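(* For every integer $n\ge3$, $$\frac{3^{3}\cdot10^{-20/9}}{\sqrt n}\le\left(\frac{\operatorname{Vol}\widetilde{\mathrm{Pos}}^{(n)}_{\mathcal Q}}{\operatorname{Vol}B_{\mathcal M}}\right)^{1/D_{\mathcal M}}.$$
   Context: Let $x=(x_1,\dots,x_n)$, $y=(y_1,\dots,y_n)$ be tuples of commuting variables, $\mathbb R[x,y]_{k_1,k_2}$ the space of polynomials homogeneous of degree $k_1$ in $x$ and of degree $k_2$ in $y$, $I\subseteq\mathbb R[x,y]$ the ideal generated by $\sum_{i=1}^n x_iy_i$, and $V(I)=\{(x,y)\in\mathbb R^n\times\mathbb R^n: y^Tx=0\}$. Put $\mathcal Q=\mathbb R[x,y]_{2,2}/(I\cap\mathbb R[x,y]_{2,2})$; elements of $\mathcal Q$ are functions on $V(I)$. Let $\mathrm{Pos}^{(n)}_{\mathcal Q}=\{p\in\mathcal Q: p(x,y)\ge 0 \text{ for all }(x,y)\in V(I)\}$. Let $T=(\mathbb S^{n-1}\times \mathbb S^{n-1})\cap V(I)$ be the set of pairs of orthonormal vectors in $\mathbb R^n$, and let $\sigma$ be the unique normalized (total mass $1$) Borel measure on $T$ invariant under the action $g(x,y)=(gx,gy)$ of $SO(n)$. Let $\mathcal H=\{f\in\mathcal Q:\int_T f\,d\sigma=1\}$, $\mathcal M=\{f\in\mathcal Q:\int_T f\,d\sigma=0\}$, and $\widetilde{\mathrm{Pos}}^{(n)}_{\mathcal Q}=\{f\in\mathcal Q: f+(\sum_i x_i^2)(\sum_i y_i^2)\in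 \mathrm{Pos}^{(n)}_{\mathcal Q}\cap\mathcal H\}\subseteq\mathcal M$. $\mathcal M$ carries the inner product $\langle f,g\rangle=\int_T fg\,d\sigma$, has dimension $D_{\mathcal M}=\binom{n+1}{2}^2-n^2-1$, and $B_{\mathcal M}$ is its unit ball. $\operatorname{Vol}$ denotes the pushforward to $\mathcal M$ of Lebesgue measure on $\mathbb R^{D_{\mathcal M}}$ under any linear isometry $\mathbb R^{D_{\mathcal M}}\to\mathcal M$ (independent of the choice). *)

theory Defs
  imports "HOL-Analysis.Analysis" "HOL-Library.Poly_Mapping"
begin

text \<open>
  The dimension \<open>n\<close> is \<^term>\<open>CARD('n)\<close>. A polynomial in \<open>x\<close> and \<open>y\<close> is a finitely supported map
  from monomials to coefficients, a monomial being a finitely supported map from variables to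
  exponents; the variable \<open>x\<^sub>i\<close> is \<^term>\<open>Inl i\<close> and \<open>y\<^sub>i\<close> is \<^term>\<open>Inr i\<close>. The ring structure
  is the one of \<^theory>\<open>HOL-Library.Poly_Mapping\<close>.
\<close>

type_synonym 'n xymonom = "('n + 'n) \<Rightarrow>\<^sub>0 nat"
type_synonym 'n xypoly = "'n xymonom \<Rightarrow>\<^sub>0 real"

definition xvar :: "'n \<Rightarrow> 'n xypoly"
  where "xvar i = Poly_Mapping.single (Poly_Mapping.single (Inl i) 1) 1"

definition yvar :: "'n \<Rightarrow> 'n xypoly"
  where "yvar i = Poly_Mapping.single (Poly_Mapping.single (Inr i) 1) 1"

definition const :: "real \<Rightarrow> 'n xypoly"
  where "const c = Poly_Mapping.single 0 c"

definition xdeg :: "'n::finite xymonom \<Rightarrow> nat"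
  where "xdeg m = (\<Sum>i\<in>UNIV. Poly_Mapping.lookup m (Inl i))"

definition ydeg :: "'n::finite xymonom \<Rightarrow> nat"
  where "ydeg m = (\<Sum>i\<in>UNIV. Poly_Mapping.lookup m (Inr i))"

definition biforms :: "nat \<Rightarrow> nat \<Rightarrow> 'n::finite xypoly set"
  where "biforms k1 k2 = {p. \<forall>m\<in>Poly_Mapping.keys p. xdeg m = k1 \<and> ydeg m = k2}"

definition monom_val :: "'n::finite xymonom \<Rightarrow> (real^'n) \<times> (real^'n) \<Rightarrow> real"
  where "monom_val m = (\<lambda>(x, y). (\<Prod>i\<in>UNIV. x $ i ^ Poly_Mapping.lookup m (Inl i)) *
                                  (\<Prod>i\<in>UNIV. y $ i ^ Poly_Mapping.lookup m (Inr i)))"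

definition poly_val :: "'n::finite xypoly \<Rightarrow> (real^'n) \<times> (real^'n) \<Rightarrow> real"
  where "poly_val p z = (\<Sum>m\<in>Poly_Mapping.keys p. Poly_Mapping.lookup p m * monom_val m z)"

definition idl :: "'n::finite xypoly set"
  where "idl = {h * (\<Sum>i\<in>UNIV. xvar i * yvar i) | h. True}"

definition variety :: "((real^'n) \<times> (real^'n)) set"
  where "variety = {(x, y). y \<bullet> x = 0}"

definition Q_rel :: "'n::finite xypoly \<Rightarrow> 'n xypoly \<Rightarrow> bool"
  where "Q_rel p p' \<longleftrightarrow> p \<in> biforms 2 2 \<and> p' \<in> biforms 2 2 \<and> p - p' \<in> idl"


lemma const_0 [simp]: "const 0 = 0"
  by (simp add: const_def)

lemma const_1 [simp]: "const 1 = 1"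
  by (simp add: const_def)

lemma const_add: "const (a + b) = const a + const b"
  by (simp add: const_def single_add)

lemma const_mult: "const (a * b) = const a * const b"
  by (simp add: const_def mult_single)

lemma idl_0: "0 \<in> idl"
  unfolding idl_def by (auto intro!: exI[of _ 0])

lemma idl_add: "p \<in> idl \<Longrightarrow> q \<in> idl \<Longrightarrow> p + q \<in> idl"
  unfolding idl_def by (auto simp: distrib_right[symmetric])

lemma idl_mult: "p \<in> idl \<Longrightarrow> h * p \<in> idl"
  unfolding idl_def by (auto simp: mult.assoc[symmetric])

lemma idl_uminus: "p \<in> idl \<Longrightarrow> - p \<in> idl"
  using idl_mult[of p "-1"] by simp

lemma xdeg_add: "xdeg (a + b) = xdeg a + xdeg b"
  by (simp add: xdeg_def lookup_add sum.distrib)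

lemma ydeg_add: "ydeg (a + b) = ydeg a + ydeg b"
  by (simp add: ydeg_def lookup_add sum.distrib)

lemma biforms_0: "0 \<in> biforms k l"
  by (simp add: biforms_def)

lemma biforms_add: "p \<in> biforms k l \<Longrightarrow> q \<in> biforms k l \<Longrightarrow> p + q \<in> biforms k l"
  using keys_add[of p q] unfolding biforms_def by blast

lemma biforms_mult: "p \<in> biforms k l \<Longrightarrow> q \<in> biforms k' l' \<Longrightarrow> p * q \<in> biforms (k + k') (l + l')"
  using keys_mult[of p q] unfolding biforms_def by (fastforce simp: xdeg_add ydeg_add)

lemma biforms_sum: "(\<And>i. i \<in> A \<Longrightarrow> f i \<in> biforms k l) \<Longrightarrow> sum f A \<in> biforms k l"
  by (induction A rule: infinite_finite_induct) (auto simp: biforms_0 biforms_add)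

lemma biforms_const: "const c \<in> biforms 0 0"
  by (simp add: biforms_def const_def xdeg_def ydeg_def)

lemma biforms_const_mult: "p \<in> biforms k l \<Longrightarrow> const c * p \<in> biforms k l"
  using biforms_mult[OF biforms_const] by fastforce

lemma biforms_uminus: "p \<in> biforms k l \<Longrightarrow> - p \<in> biforms k l"
  by (simp add: biforms_def in_keys_iff)

lemma biforms_diff: "p \<in> biforms k l \<Longrightarrow> q \<in> biforms k l \<Longrightarrow> p - q \<in> biforms k l"
  using biforms_add[OF _ biforms_uminus, of p k l q] by simp

lemma biforms_xvar: "xvar i \<in> biforms 1 0"
  by (simp add: biforms_def xvar_def xdeg_def ydeg_def lookup_single when_def)

lemma biforms_yvar: "yvar i \<in> biforms 0 1"
  by (simp add: biforms_def yvar_def xdeg_def ydeg_def lookup_single when_def)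

lemma monom_val_0: "monom_val 0 z = 1"
  by (simp add: monom_val_def split: prod.splits)

lemma monom_val_add: "monom_val (a + b) z = monom_val a z * monom_val b z"
  by (simp add: monom_val_def lookup_add power_add prod.distrib split: prod.splits)

lemma poly_val_superset:
  assumes "finite A" "Poly_Mapping.keys p \<subseteq> A"
  shows "poly_val p z = (\<Sum>m\<in>A. Poly_Mapping.lookup p m * monom_val m z)"
  unfolding poly_val_def using assms
  by (intro sum.mono_neutral_left) (auto simp: in_keys_iff)

lemma poly_val_add: "poly_val (p + q) z = poly_val p z + poly_val q z"
proof -
  let ?A = "Poly_Mapping.keys p \<union> Poly_Mapping.keys q"
  have "poly_val (p + q) z = (\<Sum>m\<in>?A. Poly_Mapping.lookup (p + q) m * monom_val m z)"
    by (rule poly_val_superset) (auto simp: keys_add)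
  also have "\<dots> = poly_val p z + poly_val q z"
    by (simp add: poly_val_superset[of ?A] lookup_add distrib_right sum.distrib)
  finally show ?thesis .
qed

lemma poly_val_0 [simp]: "poly_val 0 z = 0"
  by (simp add: poly_val_def)

lemma poly_val_uminus: "poly_val (- p) z = - poly_val p z"
  using poly_val_add[of p "- p" z] by simp

lemma poly_val_diff: "poly_val (p - q) z = poly_val p z - poly_val q z"
  using poly_val_add[of "p - q" q z] by simp

lemma poly_val_sum: "poly_val (sum f A) z = (\<Sum>i\<in>A. poly_val (f i) z)"
  by (induction A rule: infinite_finite_induct) (auto simp: poly_val_add)

lemma poly_val_single: "poly_val (Poly_Mapping.single m c) z = c * monom_val m z"
  by (simp add: poly_val_def)

lemma xypoly_monomials:
  "(\<Sum>m\<in>Poly_Mapping.keys p. Poly_Mapping.single m (Poly_Mapping.lookup p m)) = (p :: 'n xypoly)"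
  by (rule poly_mapping_eqI)
     (auto simp: lookup_sum lookup_single when_def in_keys_iff)

lemma poly_val_mult: "poly_val (p * q) z = poly_val p z * poly_val q z"
proof -
  have "p * q = (\<Sum>a\<in>Poly_Mapping.keys p. \<Sum>b\<in>Poly_Mapping.keys q.
      Poly_Mapping.single (a + b) (Poly_Mapping.lookup p a * Poly_Mapping.lookup q b))"
    by (subst (1) xypoly_monomials[of p, symmetric], subst (1) xypoly_monomials[of q, symmetric])
       (simp add: sum_product mult_single)
  then have "poly_val (p * q) z = (\<Sum>a\<in>Poly_Mapping.keys p. \<Sum>b\<in>Poly_Mapping.keys q.
      Poly_Mapping.lookup p a * Poly_Mapping.lookup q b * (monom_val a z * monom_val b z))"
    by (simp only: poly_val_sum poly_val_single monom_val_add)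
  also have "\<dots> = poly_val p z * poly_val q z"
    by (simp add: poly_val_def sum_product mult_ac)
  finally show ?thesis .
qed

lemma poly_val_xvar [simp]: "poly_val (xvar i) (x, y) = x $ i"
proof -
  have "(\<Prod>j\<in>UNIV. x $ j ^ (1 when i = j)) = (\<Prod>j\<in>UNIV. if j = i then x $ j else 1)"
    by (intro prod.cong) (auto simp: when_def)
  then show ?thesis
    by (simp add: xvar_def poly_val_single monom_val_def lookup_single)
qed

lemma poly_val_yvar [simp]: "poly_val (yvar i) (x, y) = y $ i"
proof -
  have "(\<Prod>j\<in>UNIV. y $ j ^ (1 when i = j)) = (\<Prod>j\<in>UNIV. if j = i then y $ j else 1)"
    by (intro prod.cong) (auto simp: when_def)
  then show ?thesis
    by (simp add: yvar_def poly_val_single monom_val_def lookup_single)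
qed

lemma poly_val_const: "poly_val (const c) z = c"
  by (simp add: const_def poly_val_single monom_val_0)

lemma poly_val_idl:
  assumes "p \<in> idl" "z \<in> variety"
  shows "poly_val p z = 0"
proof -
  obtain x y where z: "z = (x, y)" by (cases z)
  have "(\<Sum>i\<in>UNIV. x $ i * y $ i) = 0"
    using assms(2) by (simp add: variety_def z inner_vec_def mult.commute)
  then show ?thesis
    using assms(1) by (auto simp: idl_def poly_val_mult poly_val_sum z)
qed


text \<open>The quotient of the biforms of bidegree \<open>(2,2)\<close> by those lying in the ideal, as a type.\<close>

quotient_type 'n Q = "'n::finite xypoly" / partial: Q_rel
proof (rule part_equivpI)
  show "\<exists>p :: 'n xypoly. Q_rel p p"
    by (rule exI[of _ 0]) (simp add: Q_rel_def biforms_0 idl_0)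
  show "symp (Q_rel :: 'n xypoly \<Rightarrow> _)"
    by (rule sympI) (metis Q_rel_def idl_uminus minus_diff_eq)
  show "transp (Q_rel :: 'n xypoly \<Rightarrow> _)"
  proof (rule transpI)
    fix a b c :: "'n xypoly"
    assume "Q_rel a b" "Q_rel b c"
    then show "Q_rel a c"
      using idl_add[of "a - b" "b - c"] by (simp add: Q_rel_def)
  qed
qed

instantiation Q :: (finite) real_vector
begin

lift_definition zero_Q :: "'a Q" is 0
  by (simp add: Q_rel_def biforms_0 idl_0)

lift_definition plus_Q :: "'a Q \<Rightarrow> 'a Q \<Rightarrow> 'a Q" is "(+)"
  unfolding Q_rel_def by (metis biforms_add idl_add add_diff_add)

lift_definition uminus_Q :: "'a Q \<Rightarrow> 'a Q" is uminus
  unfolding Q_rel_def by (metis biforms_uminus idl_uminus minus_diff_minus)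

lift_definition minus_Q :: "'a Q \<Rightarrow> 'a Q \<Rightarrow> 'a Q" is "(-)"
proof -
  fix p p' q q' :: "'a xypoly"
  assume "Q_rel p p'" "Q_rel q q'"
  then show "Q_rel (p - q) (p' - q')"
    using idl_add[of "p - p'" "- (q - q')"] idl_uminus[of "q - q'"]
    by (simp add: Q_rel_def biforms_diff algebra_simps)
qed

lift_definition scaleR_Q :: "real \<Rightarrow> 'a Q \<Rightarrow> 'a Q" is "\<lambda>c p. const c * p"
  unfolding Q_rel_def by (metis biforms_const_mult idl_mult right_diff_distrib)

instance
proof
  fix a b c :: "'a Q" and r s :: real
  show "a + b + c = a + (b + c)"
    by transfer (simp add: Q_rel_def biforms_add add.assoc idl_0)
  show "a + b = b + a"
    by transfer (simp add: Q_rel_def biforms_add add.commute idl_0)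
  show "0 + a = a"
    by transfer (simp add: Q_rel_def idl_0)
  show "- a + a = 0"
    by transfer (simp add: Q_rel_def idl_0 biforms_0)
  show "a - b = a + - b"
    by transfer (simp add: Q_rel_def biforms_diff idl_0)
  show "r *\<^sub>R (a + b) = r *\<^sub>R a + r *\<^sub>R b"
    by transfer (simp add: Q_rel_def biforms_add biforms_const_mult distrib_left idl_0)
  show "(r + s) *\<^sub>R a = r *\<^sub>R a + s *\<^sub>R a"
    by transfer (simp add: Q_rel_def biforms_add biforms_const_mult const_add distrib_right idl_0)
  show "r *\<^sub>R s *\<^sub>R a = (r * s) *\<^sub>R a"
    by transfer (simp add: Q_rel_def biforms_const_mult const_mult mult.assoc idl_0)
  show "1 *\<^sub>R a = a"
    by transfer (simp add: Q_rel_def idl_0)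
qed

end

text \<open>
  An element of the quotient as a function on the variety. Off the variety its value is
  \<^const>\<open>undefined\<close>, since different representatives disagree there.
\<close>

lift_definition Q_val :: "'n::finite Q \<Rightarrow> (real^'n) \<times> (real^'n) \<Rightarrow> real"
  is "\<lambda>p. restrict (poly_val p) variety"
proof (rule restrict_ext)
  fix p p' :: "'n xypoly" and z :: "(real^'n) \<times> (real^'n)"
  assume "Q_rel p p'" "z \<in> variety"
  then show "poly_val p z = poly_val p' z"
    using poly_val_idl[of "p - p'" z] by (simp add: Q_rel_def poly_val_diff)
qed

lift_definition Q_norms :: "'n::finite Q"
  is "(\<Sum>i\<in>UNIV. xvar i ^ 2) * (\<Sum>i\<in>UNIV. yvar i ^ 2)"
proof -
  have "(\<Sum>i\<in>UNIV. xvar i ^ 2) \<in> (biforms 2 0 :: 'n xypoly set)"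
  proof (rule biforms_sum)
    fix i :: 'n
    show "xvar i ^ 2 \<in> biforms 2 0"
      using biforms_mult[OF biforms_xvar[of i] biforms_xvar[of i]]
      by (simp add: power2_eq_square numeral_2_eq_2)
  qed
  moreover have "(\<Sum>i\<in>UNIV. yvar i ^ 2) \<in> (biforms 0 2 :: 'n xypoly set)"
  proof (rule biforms_sum)
    fix i :: 'n
    show "yvar i ^ 2 \<in> biforms 0 2"
      using biforms_mult[OF biforms_yvar[of i] biforms_yvar[of i]]
      by (simp add: power2_eq_square numeral_2_eq_2)
  qed
  ultimately have "(\<Sum>i\<in>UNIV. xvar i ^ 2) * (\<Sum>i\<in>UNIV. yvar i ^ 2)
      \<in> (biforms (2 + 0) (0 + 2) :: 'n xypoly set)"
    by (rule biforms_mult)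
  then show "Q_rel ((\<Sum>i\<in>UNIV. xvar i ^ 2) * (\<Sum>i\<in>UNIV. yvar i ^ 2))
      ((\<Sum>i\<in>UNIV. xvar i ^ 2) * (\<Sum>i\<in>UNIV. yvar i ^ 2) :: 'n xypoly)"
    by (simp only: Q_rel_def add_0_right add_0_left diff_self idl_0 simp_thms)
qed

definition Pos_Q :: "'n::finite Q set"
  where "Pos_Q = {p. \<forall>z\<in>variety. Q_val p z \<ge> 0}"

definition frames :: "((real^'n) \<times> (real^'n)) set"
  where "frames = (sphere 0 1 \<times> sphere 0 1) \<inter> variety"

definition invariant_prob_on_frames :: "((real^'n) \<times> (real^'n)) measure \<Rightarrow> bool"
  where "invariant_prob_on_frames \<mu> \<longleftrightarrow>
    sets \<mu> = sets (restrict_space borel frames) \<and>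
    emeasure \<mu> frames = 1 \<and>
    (\<forall>g :: real^'n^'n. rotation_matrix g \<longrightarrow> distr \<mu> \<mu> (\<lambda>(x, y). (g *v x, g *v y)) = \<mu>)"

definition frame_measure :: "((real^'n) \<times> (real^'n)) measure"
  where "frame_measure = (THE \<mu>. invariant_prob_on_frames \<mu>)"

definition H_Q :: "'n::finite Q set"
  where "H_Q = {f. integral\<^sup>L frame_measure (Q_val f) = 1}"

definition M_Q :: "'n::finite Q set"
  where "M_Q = {f. integral\<^sup>L frame_measure (Q_val f) = 0}"

definition Pos_tilde :: "'n::finite Q set"
  where "Pos_tilde = {f. f + Q_norms \<in> Pos_Q \<inter> H_Q}"

definition inner_M :: "'n::finite Q \<Rightarrow> 'n Q \<Rightarrow> real"
  where "inner_M f g = integral\<^sup>L frame_measure (\<lambda>z. Q_val f z * Q_val g z)"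

definition ball_M :: "'n::finite Q set"
  where "ball_M = {f \<in> M_Q. sqrt (inner_M f f) \<le> 1}"

definition dim_M :: "nat \<Rightarrow> nat"
  where "dim_M n = ((n + 1) choose 2)\<^sup>2 - n\<^sup>2 - 1"

text \<open>
  An index type with \<^term>\<open>dim_M CARD('n)\<close> elements, so that \<open>real ^ 'n M_index\<close> is the Euclidean
  space of that dimension. The element \<open>0\<close> is only added because types are nonempty; it is already
  present as soon as \<open>CARD('n) \<ge> 2\<close> (see \<open>card_M_index\<close> below).
\<close>

typedef 'n M_index = "insert 0 {..<dim_M CARD('n::finite)}"
  by blast

instance M_index :: (finite) finite
proof
  show "finite (UNIV :: 'a M_index set)"
    by (simp add: type_definition.univ[OF type_definition_M_index])
qed

lemma dim_M_pos:
  assumes "n \<ge> 2"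
  shows "dim_M n > 0"
proof -
  have "(n + 1) choose 2 \<ge> n + 1"
  proof -
    have "2 * ((n + 1) choose 2) = (n + 1) * n"
      by (simp add: choose_two)
    moreover have "(n + 1) * n \<ge> (n + 1) * 2"
      using assms by (intro mult_left_mono) auto
    ultimately have "(n + 1) * 2 \<le> 2 * ((n + 1) choose 2)" by metis
    moreover have "a \<le> c" if "a * 2 \<le> 2 * c" for a c :: nat
      using that by simp
    ultimately show ?thesis by blast
  qed
  then have "((n + 1) choose 2)\<^sup>2 \<ge> (n + 1)\<^sup>2"
    by (intro power_mono) auto
  moreover have "(n + 1)\<^sup>2 > n\<^sup>2 + 1"
    using assms by (simp add: power2_eq_square)
  ultimately show ?thesis
    unfolding dim_M_def by linarith
qed

lemma card_M_index:
  assumes "CARD('n::finite) \<ge> 2"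
  shows "CARD('n M_index) = dim_M CARD('n)"
proof -
  have "CARD('n M_index) = card (insert 0 {..<dim_M CARD('n)})"
    by (rule type_definition.card[OF type_definition_M_index])
  also have "insert 0 {..<dim_M CARD('n)} = {..<dim_M CARD('n)}"
    using dim_M_pos[OF assms] by auto
  finally show ?thesis by simp
qed

definition isometry_M :: "(real ^ 'n M_index \<Rightarrow> 'n::finite Q) \<Rightarrow> bool"
  where "isometry_M \<phi> \<longleftrightarrow>
    linear \<phi> \<and> range \<phi> = M_Q \<and> (\<forall>u v. inner_M (\<phi> u) (\<phi> v) = u \<bullet> v)"

text \<open>
  Two such isometries differ by an orthogonal transformation of the domain, so the measure below does
  not depend on the choice.
\<close>

definition Vol_M :: "'n::finite Q set \<Rightarrow> real"
  where "Vol_M A = measure lebesgue ((SOME \<phi>. isometry_M \<phi>) -` A)"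

end

theory Submission
  imports Defs "HOL-Probability.Distributions"
begin

text \<open>
  Write \<open>D\<close> for the dimension of \<open>M_Q\<close>, \<open>T\<close> for the set of orthonormal frames, \<open>\<sigma>\<close> for the invariant
  probability measure on \<open>T\<close>, and let \<open>\<phi>\<close> be a linear isometry from \<open>D\<close>-dimensional Euclidean space
  onto \<open>M_Q\<close>. Evaluating \<open>\<phi> u\<close> at a frame \<open>z\<close> is a linear functional of \<open>u\<close>, hence of the form
  \<open>u \<bullet> q z\<close>, and \<open>\<phi>\<close> turns \<open>Pos_tilde\<close> into the convex body of all \<open>u\<close> with \<open>u \<bullet> q z \<ge> -1\<close> for every
  frame \<open>z\<close>. If \<open>\<bar>u \<bullet> q z\<bar> \<le> s\<close> for all \<open>z\<close>, then \<open>u / s\<close> lies in this body. It therefore suffices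
  that for \<open>s = 6 sqrt n\<close> at least half of the unit ball consists of such \<open>u\<close>: the volume ratio is then
  at least \<open>s\<^sup>-\<^sup>D / 2\<close>, and its \<open>D\<close>-th root loses only \<open>2\<close> to the power \<open>1/D\<close>, which is close to \<open>1\<close>
  because \<open>D \<ge> 26\<close>.

  The supremum over \<open>z\<close> is controlled by a high moment. Both ingredients come from one observation
  about symmetry (\<open>orthonormal_invariant_sum_squares\<close>): if orthonormal functions \<open>\<psi>\<^sub>1, \<dots>, \<psi>\<^sub>m\<close> in
  \<open>L\<^sup>2(\<sigma>)\<close> span a rotation invariant space, then \<open>\<psi>\<^sub>1\<^sup>2 + \<dots> + \<psi>\<^sub>m\<^sup>2\<close> is constant on \<open>T\<close>, since
  rotations act transitively, and integration shows that the constant is \<open>m\<close>. By Cauchy--Schwarz every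
  function \<open>h\<close> in the space satisfies \<open>h(z)\<^sup>2 \<le> m \<integral>h\<^sup>2 d\<sigma>\<close>.

  For the forms of bidegree \<open>(2j, 2j)\<close> the number \<open>m\<close> is at most the number \<open>N\<close> of monomials, and
  \<open>h = f\<^sup>j\<close> gives \<open>f(z)\<^sup>2\<^sup>j \<le> N \<integral>f\<^sup>2\<^sup>j d\<sigma>\<close> (\<open>Q_val_power_le\<close>). For \<open>M_Q\<close> itself it gives
  \<open>norm (q z) = sqrt D\<close> for every frame (\<open>isometry_kernel\<close>). The part of the unit ball on which
  \<open>u \<bullet> q z \<ge> sqrt (2t)\<close> is contained in a ball of radius \<open>sqrt (1 - 2t/D)\<close>, so it takes up at most
  the fraction \<open>exp (-t)\<close> of the volume; integrating over \<open>t\<close> bounds the average of \<open>(u \<bullet> q z)\<^sup>2\<^sup>j\<close> over the unit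
  ball by \<open>2 \<cdot> 2\<^sup>j \<cdot> j!\<close> (\<open>nn_integral_ball_moment_le\<close>). By Fubini and Markov the inequality
  \<open>sup \<bar>u \<bullet> q z\<bar> > s\<close> fails on at least half of the ball as soon as \<open>4 N j! 2\<^sup>j \<le> s\<^sup>2\<^sup>j\<close>
  (\<open>half_ball_le_sublevel\<close>), and for \<open>j = 2n\<close> the radius \<open>s = 6 sqrt n\<close> is large enough.

  Two facts make the objects in the statement meaningful. First, \<open>\<sigma>\<close> is defined by a description, so an
  invariant probability measure has to be constructed (by orthonormalising a random pair of vectors) and
  shown to be unique; uniqueness is Christensen's argument for measures that give equal mass to balls
  of equal radius (\<open>uniformly_distributed_unique\<close>), which also yields the rotation invariance
  of Lebesgue measure used in the construction. Second, the volume refers to an isometry from a space of dimension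
  exactly \<open>dim_M n\<close>, so the dimension of \<open>Q\<close> is needed, together with the fact that a biform
  vanishing on all frames is zero in \<open>Q\<close>. Both follow from a normal form modulo the ideal: the
  monomials not divisible by \<open>x\<^sub>i y\<^sub>i\<close>, for one fixed \<open>i\<close>, represent every class
  (\<open>normal_form\<close>) and are linearly independent as functions on the variety (\<open>normal_vanishing\<close>).
\<close>

section \<open>Normal forms modulo the ideal\<close>

definition normal_monom :: "'n::finite \<Rightarrow> 'n xymonom \<Rightarrow> bool"
  where "normal_monom i m \<longleftrightarrow> Poly_Mapping.lookup m (Inl i) = 0 \<or> Poly_Mapping.lookup m (Inr i) = 0"

lemma biforms_single:
  "Poly_Mapping.single m c \<in> biforms k l \<longleftrightarrow> c = 0 \<or> (xdeg m = k \<and> ydeg m = l)"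
  by (auto simp: biforms_def)

lemma idl_sum: "(\<And>i. i \<in> A \<Longrightarrow> f i \<in> idl) \<Longrightarrow> sum f A \<in> idl"
  by (induction A rule: infinite_finite_induct) (auto simp: idl_0 idl_add)

text \<open>
  The relation \<open>\<Sum>\<^sub>j x\<^sub>j y\<^sub>j = 0\<close> rewrites the product \<open>x\<^sub>i y\<^sub>i\<close> into the negative sum of the \<open>x\<^sub>j y\<^sub>j\<close> with
  \<open>j \<noteq> i\<close>. Each step lowers the exponent of \<open>x\<^sub>i\<close>, so the rewriting stops, at normal monomials.
\<close>

lemma normal_form_monom:
  fixes m :: "'n::finite xymonom"
  assumes "xdeg m = k" "ydeg m = l"
  shows "\<exists>p\<in>biforms k l. (\<forall>m'\<in>Poly_Mapping.keys p. normal_monom i m') \<and> Poly_Mapping.single m c - p \<in> idl"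
  using assms
proof (induction "Poly_Mapping.lookup m (Inl i)" arbitrary: m c)
  case 0
  then show ?case
    by (intro bexI[of _ "Poly_Mapping.single m c"])
       (auto simp: normal_monom_def idl_0 biforms_single)
next
  case (Suc a)
  show ?case
  proof (cases "Poly_Mapping.lookup m (Inr i) = 0")
    case True
    with Suc.prems show ?thesis
      by (intro bexI[of _ "Poly_Mapping.single m c"])
         (auto simp: normal_monom_def idl_0 biforms_single)
  next
    case False
    define u :: "'n \<Rightarrow> 'n xymonom"
      where "u j = Poly_Mapping.single (Inl j) 1 + Poly_Mapping.single (Inr j) 1" for j
    define r where "r = m - u i"
    have r: "m = r + u i"
      unfolding r_def u_def using Suc(2) False
      by (intro poly_mapping_eqI) (auto simp: lookup_add lookup_minus lookup_single when_def)
    have deg_u: "xdeg (u j) = 1" "ydeg (u j) = 1" for j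
      by (simp_all add: u_def xdeg_def ydeg_def lookup_add lookup_single when_def)
    have a: "Poly_Mapping.lookup (r + u j) (Inl i) = a" if "j \<noteq> i" for j
    proof -
      have "Poly_Mapping.lookup r (Inl i) + 1 = Suc a"
        using Suc(2) by (simp add: r u_def lookup_add lookup_single)
      then show ?thesis
        using that by (simp add: lookup_add u_def lookup_single when_def)
    qed
    have "\<exists>p\<in>biforms k l. (\<forall>m'\<in>Poly_Mapping.keys p. normal_monom i m') \<and>
        Poly_Mapping.single (r + u j) (- c) - p \<in> idl" if "j \<noteq> i" for j
    proof (rule Suc(1))
      show "a = Poly_Mapping.lookup (r + u j) (Inl i)" using a[OF that] by simp
      show "xdeg (r + u j) = k" "ydeg (r + u j) = l"
        using Suc.prems by (simp_all add: r xdeg_add ydeg_add deg_u)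
    qed
    then obtain P where P: "\<And>j. j \<noteq> i \<Longrightarrow> P j \<in> biforms k l"
      "\<And>j. j \<noteq> i \<Longrightarrow> \<forall>m'\<in>Poly_Mapping.keys (P j). normal_monom i m'"
      "\<And>j. j \<noteq> i \<Longrightarrow> Poly_Mapping.single (r + u j) (- c) - P j \<in> idl"
      by metis
    have xy: "xvar j * yvar j = Poly_Mapping.single (u j) 1" for j :: 'n
      by (simp add: xvar_def yvar_def mult_single u_def)
    have "(\<Sum>j\<in>UNIV. Poly_Mapping.single (r + u j) c) = Poly_Mapping.single r c * (\<Sum>j\<in>UNIV. xvar j * yvar j)"
      by (simp add: sum_distrib_left xy mult_single)
    then have all: "(\<Sum>j\<in>UNIV. Poly_Mapping.single (r + u j) c) \<in> idl"
      unfolding idl_def by blast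
    have rest: "(\<Sum>j\<in>-{i}. Poly_Mapping.single (r + u j) (- c) - P j) \<in> idl"
      by (rule idl_sum) (simp add: P)
    have "(\<Sum>j\<in>UNIV. Poly_Mapping.single (r + u j) c)
        = Poly_Mapping.single m c + (\<Sum>j\<in>-{i}. Poly_Mapping.single (r + u j) c)"
      by (simp add: sum.remove[of UNIV i] r Compl_eq_Diff_UNIV)
    then have "Poly_Mapping.single m c - sum P (-{i})
       = (\<Sum>j\<in>UNIV. Poly_Mapping.single (r + u j) c) + (\<Sum>j\<in>-{i}. Poly_Mapping.single (r + u j) (- c) - P j)"
      by (simp add: sum_subtractf single_uminus sum_negf)
    then have *: "Poly_Mapping.single m c - sum P (-{i}) \<in> idl"
      using idl_add[OF all rest] by simp
    have "Poly_Mapping.keys (sum P (-{i})) \<subseteq> (\<Union>j\<in>-{i}. Poly_Mapping.keys (P j))"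
      by (rule keys_sum)
    then have "\<forall>m'\<in>Poly_Mapping.keys (sum P (-{i})). normal_monom i m'"
      using P(2) by blast
    moreover have "sum P (-{i}) \<in> biforms k l"
      by (rule biforms_sum) (simp add: P)
    ultimately show ?thesis using * by blast
  qed
qed

lemma normal_form:
  assumes "p \<in> biforms k l"
  shows "\<exists>p'\<in>biforms k l. (\<forall>m\<in>Poly_Mapping.keys p'. normal_monom i m) \<and> p - p' \<in> idl"
proof -
  have "\<forall>m\<in>Poly_Mapping.keys p. \<exists>q\<in>biforms k l. (\<forall>m'\<in>Poly_Mapping.keys q. normal_monom i m') \<and>
      Poly_Mapping.single m (Poly_Mapping.lookup p m) - q \<in> idl"
    using assms by (intro ballI normal_form_monom) (auto simp: biforms_def)
  then obtain P where P: "\<And>m. m \<in> Poly_Mapping.keys p \<Longrightarrow> P m \<in> biforms k l"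
      "\<And>m. m \<in> Poly_Mapping.keys p \<Longrightarrow> \<forall>m'\<in>Poly_Mapping.keys (P m). normal_monom i m'"
      "\<And>m. m \<in> Poly_Mapping.keys p \<Longrightarrow> Poly_Mapping.single m (Poly_Mapping.lookup p m) - P m \<in> idl"
    by metis
  let ?q = "\<Sum>m\<in>Poly_Mapping.keys p. P m"
  have "p - ?q = (\<Sum>m\<in>Poly_Mapping.keys p. Poly_Mapping.single m (Poly_Mapping.lookup p m) - P m)"
    by (simp add: sum_subtractf xypoly_monomials)
  also have "\<dots> \<in> idl"
    by (rule idl_sum) (simp add: P)
  finally have "p - ?q \<in> idl" .
  moreover have "Poly_Mapping.keys ?q \<subseteq> (\<Union>m\<in>Poly_Mapping.keys p. Poly_Mapping.keys (P m))"
    by (rule keys_sum)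
  then have "\<forall>m'\<in>Poly_Mapping.keys ?q. normal_monom i m'"
    using P(2) by blast
  moreover have "?q \<in> biforms k l"
    by (rule biforms_sum) (simp add: P)
  ultimately show ?thesis by blast
qed

lemma power_tendsto_indicator:
  fixes r :: real assumes "0 \<le> r" "r \<le> 1"
  shows "(\<lambda>s. r ^ s) \<longlonglongrightarrow> (if r = 1 then 1 else 0)"
  using assms by (auto intro!: LIMSEQ_power_zero)

text \<open>
  The polynomial is restricted to a sequence of points of the variety along which the normal monomials
  have pairwise different exponential growth, so that the fastest of them would dominate. The free
  coordinates are \<open>q v ^ s\<close> for distinct primes \<open>q v\<close>, and the coordinate \<open>x\<^sub>i\<close> is solved from
  \<open>y \<bullet> x = 0\<close>; it grows like \<open>\<rho> ^ s\<close>, where \<open>\<rho> = q(x\<^sub>k) q(y\<^sub>k) / q(y\<^sub>i)\<close> and \<open>k\<close> maximises \<open>q(x\<^sub>k) q(y\<^sub>k)\<close>.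
  By unique factorisation the growth rate of a normal monomial determines its exponents. Normality is essential,
  because multiplying by \<open>x\<^sub>i y\<^sub>i\<close> and multiplying by \<open>x\<^sub>k y\<^sub>k\<close> change the growth rate by the same factor.
\<close>

lemma normal_vanishing:
  fixes p :: "'n::finite xypoly"
  assumes n: "CARD('n) \<ge> 2"
    and normal: "\<And>m. m \<in> Poly_Mapping.keys p \<Longrightarrow> normal_monom i m"
    and vanish: "\<And>z. z \<in> variety \<Longrightarrow> poly_val p z = 0"
  shows "p = 0"
proof (rule ccontr)
  assume "p \<noteq> 0"
  obtain q :: "'n + 'n \<Rightarrow> nat" where q: "inj q" "\<And>v. prime (q v)"
  proof -
    obtain e :: "nat \<Rightarrow> nat" where e: "inj e" "range e \<subseteq> {p. prime p}"
      using infinite_countable_subset[OF primes_infinite] by auto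
    obtain f :: "'n + 'n \<Rightarrow> nat" where f: "inj f"
      using finite_imp_inj_to_nat_seg[of "UNIV :: ('n + 'n) set"] by auto
    have "inj (e \<circ> f)" using e(1) f by (rule inj_compose)
    moreover have "prime ((e \<circ> f) v)" for v using e(2) by auto
    ultimately show ?thesis by (rule that)
  qed
  define y0 where "y0 = real (q (Inr i))"
  define t where "t k = real (q (Inl k)) * real (q (Inr k))" for k
  have qpos: "real (q v) > 0" for v using q(2)[of v] prime_gt_0_nat by simp
  have tpos: "t k > 0" and y0: "y0 > 0" for k
    using qpos by (auto simp: t_def y0_def)
  have ne: "-{i} \<noteq> ({} :: 'n set)"
  proof
    assume "-{i} = ({} :: 'n set)"
    then have "(UNIV :: 'n set) = {i}" by auto
    then have "CARD('n) = card {i}" by (rule arg_cong)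
    with n show False by simp
  qed
  obtain k0 where k0: "k0 \<noteq> i" "\<And>k. k \<noteq> i \<Longrightarrow> t k \<le> t k0"
  proof -
    have "Max (t ` (-{i})) \<in> t ` (-{i})" using ne by (intro Max_in) auto
    then obtain k0 where "k0 \<noteq> i" "t k0 = Max (t ` (-{i}))" by fastforce
    then show ?thesis using that[of k0] by (metis Max_ge ComplI finite finite_imageI image_eqI singletonD)
  qed
  define \<rho> where "\<rho> = t k0 / y0"
  have \<rho>: "\<rho> > 0" by (simp add: \<rho>_def tpos y0)
  \<comment> \<open>The coordinate \<open>x\<^sub>i\<close> divided by \<open>\<rho> ^ s\<close>; it tends to \<open>- c\<close>, where \<open>c\<close> counts the indices attaining the maximum.\<close>
  define R where "R s = - (\<Sum>k\<in>-{i}. (t k / t k0) ^ s)" for s :: nat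
  define c where "c = (\<Sum>k\<in>-{i}. if t k / t k0 = 1 then 1 else 0 :: real)"
  have c: "c \<ge> 1"
  proof -
    have "c \<ge> (\<Sum>k\<in>{k0}. if t k / t k0 = 1 then 1 else 0 :: real)"
      unfolding c_def by (rule sum_mono2) (use k0 in auto)
    then show ?thesis using tpos[of k0] by simp
  qed
  have R: "R \<longlonglongrightarrow> - c"
    unfolding R_def c_def
    by (intro tendsto_minus tendsto_sum power_tendsto_indicator)
       (use k0 tpos in \<open>auto simp: less_imp_le\<close>)
  define z where "z s = ((\<chi> j. if j = i then R s * \<rho> ^ s else real (q (Inl j)) ^ s) :: real^'n,
      (\<chi> j. real (q (Inr j)) ^ s) :: real^'n)" for s
  have z: "z s \<in> variety" for s
  proof -
    have "(\<Sum>j\<in>UNIV. real (q (Inr j)) ^ s * (if j = i then R s * \<rho> ^ s else real (q (Inl j)) ^ s))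
       = y0 ^ s * (R s * \<rho> ^ s) + (\<Sum>j\<in>-{i}. t j ^ s)"
      by (simp add: sum.remove[of UNIV i] Compl_eq_Diff_UNIV y0_def t_def power_mult_distrib mult.commute)
    also have "y0 ^ s * (R s * \<rho> ^ s) = R s * t k0 ^ s"
      using y0 by (simp add: \<rho>_def power_divide)
    also have "\<dots> = - (\<Sum>j\<in>-{i}. t j ^ s)"
      using tpos[of k0] by (simp add: R_def sum_distrib_right power_divide)
    finally show ?thesis by (simp add: z_def variety_def inner_vec_def)
  qed
  define \<alpha> where "\<alpha> m = Poly_Mapping.lookup m (Inl i)" for m :: "'n xymonom"
  define w where "w m = \<rho> ^ \<alpha> m * (\<Prod>v\<in>-{Inl i}. real (q v) ^ Poly_Mapping.lookup m v)" for m
  have wpos: "w m > 0" for m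
    unfolding w_def using \<rho> qpos by (intro mult_pos_pos prod_pos) auto
  have val: "monom_val m (z s) = R s ^ \<alpha> m * w m ^ s" for m s
  proof -
    have UN: "-{Inl i} = Inl ` (-{i}) \<union> (Inr ` UNIV :: ('n + 'n) set)"
    proof (rule set_eqI)
      fix v :: "'n + 'n"
      show "v \<in> -{Inl i} \<longleftrightarrow> v \<in> Inl ` (-{i}) \<union> Inr ` UNIV"
        by (cases v) auto
    qed
    have "(\<Prod>v\<in>-{Inl i}. real (q v) ^ Poly_Mapping.lookup m v)
       = (\<Prod>j\<in>-{i}. real (q (Inl j)) ^ Poly_Mapping.lookup m (Inl j)) * (\<Prod>j\<in>UNIV. real (q (Inr j)) ^ Poly_Mapping.lookup m (Inr j))"
      unfolding UN by (subst prod.union_disjoint) (auto simp: prod.reindex inj_on_def)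
    then show ?thesis
      unfolding monom_val_def z_def w_def \<alpha>_def
      by (simp add: prod.remove[of UNIV i] Compl_eq_Diff_UNIV power_mult_distrib prod_power_distrib
          flip: power_mult) (simp add: mult.commute)
  qed
  \<comment> \<open>Multiplying by a power of \<open>y0\<close> clears the denominator of \<open>\<rho>\<close>; then the exponents are compared prime by prime.\<close>
  have winj: "m = m'" if eq: "w m = w m'" and nm: "normal_monom i m" "normal_monom i m'" for m m'
  proof -
    define g where "g m m' v = (if v = Inl i then 0 else Poly_Mapping.lookup m v) +
       (if v = Inl k0 \<or> v = Inr k0 then \<alpha> m else 0) + (if v = Inr i then \<alpha> m' else 0)" for m m' v
    have w_nat: "w m * y0 ^ (\<alpha> m + \<alpha> m') = real (\<Prod>v\<in>UNIV. q v ^ g m m' v)" for m m'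
    proof -
      have "(\<Prod>v\<in>UNIV. real (q v) ^ g m m' v) =
         (\<Prod>v\<in>UNIV. real (q v) ^ (if v = Inl i then 0 else Poly_Mapping.lookup m v)) *
         (\<Prod>v\<in>UNIV. real (q v) ^ (if v = Inl k0 \<or> v = Inr k0 then \<alpha> m else 0)) *
         (\<Prod>v\<in>UNIV. real (q v) ^ (if v = Inr i then \<alpha> m' else 0))"
        by (simp add: g_def power_add prod.distrib)
      also have "(\<Prod>v\<in>UNIV. real (q v) ^ (if v = Inl i then 0 else Poly_Mapping.lookup m v))
          = (\<Prod>v\<in>-{Inl i}. real (q v) ^ Poly_Mapping.lookup m v)"
        by (rule prod.mono_neutral_cong_right) auto
      also have "(\<Prod>v\<in>UNIV. real (q v) ^ (if v = Inl k0 \<or> v = Inr k0 then \<alpha> m else 0))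
          = (\<Prod>v\<in>{Inl k0, Inr k0}. real (q v) ^ \<alpha> m)"
        by (rule prod.mono_neutral_cong_right) auto
      also have "(\<Prod>v\<in>UNIV. real (q v) ^ (if v = Inr i then \<alpha> m' else 0))
          = (\<Prod>v\<in>{Inr i}. real (q v) ^ \<alpha> m')"
        by (rule prod.mono_neutral_cong_right) auto
      finally show ?thesis
        using y0 by (simp add: w_def \<rho>_def t_def y0_def power_add power_divide power_mult_distrib)
    qed
    have "real (\<Prod>v\<in>UNIV. q v ^ g m m' v) = real (\<Prod>v\<in>UNIV. q v ^ g m' m v)"
      unfolding w_nat[symmetric] using eq by (simp add: add.commute)
    then have eq': "(\<Prod>v\<in>UNIV. q v ^ g m m' v) = (\<Prod>v\<in>UNIV. q v ^ g m' m v)"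
      by (simp only: of_nat_eq_iff)
    have mult: "multiplicity (q v) (\<Prod>v\<in>UNIV. q v ^ h v) = h v" for h :: "'n + 'n \<Rightarrow> nat" and v
    proof -
      have "(\<Prod>v\<in>UNIV. q v ^ h v) = (\<Prod>a\<in>range q. a ^ h (inv q a))"
        using q(1) by (subst prod.reindex) (auto simp: inv_f_f)
      then show ?thesis
        using q by (simp only:) (subst multiplicity_prod_prime_powers, auto simp: inv_f_f)
    qed
    have geq: "g m m' v = g m' m v" for v
      using arg_cong[OF eq', of "multiplicity (q v)"] by (simp only: mult)
    have "Poly_Mapping.lookup m (Inr i) + \<alpha> m' = Poly_Mapping.lookup m' (Inr i) + \<alpha> m"
      using geq[of "Inr i"] k0(1) by (simp add: g_def)
    then have \<alpha>eq: "\<alpha> m = \<alpha> m'"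
      using nm unfolding normal_monom_def \<alpha>_def by auto
    show ?thesis
    proof (rule poly_mapping_eqI)
      fix v show "Poly_Mapping.lookup m v = Poly_Mapping.lookup m' v"
      proof (cases "v = Inl i")
        case True then show ?thesis using \<alpha>eq by (simp add: \<alpha>_def)
      next
        case False then show ?thesis using geq[of v] by (simp add: g_def \<alpha>eq split: if_splits)
      qed
    qed
  qed
  have kne: "Poly_Mapping.keys p \<noteq> {}" using \<open>p \<noteq> 0\<close> by simp
  obtain M where M: "M \<in> Poly_Mapping.keys p" "\<And>m. m \<in> Poly_Mapping.keys p \<Longrightarrow> w m \<le> w M"
  proof -
    have "Max (w ` Poly_Mapping.keys p) \<in> w ` Poly_Mapping.keys p" using kne by (intro Max_in) auto
    then obtain M where "M \<in> Poly_Mapping.keys p" "w M = Max (w ` Poly_Mapping.keys p)" by auto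
    then show ?thesis using that[of M] by (metis Max_ge finite_keys finite_imageI image_eqI)
  qed
  let ?c = "\<lambda>m. Poly_Mapping.lookup p m"
  have "(\<lambda>s. \<Sum>m\<in>Poly_Mapping.keys p. ?c m * (R s ^ \<alpha> m * (w m / w M) ^ s))
      \<longlonglongrightarrow> (\<Sum>m\<in>Poly_Mapping.keys p. ?c m * ((- c) ^ \<alpha> m * (if w m / w M = 1 then 1 else 0)))"
    by (intro tendsto_sum tendsto_mult tendsto_const tendsto_power R power_tendsto_indicator)
       (use M wpos in \<open>auto simp: less_imp_le\<close>)
  moreover have "(\<Sum>m\<in>Poly_Mapping.keys p. ?c m * (R s ^ \<alpha> m * (w m / w M) ^ s)) = 0" for s
  proof -
    have "(\<Sum>m\<in>Poly_Mapping.keys p. ?c m * (R s ^ \<alpha> m * (w m / w M) ^ s)) = poly_val p (z s) / w M ^ s"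
      by (simp add: poly_val_def val sum_divide_distrib power_divide)
    then show ?thesis using vanish[OF z] by simp
  qed
  ultimately have "(\<Sum>m\<in>Poly_Mapping.keys p. ?c m * ((- c) ^ \<alpha> m * (if w m / w M = 1 then 1 else 0))) = 0"
    by (simp add: LIMSEQ_const_iff)
  moreover have "(\<Sum>m\<in>Poly_Mapping.keys p. ?c m * ((- c) ^ \<alpha> m * (if w m / w M = 1 then 1 else 0)))
      = (\<Sum>m\<in>{M}. ?c m * (- c) ^ \<alpha> m)"
    using M winj[OF _ normal normal] wpos[of M] by (intro sum.mono_neutral_cong_right) auto
  ultimately have "?c M * (- c) ^ \<alpha> M = 0" by simp
  with c M(1) show False by (simp add: in_keys_iff)
qed

section \<open>Monomials and substitutions\<close>

text \<open>
  Functions on a finite type correspond to lists of length \<^term>\<open>CARD('n)\<close>, for which the count is known.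
\<close>

lemma card_functions_sum:
  "card {f :: 'n::finite \<Rightarrow> nat. sum f UNIV = k} = (k + CARD('n) - 1) choose k"
proof -
  obtain h where h: "bij_betw h {..<CARD('n)} (UNIV :: 'n set)"
    using ex_bij_betw_nat_finite[of "UNIV :: 'n set"] by (auto simp: atLeast0LessThan)
  let ?n = "CARD('n)"
  let ?L = "{l :: nat list. length l = ?n \<and> sum_list l = k}"
  have "bij_betw (\<lambda>f. map (f \<circ> h) [0..<?n]) {f. sum f UNIV = k} ?L"
  proof (rule bij_betw_byWitness[where f' = "\<lambda>l x. l ! inv_into {..<?n} h x"])
    show "\<forall>f\<in>{f. sum f UNIV = k}. (\<lambda>x. map (f \<circ> h) [0..<?n] ! inv_into {..<?n} h x) = f"
    proof (intro ballI ext)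
      fix f x
      have "inv_into {..<?n} h x \<in> {..<?n}" "h (inv_into {..<?n} h x) = x"
        using h inv_into_into[of x h "{..<?n}"] f_inv_into_f[of x h "{..<?n}"] by (auto simp: bij_betw_def)
      then show "map (f \<circ> h) [0..<?n] ! inv_into {..<?n} h x = f x" by simp
    qed
    show "\<forall>l\<in>?L. map ((\<lambda>x. l ! inv_into {..<?n} h x) \<circ> h) [0..<?n] = l"
      using h by (auto intro!: nth_equalityI simp: inv_into_f_f bij_betw_def)
    have "sum_list (map (f \<circ> h) [0..<?n]) = sum f UNIV" for f :: "'n \<Rightarrow> nat"
      using sum.reindex_bij_betw[OF h, of f] by (simp add: interv_sum_list_conv_sum_set_nat atLeast0LessThan)
    then show "(\<lambda>f. map (f \<circ> h) [0..<?n]) ` {f. sum f UNIV = k} \<subseteq> ?L" by auto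
    show "(\<lambda>l x. l ! inv_into {..<?n} h x) ` ?L \<subseteq> {f. sum f UNIV = k}"
    proof clarsimp
      fix l :: "nat list" assume l: "length l = ?n" "k = sum_list l"
      have "(\<Sum>x\<in>UNIV. l ! inv_into {..<?n} h x) = (\<Sum>i\<in>{..<?n}. l ! inv_into {..<?n} h (h i))"
        using sum.reindex_bij_betw[OF h, of "\<lambda>x. l ! inv_into {..<?n} h x"] by simp
      also have "\<dots> = (\<Sum>i\<in>{..<?n}. l ! i)"
        using h by (intro sum.cong) (auto simp: inv_into_f_f bij_betw_def)
      finally show "(\<Sum>x\<in>UNIV. l ! inv_into {..<?n} h x) = sum_list l"
        by (simp add: sum_list_sum_nth l atLeast0LessThan)
    qed
  qed
  then show ?thesis
    using bij_betw_same_card card_length_sum_list[of ?n k] by fastforce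
qed

definition bimonoms :: "nat \<Rightarrow> nat \<Rightarrow> 'n::finite xymonom set"
  where "bimonoms k l = {m. xdeg m = k \<and> ydeg m = l}"

lemma bij_betw_bimonoms:
  "bij_betw (\<lambda>m. (\<lambda>i. Poly_Mapping.lookup m (Inl i), \<lambda>i. Poly_Mapping.lookup m (Inr i)))
    (bimonoms k l :: 'n::finite xymonom set)
    ({f. sum f UNIV = k} \<times> {f. sum f UNIV = l})"
proof (rule bij_betw_byWitness[where f' = "\<lambda>(f, g). Abs_poly_mapping (case_sum f g)"])
  have [simp]: "Poly_Mapping.lookup (Abs_poly_mapping h) = h" for h :: "'n + 'n \<Rightarrow> nat"
    by (rule lookup_Abs_poly_mapping) simp
  show "\<forall>m\<in>bimonoms k l. (case (\<lambda>i. Poly_Mapping.lookup m (Inl i), \<lambda>i. Poly_Mapping.lookup m (Inr i)) of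
      (f, g) \<Rightarrow> Abs_poly_mapping (case_sum f g)) = (m :: 'n xymonom)"
    by (auto intro!: poly_mapping_eqI split: sum.splits)
  show "\<forall>fg\<in>{f. sum f UNIV = k} \<times> {f. sum f UNIV = l}.
       (\<lambda>i. Poly_Mapping.lookup (case fg of (f, g) \<Rightarrow> Abs_poly_mapping (case_sum f g)) (Inl i),
        \<lambda>i. Poly_Mapping.lookup (case fg of (f, g) \<Rightarrow> Abs_poly_mapping (case_sum f g)) (Inr i)) = (fg :: ('n \<Rightarrow> nat) \<times> ('n \<Rightarrow> nat))"
    by auto
  show "(\<lambda>m. (\<lambda>i. Poly_Mapping.lookup m (Inl i), \<lambda>i. Poly_Mapping.lookup m (Inr i))) ` bimonoms k l
    \<subseteq> ({f :: 'n \<Rightarrow> nat. sum f UNIV = k} \<times> {f. sum f UNIV = l})"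
    by (auto simp: bimonoms_def xdeg_def ydeg_def)
  show "(\<lambda>(f, g). Abs_poly_mapping (case_sum f g)) ` ({f. sum f UNIV = k} \<times> {f. sum f UNIV = l})
      \<subseteq> (bimonoms k l :: 'n xymonom set)"
    by (auto simp: bimonoms_def xdeg_def ydeg_def)
qed

lemma finite_functions_sum: "finite {f :: 'n::finite \<Rightarrow> nat. sum f UNIV = k}"
proof (rule finite_subset)
  show "{f :: 'n \<Rightarrow> nat. sum f UNIV = k} \<subseteq> UNIV \<rightarrow>\<^sub>E {..k}"
    by (auto simp: member_le_sum)
  show "finite ((UNIV :: 'n set) \<rightarrow>\<^sub>E {..k})"
    by (rule finite_PiE) auto
qed

lemma finite_bimonoms: "finite (bimonoms k l)"
  using bij_betw_finite[OF bij_betw_bimonoms] finite_functions_sum by blast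

lemma card_bimonoms:
  "card (bimonoms k l :: 'n::finite xymonom set)
    = ((k + CARD('n) - 1) choose k) * ((l + CARD('n) - 1) choose l)"
  using bij_betw_same_card[OF bij_betw_bimonoms[where 'n = 'n, of k l]]
  by (simp add: card_cartesian_product card_functions_sum)

text \<open>
  The remaining monomials are the multiples of \<open>x\<^sub>i y\<^sub>i\<close>, one for each of the \<open>n\<^sup>2\<close> monomials of bidegree \<open>(1, 1)\<close>.
\<close>

lemma card_normal_monoms:
  "card {m \<in> bimonoms 2 2. normal_monom (i :: 'n::finite) m} = ((CARD('n) + 1) choose 2)\<^sup>2 - CARD('n)\<^sup>2"
proof -
  define u :: "'n xymonom" where "u = Poly_Mapping.single (Inl i) 1 + Poly_Mapping.single (Inr i) 1"
  have n: "CARD('n) > 0" by simp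
  have deg_u: "xdeg u = 1" "ydeg u = 1"
    by (simp_all add: u_def xdeg_def ydeg_def lookup_add lookup_single when_def)
  let ?N = "{m \<in> bimonoms 2 2. normal_monom i m}"
  have eq: "bimonoms 2 2 = ?N \<union> (\<lambda>r. r + u) ` bimonoms 1 1"
  proof
    show "bimonoms 2 2 \<subseteq> ?N \<union> (\<lambda>r. r + u) ` bimonoms 1 1"
    proof
      fix m :: "'n xymonom" assume m: "m \<in> bimonoms 2 2"
      show "m \<in> ?N \<union> (\<lambda>r. r + u) ` bimonoms 1 1"
      proof (cases "normal_monom i m")
        case False
        have r: "m = (m - u) + u"
          unfolding u_def using False
          by (intro poly_mapping_eqI) (auto simp: lookup_add lookup_minus lookup_single when_def normal_monom_def)
        moreover have "m - u \<in> bimonoms 1 1"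
          using m deg_u xdeg_add[of "m - u" u] ydeg_add[of "m - u" u]
          by (simp add: bimonoms_def flip: r)
        ultimately show ?thesis by blast
      qed (use m in auto)
    qed
    show "?N \<union> (\<lambda>r. r + u) ` bimonoms 1 1 \<subseteq> bimonoms 2 2"
      by (auto simp: bimonoms_def xdeg_add ydeg_add deg_u)
  qed
  have disj: "?N \<inter> (\<lambda>r. r + u) ` bimonoms 1 1 = {}"
    by (auto simp: normal_monom_def u_def lookup_add lookup_single)
  have "card (bimonoms 2 2 :: 'n xymonom set) = card ?N + card ((\<lambda>r. r + u) ` bimonoms 1 1)"
    by (subst eq, rule card_Un_disjoint) (use finite_bimonoms disj in \<open>auto intro: rev_finite_subset[OF finite_bimonoms]\<close>)
  also have "card ((\<lambda>r. r + u) ` bimonoms 1 1) = card (bimonoms 1 1 :: 'n xymonom set)"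
    by (rule card_image) (auto simp: inj_on_def)
  finally show ?thesis
    using n by (simp add: card_bimonoms power2_eq_square)
qed

lemma poly_val_const_mult: "poly_val (const c * p) z = c * poly_val p z"
  by (simp add: poly_val_mult poly_val_const)

lemma poly_val_1 [simp]: "poly_val 1 z = 1"
  using poly_val_const[of 1 z] by simp

lemma poly_val_power: "poly_val (p ^ k) z = poly_val p z ^ k"
  by (induction k) (auto simp: poly_val_mult)

lemma poly_val_prod: "poly_val (prod f A) z = (\<Prod>i\<in>A. poly_val (f i) z)"
  by (induction A rule: infinite_finite_induct) (auto simp: poly_val_mult)

lemma biforms_1: "1 \<in> biforms 0 0"
  using biforms_const[of 1] by simp

lemma biforms_power: "p \<in> biforms k l \<Longrightarrow> p ^ a \<in> biforms (a * k) (a * l)"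
  by (induction a) (auto simp: biforms_1 dest: biforms_mult)

lemma biforms_prod:
  "(\<And>i. i \<in> A \<Longrightarrow> f i \<in> biforms (k i) (l i)) \<Longrightarrow> finite A \<Longrightarrow> prod f A \<in> biforms (sum k A) (sum l A)"
  by (induction A rule: infinite_finite_induct) (auto simp: biforms_1 biforms_mult)

lemma biforms_rotate:
  fixes g :: "real^'n::finite^'n"
  assumes "p \<in> biforms k l"
  shows "\<exists>p'\<in>biforms k l. \<forall>x y. poly_val p' (x, y) = poly_val p (g *v x, g *v y)"
proof -
  define X where "X i = (\<Sum>j\<in>UNIV. const (g $ i $ j) * xvar j)" for i
  define Y where "Y i = (\<Sum>j\<in>UNIV. const (g $ i $ j) * yvar j)" for i
  have X: "X i \<in> biforms 1 0" for i
    unfolding X_def by (intro biforms_sum biforms_const_mult biforms_xvar)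
  have Y: "Y i \<in> biforms 0 1" for i
    unfolding Y_def by (intro biforms_sum biforms_const_mult biforms_yvar)
  define M where "M m = (\<Prod>i\<in>UNIV. X i ^ Poly_Mapping.lookup m (Inl i)) *
      (\<Prod>i\<in>UNIV. Y i ^ Poly_Mapping.lookup m (Inr i))" for m
  have M: "M m \<in> biforms (xdeg m) (ydeg m)" for m
  proof -
    have "(\<Prod>i\<in>UNIV. X i ^ Poly_Mapping.lookup m (Inl i)) \<in>
       biforms (\<Sum>i\<in>UNIV. Poly_Mapping.lookup m (Inl i) * 1) (\<Sum>i\<in>UNIV. Poly_Mapping.lookup m (Inl i) * 0)"
      by (intro biforms_prod biforms_power X) auto
    moreover have "(\<Prod>i\<in>UNIV. Y i ^ Poly_Mapping.lookup m (Inr i)) \<in>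
       biforms (\<Sum>i\<in>UNIV. Poly_Mapping.lookup m (Inr i) * 0) (\<Sum>i\<in>UNIV. Poly_Mapping.lookup m (Inr i) * 1)"
      by (intro biforms_prod biforms_power Y) auto
    ultimately have "M m \<in> biforms
        ((\<Sum>i\<in>UNIV. Poly_Mapping.lookup m (Inl i) * 1) + (\<Sum>i\<in>UNIV. Poly_Mapping.lookup m (Inr i) * 0))
        ((\<Sum>i\<in>UNIV. Poly_Mapping.lookup m (Inl i) * 0) + (\<Sum>i\<in>UNIV. Poly_Mapping.lookup m (Inr i) * 1))"
      unfolding M_def by (rule biforms_mult)
    then show ?thesis by (simp add: xdeg_def ydeg_def)
  qed
  define p' where "p' = (\<Sum>m\<in>Poly_Mapping.keys p. const (Poly_Mapping.lookup p m) * M m)"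
  have "p' \<in> biforms k l"
    unfolding p'_def
  proof (intro biforms_sum biforms_const_mult)
    fix m assume "m \<in> Poly_Mapping.keys p"
    then show "M m \<in> biforms k l" using M[of m] assms by (auto simp: biforms_def[of k l])
  qed
  moreover have "poly_val p' (x, y) = poly_val p (g *v x, g *v y)" for x y
    by (simp add: p'_def poly_val_def[of p] poly_val_sum poly_val_const_mult M_def monom_val_def
        poly_val_mult poly_val_prod poly_val_power poly_val_const X_def Y_def matrix_vector_mult_def)
  ultimately show ?thesis by blast
qed

lemma poly_val_homogeneous:
  assumes "p \<in> biforms k l"
  shows "poly_val p (a *\<^sub>R x, b *\<^sub>R y) = a ^ k * b ^ l * poly_val p (x, y)"
proof -
  have "monom_val m (a *\<^sub>R x, b *\<^sub>R y) = a ^ xdeg m * b ^ ydeg m * monom_val m (x, y)" for m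
    by (simp add: monom_val_def power_mult_distrib prod.distrib xdeg_def ydeg_def power_sum)
  then show ?thesis
    using assms unfolding poly_val_def sum_distrib_left
    by (intro sum.cong) (auto simp: biforms_def)
qed

lemma continuous_on_poly_val: "continuous_on S (poly_val p)"
  unfolding poly_val_def monom_val_def case_prod_beta
  by (intro continuous_intros)

lemma biforms_eq_sum_bimonoms:
  assumes "p \<in> biforms k l"
  shows "poly_val p z = (\<Sum>m\<in>bimonoms k l. Poly_Mapping.lookup p m * monom_val m z)"
  using assms finite_bimonoms
  by (intro poly_val_superset) (auto simp: biforms_def bimonoms_def)

section \<open>Classes of biforms as functions on the variety\<close>

lemma Q_rel_refl: "p \<in> biforms 2 2 \<Longrightarrow> Q_rel p p"
  by (simp add: Q_rel_def idl_0)

lemma Q_cases: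
  obtains p where "p \<in> biforms 2 2" "f = abs_Q p"
proof -
  have "Q_rel (rep_Q f) (rep_Q f)" by (rule Quotient_rep_reflp[OF Quotient_Q])
  moreover have "f = abs_Q (rep_Q f)" by (simp add: Quotient_abs_rep[OF Quotient_Q])
  ultimately show ?thesis using that by (auto simp: Q_rel_def)
qed

lemma abs_Q_eq_iff:
  assumes "p \<in> biforms 2 2" "q \<in> biforms 2 2"
  shows "abs_Q p = abs_Q q \<longleftrightarrow> p - q \<in> idl"
  using assms Quotient_rel[OF Quotient_Q, of p q] by (simp add: Q_rel_def idl_0)

lemma abs_Q_add: "p \<in> biforms 2 2 \<Longrightarrow> q \<in> biforms 2 2 \<Longrightarrow> abs_Q p + abs_Q q = abs_Q (p + q)"
  by (rule plus_Q.abs_eq) (auto simp: Q_rel_refl)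

lemma abs_Q_scaleR: "p \<in> biforms 2 2 \<Longrightarrow> c *\<^sub>R abs_Q p = abs_Q (const c * p)"
  by (rule scaleR_Q.abs_eq) (auto simp: Q_rel_refl)

lemma abs_Q_0: "abs_Q 0 = 0"
  by (simp add: zero_Q_def)

lemma abs_Q_sum:
  assumes "\<And>i. i \<in> A \<Longrightarrow> f i \<in> biforms 2 2"
  shows "abs_Q (sum f A) = (\<Sum>i\<in>A. abs_Q (f i))"
  using assms
  by (induction A rule: infinite_finite_induct) (auto simp: abs_Q_0 biforms_sum abs_Q_add[symmetric])

lemma Q_val_abs: "p \<in> biforms 2 2 \<Longrightarrow> z \<in> variety \<Longrightarrow> Q_val (abs_Q p) z = poly_val p z"
  by (simp add: Q_val.abs_eq Q_rel_refl)

lemma Q_val_add: "z \<in> variety \<Longrightarrow> Q_val (f + g) z = Q_val f z + Q_val g z"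
  by (cases f rule: Q_cases, cases g rule: Q_cases) (simp add: abs_Q_add Q_val_abs biforms_add poly_val_add)

lemma Q_val_scaleR: "z \<in> variety \<Longrightarrow> Q_val (c *\<^sub>R f) z = c * Q_val f z"
  by (cases f rule: Q_cases) (simp add: abs_Q_scaleR Q_val_abs biforms_const_mult poly_val_const_mult)

lemma Q_val_0: "z \<in> variety \<Longrightarrow> Q_val 0 z = 0"
  using Q_val_scaleR[of z 0 0] by simp

lemma Q_val_diff: "z \<in> variety \<Longrightarrow> Q_val (f - g) z = Q_val f z - Q_val g z"
  using Q_val_add[of z "f - g" g] by simp

lemma Q_val_sum: "z \<in> variety \<Longrightarrow> Q_val (sum f A) z = (\<Sum>i\<in>A. Q_val (f i) z)"
  by (induction A rule: infinite_finite_induct) (auto simp: Q_val_add Q_val_0)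

lemma Q_val_norms: "(x, y) \<in> variety \<Longrightarrow> Q_val Q_norms (x, y) = (x \<bullet> x) * (y \<bullet> y)"
  unfolding Q_norms_def Q_val.abs_eq[OF Q_norms.rsp]
  by (simp add: poly_val_mult poly_val_sum poly_val_power inner_vec_def flip: power2_eq_square)

lemma frames_subset_variety: "frames \<subseteq> variety"
  by (auto simp: frames_def)

lemma frames_nonempty:
  assumes "CARD('n::finite) \<ge> 2"
  shows "frames \<noteq> ({} :: ((real^'n) \<times> (real^'n)) set)"
proof -
  obtain i j :: 'n where "i \<noteq> j"
    using assms card_le_Suc0_iff_eq[of "UNIV :: 'n set"] by auto
  then have "(axis i 1, axis j 1) \<in> (frames :: ((real^'n) \<times> (real^'n)) set)"
    by (auto simp: frames_def variety_def inner_axis_axis)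
  then show ?thesis by blast
qed

text \<open>
  By homogeneity, the values on the variety are nonnegative multiples of the values on frames. When \<open>x\<close> or
  \<open>y\<close> vanishes there is no frame to normalise to, but then every value is zero.
\<close>

lemma variety_normalize:
  fixes z :: "(real^'n::finite) \<times> (real^'n)"
  assumes n: "CARD('n) \<ge> 2" and z: "z \<in> variety"
  shows "\<exists>c\<ge>0. \<exists>w\<in>frames. \<forall>f. Q_val f z = c * Q_val f w"
proof -
  obtain x y where xy: "z = (x, y)" by (cases z)
  have nsgn: "norm v *\<^sub>R sgn v = v" for v :: "real^'n"
    by (cases "v = 0") (simp_all add: sgn_div_norm)
  have hom: "poly_val p (x, y) = norm x ^ 2 * norm y ^ 2 * poly_val p (sgn x, sgn y)"
    if "p \<in> biforms 2 2" for p
    using poly_val_homogeneous[OF that, of "norm x" "sgn x" "norm y" "sgn y"] by (simp only: nsgn)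
  show ?thesis
  proof (cases "x = 0 \<or> y = 0")
    case True
    then have "Q_val f z = 0" for f
      using z by (cases f rule: Q_cases) (auto simp: Q_val_abs hom xy)
    then show ?thesis using frames_nonempty[OF n] by (intro exI[of _ 0]) auto
  next
    case False
    then have fr: "(sgn x, sgn y) \<in> frames"
      using z by (auto simp: frames_def variety_def xy norm_sgn sgn_div_norm)
    then have var: "(sgn x, sgn y) \<in> variety" using frames_subset_variety by blast
    have "Q_val f z = (norm x ^ 2 * norm y ^ 2) * Q_val f (sgn x, sgn y)" for f
      using z var by (cases f rule: Q_cases) (simp add: Q_val_abs hom xy)
    then show ?thesis
      using fr by (intro exI[of _ "norm x ^ 2 * norm y ^ 2"]) auto
  qed
qed

lemma Q_eq_0I:
  fixes f :: "'n::finite Q"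
  assumes n: "CARD('n) \<ge> 2" and z: "\<And>z. z \<in> frames \<Longrightarrow> Q_val f z = 0"
  shows "f = 0"
proof -
  obtain i :: 'n where True by simp
  obtain p where p: "p \<in> biforms 2 2" "f = abs_Q p" by (rule Q_cases)
  obtain p' where p': "p' \<in> biforms 2 2" "\<forall>m\<in>Poly_Mapping.keys p'. normal_monom i m" "p - p' \<in> idl"
    using normal_form[OF p(1)] by blast
  have f: "f = abs_Q p'" using p p' abs_Q_eq_iff by blast
  have "poly_val p' w = 0" if w: "w \<in> variety" for w
  proof -
    have "poly_val p' w = Q_val f w" using Q_val_abs[OF p'(1) w] by (simp add: f)
    also have "\<dots> = 0" using variety_normalize[OF n w] z by fastforce
    finally show ?thesis .
  qed
  then have "p' = 0" using normal_vanishing[OF n, of p' i] p'(2) by blast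
  then show ?thesis by (simp add: f abs_Q_0)
qed

lemma Pos_Q_iff_frames:
  assumes n: "CARD('n::finite) \<ge> 2"
  shows "(f :: 'n Q) \<in> Pos_Q \<longleftrightarrow> (\<forall>z\<in>frames. 0 \<le> Q_val f z)"
proof
  show "f \<in> Pos_Q \<Longrightarrow> \<forall>z\<in>frames. 0 \<le> Q_val f z"
    using frames_subset_variety by (auto simp: Pos_Q_def)
  assume nn: "\<forall>z\<in>frames. 0 \<le> Q_val f z"
  have "0 \<le> Q_val f z" if z: "z \<in> variety" for z
  proof -
    obtain c w where "c \<ge> 0" "w \<in> frames" "Q_val f z = c * Q_val f w"
      using variety_normalize[OF n z] by blast
    then show ?thesis using nn by simp
  qed
  then show "f \<in> Pos_Q" by (simp add: Pos_Q_def)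
qed

text \<open>
  The classes of the normal monomials form a basis.
\<close>

lemma dim_Q:
  assumes n: "CARD('n::finite) \<ge> 2"
  shows "dim (UNIV :: 'n Q set) = ((CARD('n) + 1) choose 2)\<^sup>2 - CARD('n)\<^sup>2"
    and "\<exists>B :: 'n Q set. finite B \<and> span B = UNIV"
proof -
  obtain i :: 'n where True by simp
  let ?N = "{m \<in> bimonoms 2 2. normal_monom i m}"
  define b where "b m = abs_Q (Poly_Mapping.single m 1)" for m :: "'n xymonom"
  have fin: "finite ?N" using finite_bimonoms by (rule rev_finite_subset) auto
  have comb: "(\<Sum>m\<in>A. c m *\<^sub>R b m) = abs_Q (\<Sum>m\<in>A. Poly_Mapping.single m (c m))"
    if "A \<subseteq> ?N" for c A
  proof -
    have "c m *\<^sub>R b m = abs_Q (Poly_Mapping.single m (c m))" if "m \<in> A" for m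
      using that \<open>A \<subseteq> ?N\<close> unfolding b_def
      by (subst abs_Q_scaleR) (auto simp: biforms_single bimonoms_def const_def mult_single)
    moreover have "Poly_Mapping.single m (c m) \<in> biforms 2 2" if "m \<in> A" for m
      using that \<open>A \<subseteq> ?N\<close> by (auto simp: biforms_single bimonoms_def)
    ultimately show ?thesis
      using abs_Q_sum[of A "\<lambda>m. Poly_Mapping.single m (c m)"] by simp
  qed
  have zero: "\<forall>m\<in>?N. c m = 0" if "(\<Sum>m\<in>?N. c m *\<^sub>R b m) = 0" for c
  proof
    fix m assume m: "m \<in> ?N"
    let ?p = "\<Sum>m\<in>?N. Poly_Mapping.single m (c m)"
    have lk: "Poly_Mapping.lookup ?p m' = (if m' \<in> ?N then c m' else 0)" for m'
      using fin by (simp add: lookup_sum lookup_single when_def)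
    have bi: "?p \<in> biforms 2 2"
      by (rule biforms_sum) (auto simp: biforms_single bimonoms_def)
    have 0: "abs_Q ?p = 0" using that by (simp add: comb)
    have "?p = 0"
    proof (rule normal_vanishing[OF n])
      show "normal_monom i m" if "m \<in> Poly_Mapping.keys ?p" for m
        using that lk[of m] by (auto simp: in_keys_iff split: if_splits)
      show "poly_val ?p z = 0" if "z \<in> variety" for z
        using Q_val_abs[OF bi that] that by (simp add: 0 Q_val_0)
    qed
    then show "c m = 0" using lk[of m] m by simp
  qed
  have inj: "inj_on b ?N"
  proof (rule inj_onI, rule ccontr)
    fix m m' assume mm: "m \<in> ?N" "m' \<in> ?N" "b m = b m'" "m \<noteq> m'"
    define c where "c k = (if k = m then 1 else if k = m' then - 1 else 0 :: real)" for k
    have "(\<Sum>k\<in>?N. c k *\<^sub>R b k) = (\<Sum>k\<in>{m, m'}. c k *\<^sub>R b k)"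
      by (rule sum.mono_neutral_right) (use fin mm in \<open>auto simp: c_def\<close>)
    also have "\<dots> = 0" using mm by (simp add: c_def)
    finally have "c m = 0" using zero mm by blast
    then show False by (simp add: c_def)
  qed
  have indep: "independent (b ` ?N)"
  proof (rule independent_if_scalars_zero)
    fix f x assume "(\<Sum>x\<in>b ` ?N. f x *\<^sub>R x) = 0" "x \<in> b ` ?N"
    then show "f x = 0" using zero[of "\<lambda>m. f (b m)"] by (auto simp: sum.reindex[OF inj])
  qed (use fin in auto)
  have span: "span (b ` ?N) = UNIV"
  proof -
    have "f \<in> span (b ` ?N)" for f
    proof -
      obtain p where p: "p \<in> biforms 2 2" "f = abs_Q p" by (rule Q_cases)
      obtain p' where p': "p' \<in> biforms 2 2" "\<forall>m\<in>Poly_Mapping.keys p'. normal_monom i m" "p - p' \<in> idl"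
        using normal_form[OF p(1)] by blast
      have sub: "Poly_Mapping.keys p' \<subseteq> ?N" using p' by (auto simp: biforms_def bimonoms_def)
      have "f = abs_Q p'" using p p' abs_Q_eq_iff by blast
      also have "\<dots> = (\<Sum>m\<in>Poly_Mapping.keys p'. Poly_Mapping.lookup p' m *\<^sub>R b m)"
        using comb[OF sub, of "Poly_Mapping.lookup p'"] by (simp add: xypoly_monomials)
      also have "\<dots> \<in> span (b ` ?N)"
        using sub by (intro span_sum span_scale span_base) auto
      finally show ?thesis .
    qed
    then show ?thesis by auto
  qed
  have "dim (UNIV :: 'n Q set) = card (b ` ?N)"
    by (rule dim_eq_card) (use span indep in auto)
  then show "dim (UNIV :: 'n Q set) = ((CARD('n) + 1) choose 2)\<^sup>2 - CARD('n)\<^sup>2"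
    by (simp add: card_image[OF inj] card_normal_monoms)
  show "\<exists>B :: 'n Q set. finite B \<and> span B = UNIV"
    using fin span by blast
qed

section \<open>Measures giving equal mass to balls of equal radius\<close>

text \<open>
  Integrate the indicator of \<open>x \<in> A \<and> dist x y < e\<close> over the product of the two measures. Integrating over \<open>y\<close>
  first gives the left-hand side; integrating over \<open>x\<close> first gives a function supported on the
  \<open>e\<close>-neighbourhood of \<open>A\<close> and bounded there by the mass of a ball.
\<close>

lemma emeasure_mult_ball_le:
  fixes M N :: "'a::{metric_space, second_countable_topology} measure"
  assumes M: "sets M = sets borel" "sigma_finite_measure M" "AE x in M. x \<in> T"
    and N: "sets N = sets borel" "sigma_finite_measure N" "AE x in N. x \<in> T"
    and c: "\<And>x. x \<in> T \<Longrightarrow> emeasure M (ball x e) = c"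
    and d: "\<And>x. x \<in> T \<Longrightarrow> emeasure N (ball x e) = d"
    and A: "A \<in> sets borel"
  shows "emeasure M A * d \<le> c * emeasure N (\<Union>x\<in>A. ball x e)"
proof -
  interpret M: sigma_finite_measure M by fact
  interpret N: sigma_finite_measure N by fact
  interpret P: pair_sigma_finite N M ..
  have [measurable_cong]: "sets M = sets borel" "sets N = sets borel" by fact+
  have [measurable]: "A \<in> sets borel" by fact
  have U [measurable]: "(\<Union>x\<in>A. ball x e) \<in> sets borel" by (intro borel_open) auto
  define k where "k x y = (indicator A x * indicator {..<e} (dist x y) :: ennreal)" for x y :: 'a
  have k_meas: "(\<lambda>(x, y). k y x) \<in> borel_measurable (N \<Otimes>\<^sub>M M)"
    unfolding k_def by measurable
  have row: "(\<integral>\<^sup>+y. k x y \<partial>N) = d * indicator A x" if "x \<in> T" for x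
  proof -
    have "(\<integral>\<^sup>+y. k x y \<partial>N) = (\<integral>\<^sup>+y. indicator A x * indicator (ball x e) y \<partial>N)"
      by (intro nn_integral_cong) (auto simp: k_def indicator_def)
    also have "\<dots> = indicator A x * emeasure N (ball x e)"
      by (subst nn_integral_cmult_indicator) auto
    finally show ?thesis using d[OF that] by (simp add: mult.commute)
  qed
  have col: "(\<integral>\<^sup>+x. k x y \<partial>M) \<le> c * indicator (\<Union>x\<in>A. ball x e) y" if "y \<in> T" for y
  proof -
    have "(\<integral>\<^sup>+x. k x y \<partial>M) \<le> (\<integral>\<^sup>+x. indicator (\<Union>x\<in>A. ball x e) y * indicator (ball y e) x \<partial>M)"
      by (intro nn_integral_mono) (auto simp: k_def indicator_def dist_commute)
    also have "\<dots> = indicator (\<Union>x\<in>A. ball x e) y * emeasure M (ball y e)"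
      by (subst nn_integral_cmult_indicator) auto
    finally show ?thesis using c[OF that] by (simp add: mult.commute)
  qed
  have "emeasure M A * d = (\<integral>\<^sup>+x. d * indicator A x \<partial>M)"
    by (subst nn_integral_cmult_indicator) (auto simp: mult.commute)
  also have "\<dots> = (\<integral>\<^sup>+x. (\<integral>\<^sup>+y. k x y \<partial>N) \<partial>M)"
    using M(3) by (intro nn_integral_cong_AE) (auto simp: row)
  also have "\<dots> = (\<integral>\<^sup>+y. (\<integral>\<^sup>+x. k x y \<partial>M) \<partial>N)"
    using P.Fubini'[OF k_meas] by simp
  also have "\<dots> \<le> (\<integral>\<^sup>+y. c * indicator (\<Union>x\<in>A. ball x e) y \<partial>N)"
    using N(3) by (intro nn_integral_mono_AE) (auto simp: col)
  also have "\<dots> = c * emeasure N (\<Union>x\<in>A. ball x e)"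
    by (subst nn_integral_cmult_indicator) auto
  finally show ?thesis .
qed

text \<open>
  A generator that is closed under intersections and on which locally finite measures are finite, as
  uniqueness of measures requires.
\<close>

lemma borel_eq_closed_bounded:
  "sets borel = sigma_sets UNIV {A :: 'a::metric_space set. closed A \<and> bounded A}"
proof -
  obtain x0 :: 'a where True by simp
  have "sets borel = sigma_sets UNIV (Collect (closed :: 'a set \<Rightarrow> bool))"
    by (simp add: borel_eq_closed)
  also have "\<dots> = sigma_sets UNIV {A. closed A \<and> bounded A}"
  proof (rule sigma_sets_eqI)
    fix A :: "'a set" assume A: "A \<in> Collect closed"
    have "A = (\<Union>n :: nat. A \<inter> cball x0 (real n))"
      by (auto intro: real_arch_simple)
    moreover have "(\<Union>n :: nat. A \<inter> cball x0 (real n)) \<in> sigma_sets UNIV {A. closed A \<and> bounded A}"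
      using A by (intro sigma_sets.Union sigma_sets.Basic) (auto intro!: bounded_Int)
    ultimately show "A \<in> sigma_sets UNIV {A. closed A \<and> bounded A}" by simp
  next
    fix B :: "'a set" assume "B \<in> {A. closed A \<and> bounded A}"
    then show "B \<in> sigma_sets UNIV (Collect closed)" by auto
  qed
  finally show ?thesis .
qed

text \<open>
  For closed bounded \<open>A\<close> the inequality \<open>emeasure_mult_ball_le\<close> says that \<open>M\<close> gives \<open>A\<close> at most the \<open>N\<close>-mass of each
  neighbourhood of \<open>A\<close>; shrinking the neighbourhood and exchanging the roles of \<open>M\<close> and \<open>N\<close> yields equality.
\<close>

lemma uniformly_distributed_unique:
  fixes M N :: "'a::{metric_space, second_countable_topology} measure"
  assumes M: "sets M = sets borel" "AE x in M. x \<in> T"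
    and N: "sets N = sets borel" "AE x in N. x \<in> T"
    and cM: "\<And>x e. e > 0 \<Longrightarrow> x \<in> T \<Longrightarrow> emeasure M (ball x e) = c e"
    and cN: "\<And>x e. e > 0 \<Longrightarrow> x \<in> T \<Longrightarrow> emeasure N (ball x e) = c e"
    and c: "\<And>e. e > 0 \<Longrightarrow> 0 < c e" "\<And>e. e > 0 \<Longrightarrow> c e < \<infinity>"
    and T: "T \<noteq> {}"
  shows "M = N"
proof -
  obtain x0 where x0: "x0 \<in> T" using T by blast
  have fin: "emeasure K A < \<infinity>" if K: "sets K = sets borel" and "bounded A"
    and cK: "\<And>e. e > 0 \<Longrightarrow> emeasure K (ball x0 e) = c e" for K A
  proof -
    obtain e where e: "e > 0" "A \<subseteq> ball x0 e"
      using \<open>bounded A\<close> bounded_subset_ballD by blast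
    have "emeasure K A \<le> emeasure K (ball x0 e)"
      using e K by (intro emeasure_mono) auto
    also have "\<dots> < \<infinity>" using c(2)[OF e(1)] cK[OF e(1)] by simp
    finally show ?thesis .
  qed
  have sf: "sigma_finite_measure K" if K: "sets K = sets borel"
    and cK: "\<And>e. e > 0 \<Longrightarrow> emeasure K (ball x0 e) = c e" for K
  proof
    have sp: "space K = UNIV" using sets_eq_imp_space_eq[OF K] by simp
    show "\<exists>A. countable A \<and> A \<subseteq> sets K \<and> \<Union>A = space K \<and> (\<forall>a\<in>A. emeasure K a \<noteq> \<infinity>)"
    proof (intro exI conjI ballI)
      show "countable (range (\<lambda>n :: nat. ball x0 (real n)))" by simp
      show "range (\<lambda>n :: nat. ball x0 (real n)) \<subseteq> sets K"
        unfolding K by (intro image_subsetI borel_open open_ball)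
      show "\<Union> (range (\<lambda>n :: nat. ball x0 (real n))) = space K"
        unfolding sp by (auto intro: reals_Archimedean2)
      show "emeasure K a \<noteq> \<infinity>" if "a \<in> range (\<lambda>n :: nat. ball x0 (real n))" for a
      proof -
        obtain n :: nat where a: "a = ball x0 (real n)" using \<open>a \<in> _\<close> by blast
        have "emeasure K a < \<infinity>" unfolding a by (rule fin[OF K bounded_ball cK])
        then show ?thesis by simp
      qed
    qed
  qed
  have sfM: "sigma_finite_measure M" and sfN: "sigma_finite_measure N"
    using sf M N cM cN x0 by auto
  have le: "emeasure K A \<le> emeasure L A"
    if K: "sets K = sets borel" "sigma_finite_measure K" "AE x in K. x \<in> T"
      and L: "sets L = sets borel" "sigma_finite_measure L" "AE x in L. x \<in> T"
      and cK: "\<And>x e. e > 0 \<Longrightarrow> x \<in> T \<Longrightarrow> emeasure K (ball x e) = c e"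
      and cL: "\<And>x e. e > 0 \<Longrightarrow> x \<in> T \<Longrightarrow> emeasure L (ball x e) = c e"
      and A: "closed A" "bounded A" for K L A
  proof -
    define e where "e n = inverse (real (Suc n))" for n
    have e: "e n > 0" "e n \<le> 1" for n by (auto simp: e_def inverse_le_1_iff)
    define V where "V n = (\<Union>x\<in>A. ball x (e n))" for n
    have step: "emeasure K A \<le> emeasure L (V n)" for n
    proof -
      have "emeasure K A * c (e n) \<le> c (e n) * emeasure L (V n)"
        unfolding V_def using e A
        by (intro emeasure_mult_ball_le[OF K L]) (auto simp: cK cL)
      then show ?thesis
        using c[OF e(1)[of n]] by (simp add: mult.commute[of _ "c (e n)"] ennreal_mult_le_mult_iff)
    qed
    have "bounded (V n)" for n
    proof -
      obtain r where r: "A \<subseteq> ball x0 r" using A(2) bounded_subset_ballD by blast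
      have "V n \<subseteq> cball x0 (r + 1)"
      proof
        fix y assume "y \<in> V n"
        then obtain x where "x \<in> A" "dist x y < e n" by (auto simp: V_def)
        then show "y \<in> cball x0 (r + 1)"
          using r e(2)[of n] dist_triangle[of x0 y x] by force
      qed
      then show ?thesis using bounded_cball bounded_subset by blast
    qed
    then have "emeasure L (V n) \<noteq> \<infinity>" for n
      using fin[OF L(1) _ cL[OF _ x0], of "V n"] by simp
    moreover have "e n \<le> e m" if "m \<le> n" for m n
      using that by (simp add: e_def le_imp_inverse_le)
    then have dec: "decseq V"
      unfolding V_def decseq_def by (meson UN_mono order_refl subset_ball)
    moreover have "range V \<subseteq> sets L"
      unfolding L V_def by (intro image_subsetI borel_open open_UN ballI open_ball)
    ultimately have "(INF n. emeasure L (V n)) = emeasure L (\<Inter>n. V n)"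
      by (intro INF_emeasure_decseq)
    moreover have "(\<Inter>n. V n) = A"
    proof
      show "A \<subseteq> (\<Inter>n. V n)" using e(1) by (auto simp: V_def)
      show "(\<Inter>n. V n) \<subseteq> A"
      proof
        fix y assume y: "y \<in> (\<Inter>n. V n)"
        have "\<exists>x\<in>A. dist x y < r" if r: "r > 0" for r
        proof -
          obtain n where "e n < r" unfolding e_def using reals_Archimedean[OF r] by auto
          moreover obtain x where "x \<in> A" "dist x y < e n" using y by (auto simp: V_def)
          ultimately show ?thesis by force
        qed
        then have "y \<in> closure A" by (auto simp: closure_approachable)
        then show "y \<in> A" using A by simp
      qed
    qed
    ultimately show ?thesis using step by (metis INF_greatest)
  qed
  show ?thesis
  proof (rule measure_eqI_generator_eq[where \<Omega> = UNIV and E = "{A. closed A \<and> bounded A}"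
        and A = "\<lambda>n :: nat. cball x0 (real n)"])
    show "Int_stable {A :: 'a set. closed A \<and> bounded A}"
      by (auto simp: Int_stable_def)
    show "emeasure M X = emeasure N X" if "X \<in> {A. closed A \<and> bounded A}" for X
      using that le[OF M(1) sfM M(2) N(1) sfN N(2) cM cN, of X]
        le[OF N(1) sfN N(2) M(1) sfM M(2) cN cM, of X]
      by (auto intro: antisym)
    show "sets M = sigma_sets UNIV {A. closed A \<and> bounded A}"
      "sets N = sigma_sets UNIV {A. closed A \<and> bounded A}"
      using M N borel_eq_closed_bounded by auto
    show "(\<Union>i :: nat. cball x0 (real i)) = UNIV"
      by (auto intro: real_arch_simple)
    show "emeasure M (cball x0 (real i)) \<noteq> \<infinity>" for i
      using fin[OF M(1), of "cball x0 (real i)"] cM x0 by auto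
  qed auto
qed

text \<open>
  An orthogonal map permutes the balls of a given radius, so the image measure gives them the same mass as
  Lebesgue measure does.
\<close>

lemma orthogonal_transformation_lborel:
  fixes g :: "'a::euclidean_space \<Rightarrow> 'a"
  assumes g: "orthogonal_transformation g"
  shows "distr lborel borel g = lborel"
proof (rule uniformly_distributed_unique[where T = UNIV
      and c = "\<lambda>e. ennreal (unit_ball_vol DIM('a) * e ^ DIM('a))"])
  have lin: "linear g" using g by (rule orthogonal_transformation_linear)
  have [measurable]: "g \<in> borel_measurable borel"
    using lin by (intro borel_measurable_continuous_onI linear_continuous_on) (simp add: linear_conv_bounded_linear)
  show "emeasure (distr lborel borel g) (ball x e) = ennreal (unit_ball_vol DIM('a) * e ^ DIM('a))"
    if "e > 0" for x e
  proof -
    obtain y where y: "x = g y" using orthogonal_transformation_surj[OF g] by blast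
    have "g -` ball x e = ball y e"
      using g by (auto simp: y orthogonal_transformation_isometry)
    then show ?thesis
      using that by (simp add: emeasure_distr emeasure_ball)
  qed
  show "emeasure lborel (ball x e) = ennreal (unit_ball_vol DIM('a) * e ^ DIM('a))" if "e > 0" for x :: 'a and e
    using that by (simp add: emeasure_ball)
qed (auto simp: unit_ball_vol_pos zero_less_mult_iff)

section \<open>The invariant probability measure on frames\<close>

lemma orthogonal_matrix_transformation:
  fixes A :: "real^'n::finite^'n"
  shows "orthogonal_matrix A \<Longrightarrow> orthogonal_transformation ((*v) A)"
  by (simp add: orthogonal_transformation_matrix)

definition householder :: "real^'n \<Rightarrow> real^'n \<Rightarrow> real^'n"
  where "householder v x = x - (2 * (v \<bullet> x) / (v \<bullet> v)) *\<^sub>R v"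

lemma householder_orthogonal: "orthogonal_transformation (householder v)"
proof (cases "v = 0")
  case True
  then have "householder v = (\<lambda>x. x)" by (auto simp: householder_def)
  then show ?thesis by simp
next
  case False
  then have v: "v \<bullet> v \<noteq> 0" by simp
  have "linear (householder v)"
    by (rule linearI) (auto simp: householder_def algebra_simps inner_add_right add_divide_distrib)
  moreover have "householder v x \<bullet> householder v y = x \<bullet> y" for x y
    using v by (simp add: householder_def inner_diff_left inner_diff_right inner_commute field_simps)
  ultimately show ?thesis by (simp add: orthogonal_transformation_def)
qed

lemma householder_fix: "v \<bullet> x = 0 \<Longrightarrow> householder v x = x"
  by (simp add: householder_def)

lemma householder_swap:
  assumes "norm a = norm b"
  shows "householder (a - b) a = b"
proof (cases "a = b")
  case False
  have eq: "a \<bullet> a = b \<bullet> b" using assms by (simp add: norm_eq)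
  have "(a - b) \<bullet> (a - b) = 2 * ((a - b) \<bullet> a)"
    using eq by (simp add: inner_diff_left inner_diff_right inner_commute)
  moreover have "(a - b) \<bullet> (a - b) \<noteq> 0" using False by simp
  ultimately have "2 * ((a - b) \<bullet> a) / ((a - b) \<bullet> (a - b)) = 1" by simp
  then show ?thesis unfolding householder_def by (simp only: scaleR_one) simp
qed (simp add: householder_def)

text \<open>
  A rotation of the coordinates turns the reflection into one along a coordinate axis, whose matrix is diagonal.
\<close>

lemma det_householder:
  fixes v :: "real^'n::finite"
  assumes "v \<noteq> 0"
  shows "det (matrix (householder v)) = - 1"
proof -
  obtain k :: 'n where True by simp
  obtain A where A: "orthogonal_matrix A" "A *v axis k 1 = sgn v"
    using orthogonal_matrix_exists_basis[of "sgn v" k] assms by (auto simp: norm_sgn)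
  let ?e = "axis k 1 :: real^'n"
  have Ainner: "(A *v x) \<bullet> (A *v y) = x \<bullet> y" for x y
    using A(1) using orthogonal_matrix_transformation by (auto simp: orthogonal_transformation_def)
  have eq: "householder v (A *v x) = A *v householder ?e x" for x
  proof -
    have v: "v = norm v *\<^sub>R (A *v ?e)" using assms by (simp add: A(2) sgn_div_norm)
    have "householder (c *\<^sub>R w) y = y - (2 * (w \<bullet> y)) *\<^sub>R w" if "c \<noteq> 0" "w \<bullet> w = 1" for c and w y :: "real^'n"
      using that by (simp add: householder_def)
    from this[of "norm v" "A *v ?e" "A *v x"]
    have "householder v (A *v x) = A *v x - (2 * (?e \<bullet> x)) *\<^sub>R (A *v ?e)"
      using assms by (simp add: Ainner inner_axis_axis flip: v)
    also have "\<dots> = A *v householder ?e x"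
      by (simp add: householder_def matrix_vector_mult_diff_distrib matrix_vector_mult_scaleR)
    finally show ?thesis .
  qed
  have lin: "linear (householder w)" for w :: "real^'n"
    using householder_orthogonal by (rule orthogonal_transformation_linear)
  have "matrix (householder v) ** A = A ** matrix (householder ?e)"
    by (subst matrix_eq) (simp add: matrix_vector_mul(2)[OF lin, THEN fun_cong] eq flip: matrix_vector_mul_assoc)
  then have "det (matrix (householder v)) * det A = det A * det (matrix (householder ?e))"
    by (metis det_mul)
  moreover have "det A \<noteq> 0" using det_orthogonal_matrix[OF A(1)] by auto
  moreover have "det (matrix (householder ?e)) = - 1"
  proof -
    have m: "matrix (householder ?e) $ i $ j = (if i = j then if i = k then - 1 else 1 else 0)" for i j
    proof -
      have "householder ?e x = x - (2 * (x $ k)) *\<^sub>R ?e" for x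
        by (simp add: householder_def inner_axis_axis inner_commute[of ?e] inner_axis)
      then show ?thesis by (simp add: matrix_def) (simp add: axis_def)
    qed
    have "det (matrix (householder ?e)) = (\<Prod>i\<in>UNIV. matrix (householder ?e) $ i $ i)"
      by (rule det_diagonal) (simp add: m)
    also have "\<dots> = (\<Prod>i\<in>UNIV. if i = k then - 1 else 1)" by (simp add: m)
    also have "\<dots> = - 1" by simp
    finally show ?thesis .
  qed
  ultimately have "det (matrix (householder v)) * det A = (- 1) * det A" "det A \<noteq> 0" by simp_all
  then show ?thesis by (metis mult_right_cancel)
qed

text \<open>
  A rotation takes the first vector to its target, and the reflection along the difference of the second
  vector and its target, which fixes the first one, takes care of the second. One more
  reflection, along a vector orthogonal to the target frame, restores the determinant; such a vector
  exists because the dimension is at least three.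
\<close>

lemma frames_transitive:
  fixes z w :: "(real^'n::finite) \<times> (real^'n)"
  assumes n: "CARD('n) \<ge> 3" and z: "z \<in> frames" and w: "w \<in> frames"
  obtains g :: "real^'n^'n" where "rotation_matrix g" "g *v fst z = fst w" "g *v snd z = snd w"
proof -
  obtain x y x' y' where zw: "z = (x, y)" "w = (x', y')" by (cases z, cases w)
  have xy: "norm x = 1" "norm y = 1" "y \<bullet> x = 0" "norm x' = 1" "norm y' = 1" "y' \<bullet> x' = 0"
    using z w by (auto simp: zw frames_def variety_def)
  obtain f where f: "orthogonal_transformation f" "det (matrix f) = 1" "f x = x'"
    using rotation_exists_1[of x x'] n xy by auto
  have fy: "norm (f y) = 1" "f y \<bullet> x' = 0"
    using f xy by (auto simp: orthogonal_transformation_norm orthogonal_transformation_def)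
  obtain f' where f': "orthogonal_transformation f'" "det (matrix f') = 1" "f' x = x'" "f' y = y'"
  proof (cases "f y = y'")
    case True then show ?thesis using that f by blast
  next
    case False
    have "dim {x', y'} \<le> 2"
      using dim_le_card[of "{x', y'}" "{x', y'}"] card_insert_le_m1[of 2 "{y'}" x'] by (auto simp: span_superset)
    then have "dim {x', y'} < DIM(real^'n)" using n by simp
    then obtain u where u: "u \<noteq> 0" "u \<bullet> x' = 0" "u \<bullet> y' = 0"
      using orthogonal_to_subspace_exists[of "{x', y'}"]
      by (metis orthogonal_def span_base insertI1 insertI2)
    define v where "v = f y - y'"
    have v: "v \<noteq> 0" using False by (simp add: v_def)
    let ?f = "householder u \<circ> householder v \<circ> f"
    have o: "orthogonal_transformation ?f"
      by (intro orthogonal_transformation_compose householder_orthogonal f)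
    have lin: "linear (householder w)" "linear f" for w :: "real^'n"
      using householder_orthogonal f(1) orthogonal_transformation_linear by blast+
    have "matrix ?f = matrix (householder u) ** matrix (householder v) ** matrix f"
      using lin by (simp add: matrix_compose linear_compose)
    then have "det (matrix ?f) = 1" using f u v by (simp add: det_mul det_householder)
    moreover have "?f x = x'"
      using f fy xy u by (simp add: householder_fix v_def inner_diff_left)
    moreover have "?f y = y'"
      using householder_swap[of "f y" y'] fy xy u by (simp add: householder_fix v_def)
    ultimately show ?thesis using that o by blast
  qed
  have "rotation_matrix (matrix f')"
    using f' by (simp add: rotation_matrix_def orthogonal_transformation_matrix)
  then show ?thesis
    using that[of "matrix f'"] f' by (simp add: zw matrix_works orthogonal_transformation_linear)
qed

definition rotate_pair :: "real^'n^'n \<Rightarrow> (real^'n::finite) \<times> (real^'n) \<Rightarrow> (real^'n) \<times> (real^'n)"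
  where "rotate_pair g = (\<lambda>(x, y). (g *v x, g *v y))"

lemma rotate_pair_orthogonal:
  assumes "rotation_matrix g"
  shows "orthogonal_transformation (rotate_pair g)"
proof -
  have "orthogonal_transformation ((*v) g)"
    using assms by (simp add: rotation_matrix_def orthogonal_matrix_transformation)
  then show ?thesis
    by (auto simp: orthogonal_transformation_def rotate_pair_def inner_prod_def case_prod_beta
        intro!: linearI linear_add linear_scale matrix_vector_mul_linear)
qed

lemma rotate_pair_frames: "rotation_matrix g \<Longrightarrow> z \<in> frames \<Longrightarrow> rotate_pair g z \<in> frames"
proof -
  assume "rotation_matrix g" and z: "z \<in> frames"
  then have "orthogonal_transformation ((*v) g)"
    by (simp add: rotation_matrix_def orthogonal_matrix_transformation)
  then show ?thesis
    using z by (auto simp: frames_def variety_def rotate_pair_def orthogonal_transformation_norm orthogonal_transformation_def)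
qed

lemma rotate_pair_measurable [measurable]: "rotate_pair g \<in> borel_measurable borel"
  unfolding rotate_pair_def case_prod_beta
  by (intro borel_measurable_continuous_onI continuous_intros linear_continuous_on
      bounded_linear_compose[OF matrix_vector_mul_bounded_linear] bounded_linear_fst bounded_linear_snd)

lemma compact_frames: "compact (frames :: ((real^'n::finite) \<times> (real^'n)) set)"
proof -
  have "closed (variety :: ((real^'n) \<times> (real^'n)) set)"
    unfolding variety_def case_prod_beta' by (intro closed_Collect_eq continuous_intros)
  then show ?thesis
    unfolding frames_def by (intro compact_Int_closed compact_Times compact_sphere)
qed

lemma frames_borel [measurable]: "(frames :: ((real^'n::finite) \<times> (real^'n)) set) \<in> sets borel"
  by (intro borel_closed compact_imp_closed compact_frames)

text \<open>
  A pair of vectors that is uniformly distributed over the linearly independent pairs in a ball becomes a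
  random frame by orthonormalisation. As orthonormalisation commutes with rotations and Lebesgue measure is
  rotation invariant, so is the distribution of this frame.
\<close>

lemma invariant_prob_exists:
  assumes n: "CARD('n::finite) \<ge> 3"
  shows "\<exists>\<mu> :: ((real^'n) \<times> (real^'n)) measure. invariant_prob_on_frames \<mu>"
proof -
  \<comment> \<open>The Gram--Schmidt vector, multiplied by \<open>a \<bullet> a\<close> to make it a polynomial in the pair \<open>(a, b)\<close>. It
    vanishes exactly on the linearly dependent pairs.\<close>
  define h :: "(real^'n) \<times> (real^'n) \<Rightarrow> real^'n"
    where "h z = (fst z \<bullet> fst z) *\<^sub>R snd z - (snd z \<bullet> fst z) *\<^sub>R fst z" for z
  define D where "D = {z. h z \<noteq> 0} \<inter> ball 0 1"
  have h_cont: "continuous_on UNIV h" unfolding h_def by (intro continuous_intros)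
  have [measurable]: "h \<in> borel_measurable borel"
    using h_cont by (rule borel_measurable_continuous_onI)
  have "open D"
    unfolding D_def by (intro open_Int open_Collect_neq h_cont continuous_intros open_ball)
  then have [measurable]: "D \<in> sets borel" by simp
  obtain z0 where z0: "z0 \<in> (frames :: ((real^'n) \<times> (real^'n)) set)" using frames_nonempty[where 'n = 'n] n by fastforce
  have "(1/2) *\<^sub>R z0 \<in> D"
  proof -
    obtain x y where xy: "z0 = (x, y)" "norm x = 1" "norm y = 1" "y \<bullet> x = 0"
      using z0 by (auto simp: frames_def variety_def)
    have "norm z0 = sqrt 2" by (simp add: xy norm_Pair)
    then have "norm ((1/2) *\<^sub>R z0) = sqrt 2 / 2" by simp
    also have "\<dots> < 1" using real_sqrt_less_mono[of 2 4] by simp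
    finally show ?thesis using xy by (auto simp: D_def h_def dot_square_norm)
  qed
  then obtain e where e: "e > 0" "ball ((1/2) *\<^sub>R z0) e \<subseteq> D"
    using \<open>open D\<close> open_contains_ball by blast
  have "0 < emeasure lborel (ball ((1/2) *\<^sub>R z0) e)"
    using e by (simp add: emeasure_ball unit_ball_vol_pos)
  also have "\<dots> \<le> emeasure lborel D" using e \<open>open D\<close> by (intro emeasure_mono) auto
  finally have D_pos: "emeasure lborel D \<noteq> 0" by simp
  have D_fin: "emeasure lborel D \<noteq> \<infinity>"
    using emeasure_lborel_ball_finite[of 0 1] emeasure_mono[of D "ball 0 1" lborel]
    by (auto simp: D_def less_top[symmetric] top_unique)
  define U where "U = uniform_measure lborel D"
  have U_em: "emeasure U A = emeasure lborel (D \<inter> A) / emeasure lborel D" if "A \<in> sets borel" for A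
    unfolding U_def using that by (intro emeasure_uniform_measure) auto
  have [measurable_cong]: "sets U = sets borel" by (simp add: U_def)
  \<comment> \<open>Outside the independent pairs, which carry all the mass, the value is an arbitrary frame.\<close>
  define \<Gamma> where "\<Gamma> z = (if z \<in> D then (sgn (fst z), sgn (h z)) else z0)" for z
  have sgn_meas: "(\<lambda>x. sgn (x :: real^'n)) \<in> borel_measurable borel"
    unfolding sgn_div_norm by measurable
  have \<Gamma>_meas': "\<Gamma> \<in> borel_measurable borel"
  proof -
    have fst_meas: "fst \<in> borel_measurable (borel :: ((real^'n) \<times> (real^'n)) measure)"
      by (intro borel_measurable_continuous_onI continuous_intros)
    have "(\<lambda>z. (sgn (fst z), sgn (h z))) \<in> borel_measurable borel"
      by (intro borel_measurable_Pair measurable_compose[OF fst_meas sgn_meas]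
          measurable_compose[OF \<open>h \<in> borel_measurable borel\<close> sgn_meas])
    then show ?thesis
      unfolding \<Gamma>_def by (intro measurable_If) auto
  qed
  have \<Gamma>_frames: "\<Gamma> z \<in> frames" for z
  proof (cases "z \<in> D")
    case True
    have "h z \<bullet> fst z = 0" by (simp add: h_def inner_diff_left)
    moreover have "h z \<noteq> 0" "fst z \<noteq> 0" using True by (auto simp: D_def h_def)
    ultimately show ?thesis
      using True by (auto simp: \<Gamma>_def frames_def variety_def norm_sgn sgn_div_norm)
  qed (use z0 in \<open>simp add: \<Gamma>_def\<close>)
  let ?R = "restrict_space borel frames :: ((real^'n) \<times> (real^'n)) measure"
  have \<Gamma>_meas [measurable]: "\<Gamma> \<in> measurable borel ?R"
    using \<Gamma>_meas' \<Gamma>_frames by (intro measurable_restrict_space2) auto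
  define \<sigma> where "\<sigma> = distr U ?R \<Gamma>"
  have sets_\<sigma> [measurable_cong]: "sets \<sigma> = sets ?R" by (simp add: \<sigma>_def)
  have sp: "space ?R = frames" by (simp add: space_restrict_space)
  have "emeasure \<sigma> frames = emeasure U (\<Gamma> -` frames \<inter> space U)"
    unfolding \<sigma>_def by (rule emeasure_distr) (auto simp: sets_restrict_space_iff)
  also have "\<dots> = emeasure U UNIV" using \<Gamma>_frames by (simp add: U_def vimage_def)
  also have "\<dots> = 1" using D_pos D_fin using ennreal_divide_self[of "emeasure lborel D"] by (simp add: U_em less_top)
  finally have total: "emeasure \<sigma> frames = 1" .
  have "distr \<sigma> \<sigma> (rotate_pair g) = \<sigma>" if g: "rotation_matrix g" for g :: "real^'n^'n"
  proof -
    have og: "orthogonal_transformation ((*v) g)"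
      using g by (simp add: rotation_matrix_def orthogonal_matrix_transformation)
    have ng: "norm (g *v x) = norm x" and ig: "(g *v x) \<bullet> (g *v y) = x \<bullet> y" for x y
      using og by (auto simp: orthogonal_transformation_norm orthogonal_transformation_def)
    have hg: "h (rotate_pair g z) = g *v h z" for z
      by (simp add: h_def rotate_pair_def case_prod_beta ig matrix_vector_mult_diff_distrib matrix_vector_mult_scaleR)
    have Dg: "rotate_pair g z \<in> D \<longleftrightarrow> z \<in> D" for z
    proof -
      have "norm (rotate_pair g z) = norm z"
        using rotate_pair_orthogonal[OF g] by (rule orthogonal_transformation_norm)
      moreover have "g *v h z = 0 \<longleftrightarrow> h z = 0" using ng[of "h z"] by (metis norm_eq_zero)
      ultimately show ?thesis by (simp add: D_def hg)
    qed
    have sg: "sgn (g *v x) = g *v sgn x" for x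
      by (simp add: sgn_div_norm ng matrix_vector_mult_scaleR)
    have \<Gamma>g: "\<Gamma> (rotate_pair g z) = rotate_pair g (\<Gamma> z)" if "z \<in> D" for z
      using that Dg[of z] hg[of z] by (simp add: \<Gamma>_def sg) (simp add: rotate_pair_def sg case_prod_beta)
    have rm [measurable]: "rotate_pair g \<in> measurable ?R ?R"
      using rotate_pair_frames[OF g]
      by (intro measurable_restrict_space2 measurable_restrict_space1 rotate_pair_measurable) (auto simp: sp)
    show ?thesis
    proof (rule measure_eqI)
      fix A assume "A \<in> sets (distr \<sigma> \<sigma> (rotate_pair g))"
      then have A [measurable]: "A \<in> sets ?R" by (simp add: sets_\<sigma>)
      have V [measurable]: "\<Gamma> -` A \<in> sets borel"
        using measurable_sets[OF \<Gamma>_meas A] by simp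
      have V2: "rotate_pair g -` \<Gamma> -` A \<in> sets borel"
        using measurable_sets[OF rotate_pair_measurable V, of g] by simp
      have V3: "\<Gamma> -` (rotate_pair g -` A \<inter> frames) \<in> sets borel"
        using measurable_sets[OF \<Gamma>_meas measurable_sets[OF rm A]] by (simp add: sp)
      have "emeasure (distr \<sigma> \<sigma> (rotate_pair g)) A = emeasure \<sigma> (rotate_pair g -` A \<inter> space \<sigma>)"
        by (rule emeasure_distr) (use A sets_\<sigma> rm in \<open>auto cong: measurable_cong_sets\<close>)
      also have "space \<sigma> = frames" by (simp add: \<sigma>_def sp)
      also have "emeasure \<sigma> (rotate_pair g -` A \<inter> frames) = emeasure U (\<Gamma> -` (rotate_pair g -` A \<inter> frames) \<inter> space U)"
        unfolding \<sigma>_def using measurable_sets[OF rm A] by (intro emeasure_distr) (auto simp: sp)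
      also have "\<dots> = emeasure U (\<Gamma> -` (rotate_pair g -` A \<inter> frames))" by (simp add: U_def)
      also have "\<dots> = emeasure U (rotate_pair g -` \<Gamma> -` A)"
      proof -
        have "D \<inter> \<Gamma> -` (rotate_pair g -` A \<inter> frames) = D \<inter> rotate_pair g -` \<Gamma> -` A"
        proof (rule set_eqI)
          show "z \<in> D \<inter> \<Gamma> -` (rotate_pair g -` A \<inter> frames) \<longleftrightarrow> z \<in> D \<inter> rotate_pair g -` \<Gamma> -` A" for z
            by (cases "z \<in> D") (simp_all add: \<Gamma>_frames \<Gamma>g)
        qed
        then show ?thesis using V2 V3 by (simp add: U_em)
      qed
      also have "\<dots> = emeasure U (\<Gamma> -` A)"
      proof -
        have "emeasure lborel (D \<inter> \<Gamma> -` A) = emeasure (distr lborel borel (rotate_pair g)) (D \<inter> \<Gamma> -` A)"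
          by (simp add: orthogonal_transformation_lborel[OF rotate_pair_orthogonal[OF g]])
        also have "\<dots> = emeasure lborel (rotate_pair g -` (D \<inter> \<Gamma> -` A))"
          using \<open>D \<in> sets borel\<close> V by (subst emeasure_distr) auto
        also have "rotate_pair g -` (D \<inter> \<Gamma> -` A) = D \<inter> rotate_pair g -` \<Gamma> -` A"
          by (rule set_eqI) (simp add: Dg)
        finally show ?thesis using V V2 by (simp add: U_em)
      qed
      also have "\<dots> = emeasure \<sigma> A"
        unfolding \<sigma>_def by (subst emeasure_distr) (use A in \<open>auto simp: U_def\<close>)
      finally show "emeasure (distr \<sigma> \<sigma> (rotate_pair g)) A = emeasure \<sigma> A" .
    qed (simp)
  qed
  then have "invariant_prob_on_frames \<sigma>"
    using sets_\<sigma> total by (simp add: invariant_prob_on_frames_def rotate_pair_def)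
  then show ?thesis by blast
qed


lemma rotate_pair_vimage_ball:
  assumes "rotation_matrix g"
  shows "rotate_pair g -` ball (rotate_pair g z) e = ball z e"
proof (rule set_eqI)
  fix w
  have "dist (rotate_pair g z) (rotate_pair g w) = dist z w"
    using rotate_pair_orthogonal[OF assms] unfolding orthogonal_transformation_isometry by blast
  then show "w \<in> rotate_pair g -` ball (rotate_pair g z) e \<longleftrightarrow> w \<in> ball z e" by simp
qed

text \<open>
  The measure is extended by zero to the whole space. Transitivity makes the mass of a ball independent
  of its centre, and the mass is positive because finitely many balls of the same radius cover the compact set of frames.
\<close>

lemma invariant_prob_facts:
  fixes \<mu> :: "((real^'n::finite) \<times> (real^'n)) measure"
  assumes n: "CARD('n) \<ge> 3" and inv: "invariant_prob_on_frames \<mu>"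
  defines "M \<equiv> distr \<mu> borel (\<lambda>z. z)"
  shows "AE z in M. z \<in> frames" "emeasure M UNIV = 1" "sigma_finite_measure M"
    and "\<And>A. A \<in> sets \<mu> \<Longrightarrow> emeasure \<mu> A = emeasure M A"
    and "\<And>z w. z \<in> frames \<Longrightarrow> w \<in> frames \<Longrightarrow> emeasure M (ball z e) = emeasure M (ball w e)"
    and "\<And>z. z \<in> frames \<Longrightarrow> e > 0 \<Longrightarrow> 0 < emeasure M (ball z e)"
proof -
  have sets [measurable_cong]: "sets \<mu> = sets (restrict_space borel frames)"
    and total: "emeasure \<mu> frames = 1"
    and rot: "\<And>g. rotation_matrix g \<Longrightarrow> distr \<mu> \<mu> (rotate_pair g) = \<mu>"
    using inv by (auto simp: invariant_prob_on_frames_def rotate_pair_def)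
  have sp: "space \<mu> = frames" using sets_eq_imp_space_eq[OF sets] by (simp add: space_restrict_space)
  have id [measurable]: "(\<lambda>z. z) \<in> measurable \<mu> borel"
    unfolding measurable_cong_sets[OF sets refl] by (intro measurable_restrict_space1) simp
  have em: "emeasure M A = emeasure \<mu> (A \<inter> frames)" if "A \<in> sets borel" for A
    unfolding M_def using that by (subst emeasure_distr) (auto simp: sp)
  show em': "emeasure \<mu> A = emeasure M A" if "A \<in> sets \<mu>" for A
  proof -
    have "A \<in> sets borel" "A \<subseteq> frames"
      using that frames_borel by (auto simp: sets sets_restrict_space_iff)
    then show ?thesis by (simp add: em Int_absorb2)
  qed
  show AE: "AE z in M. z \<in> frames"
    unfolding M_def by (subst AE_distr_iff) (auto simp: sp frames_borel)
  show tot: "emeasure M UNIV = 1" by (simp add: em total)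
  then show "sigma_finite_measure M"
    by (intro finite_measure.axioms(1) finite_measureI) (simp add: M_def)
  have rM: "emeasure M (rotate_pair g -` A) = emeasure M A" if g: "rotation_matrix g" and A: "A \<in> sets borel" for g A
  proof -
    have rm: "rotate_pair g \<in> measurable \<mu> \<mu>"
      unfolding measurable_cong_sets[OF sets sets]
      using rotate_pair_frames[OF g]
      by (intro measurable_restrict_space2 measurable_restrict_space1 rotate_pair_measurable) (auto simp: space_restrict_space)
    have A': "A \<inter> frames \<in> sets \<mu>" using A frames_borel by (auto simp: sets sets_restrict_space_iff)
    have "emeasure M A = emeasure (distr \<mu> \<mu> (rotate_pair g)) (A \<inter> frames)" using A by (simp add: em rot[OF g])
    also have "\<dots> = emeasure \<mu> (rotate_pair g -` (A \<inter> frames) \<inter> frames)"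
      using emeasure_distr[OF rm A'] by (simp add: sp)
    also have "rotate_pair g -` (A \<inter> frames) \<inter> frames = rotate_pair g -` A \<inter> frames"
      using rotate_pair_frames[OF g] by auto
    also have "emeasure \<mu> \<dots> = emeasure M (rotate_pair g -` A)"
      using measurable_sets[OF rotate_pair_measurable A, of g] by (simp add: em)
    finally show ?thesis by simp
  qed
  show ball_eq: "emeasure M (ball z e) = emeasure M (ball w e)" if zw: "z \<in> frames" "w \<in> frames" for z w e
  proof -
    obtain g where g: "rotation_matrix g" "g *v fst z = fst w" "g *v snd z = snd w"
      using frames_transitive[OF n zw] .
    then have "rotate_pair g z = w" by (simp add: rotate_pair_def case_prod_beta)
    then show ?thesis using rM[OF g(1), of "ball w e"] rotate_pair_vimage_ball[OF g(1), of z e] by simp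
  qed
  show "0 < emeasure M (ball z e)" if z: "z \<in> frames" and e: "e > 0" for z e
  proof (rule ccontr)
    assume "\<not> 0 < emeasure M (ball z e)"
    then have 0: "emeasure M (ball w e) = 0" if "w \<in> frames" for w
      using ball_eq[OF that z, of e] by simp
    obtain C :: "((real^'n) \<times> (real^'n)) set" where C: "C \<subseteq> frames" "finite C" "frames \<subseteq> (\<Union>w\<in>C. ball w e)"
    proof (rule compactE_image[OF compact_frames, of frames "\<lambda>w. ball w e"])
      show "frames \<subseteq> (\<Union>w\<in>frames. ball w e)"
        using e by (auto simp del: split_paired_All split_paired_Ex)
    qed auto
    have "1 = emeasure M frames" using total frames_borel by (simp add: em)
    also have "\<dots> \<le> emeasure M (\<Union>w\<in>C. ball w e)"
      using C(3) by (intro emeasure_mono) (auto simp: M_def intro!: borel_open)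
    also have "\<dots> \<le> (\<Sum>w\<in>C. emeasure M (ball w e))"
      using C(2) by (intro emeasure_subadditive_finite) (auto simp: M_def)
    also have "\<dots> = 0" using C(1) by (intro sum.neutral) (auto simp: 0)
    finally show False by simp
  qed
qed

text \<open>
  Comparing the two total masses through \<open>emeasure_mult_ball_le\<close> shows that both measures give the same
  mass to balls of the same radius.
\<close>

lemma invariant_prob_unique:
  fixes \<mu> \<nu> :: "((real^'n::finite) \<times> (real^'n)) measure"
  assumes n: "CARD('n) \<ge> 3" and \<mu>: "invariant_prob_on_frames \<mu>" and \<nu>: "invariant_prob_on_frames \<nu>"
  shows "\<mu> = \<nu>"
proof -
  define M where "M = distr \<mu> borel (\<lambda>z. z)"
  define N where "N = distr \<nu> borel (\<lambda>z. z)"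
  note M = invariant_prob_facts[OF n \<mu>, folded M_def]
  note N = invariant_prob_facts[OF n \<nu>, folded N_def]
  have sM: "sets M = sets borel" and sN: "sets N = sets borel" by (simp_all add: M_def N_def)
  obtain z0 where z0: "z0 \<in> (frames :: ((real^'n) \<times> (real^'n)) set)"
    using frames_nonempty[where 'n = 'n] n by fastforce
  define c where "c e = emeasure M (ball z0 e)" for e
  define d where "d e = emeasure N (ball z0 e)" for e
  have cM: "emeasure M (ball z e) = c e" and dN: "emeasure N (ball z e) = d e" if "z \<in> frames" for z e
    using M(5)[OF that z0] N(5)[OF that z0] by (auto simp: c_def d_def)
  have U: "(\<Union>z :: (real^'n) \<times> (real^'n). ball z e) = UNIV" if "e > 0" for e
    using that by (auto intro!: exI centre_in_ball[THEN iffD2])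
  have eq: "c e = d e" if "e > 0" for e
  proof (rule antisym)
    show "d e \<le> c e"
      using emeasure_mult_ball_le[OF sM M(3,1) sN N(3,1) cM[of _ e] dN[of _ e], of UNIV] U[OF that] M(2) N(2) by simp
    show "c e \<le> d e"
      using emeasure_mult_ball_le[OF sN N(3,1) sM M(3,1) dN[of _ e] cM[of _ e], of UNIV] U[OF that] M(2) N(2) by simp
  qed
  have "M = N"
  proof (rule uniformly_distributed_unique[OF sM M(1) sN N(1), of c])
    show "0 < c e" if "e > 0" for e using M(6)[OF z0 that] by (simp add: c_def)
    show "c e < \<infinity>" for e
    proof -
      have "c e \<le> emeasure M UNIV" unfolding c_def by (intro emeasure_mono) (auto simp: sM)
      also have "\<dots> < \<infinity>" using M(2) by simp
      finally show ?thesis .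
    qed
  qed (use cM dN eq z0 in auto)
  show ?thesis
  proof (rule measure_eqI)
    show s: "sets \<mu> = sets \<nu>" using \<mu> \<nu> by (simp add: invariant_prob_on_frames_def)
    show "emeasure \<mu> A = emeasure \<nu> A" if "A \<in> sets \<mu>" for A
      using M(4)[OF that] N(4)[of A] that by (simp add: s \<open>M = N\<close>)
  qed
qed

lemma frame_measure_invariant:
  assumes n: "CARD('n::finite) \<ge> 3"
  shows "invariant_prob_on_frames (frame_measure :: ((real^'n) \<times> (real^'n)) measure)"
proof -
  have "\<exists>!\<mu> :: ((real^'n) \<times> (real^'n)) measure. invariant_prob_on_frames \<mu>"
    using invariant_prob_exists[OF n] invariant_prob_unique[OF n] by blast
  then show ?thesis unfolding frame_measure_def by (rule theI')
qed

lemma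
  assumes n: "CARD('n::finite) \<ge> 3"
  shows sets_frame_measure: "sets (frame_measure :: ((real^'n) \<times> (real^'n)) measure) = sets (restrict_space borel frames)"
    and space_frame_measure: "space (frame_measure :: ((real^'n) \<times> (real^'n)) measure) = frames"
    and prob_space_frame_measure: "prob_space (frame_measure :: ((real^'n) \<times> (real^'n)) measure)"
    and distr_frame_measure: "rotation_matrix g \<Longrightarrow> distr frame_measure frame_measure (rotate_pair g) = (frame_measure :: ((real^'n) \<times> (real^'n)) measure)"
    and emeasure_frame_ball: "z \<in> frames \<Longrightarrow> e > 0 \<Longrightarrow>
      0 < emeasure (frame_measure :: ((real^'n) \<times> (real^'n)) measure) (ball z e \<inter> frames)"
proof -
  let ?\<sigma> = "frame_measure :: ((real^'n) \<times> (real^'n)) measure"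
  show s: "sets ?\<sigma> = sets (restrict_space borel frames)"
    using frame_measure_invariant[OF n] by (simp add: invariant_prob_on_frames_def)
  then show sp: "space ?\<sigma> = frames"
    using sets_eq_imp_space_eq[OF s] by (simp add: space_restrict_space)
  show "prob_space ?\<sigma>"
    using frame_measure_invariant[OF n] by (intro prob_spaceI) (simp add: sp invariant_prob_on_frames_def)
  show "distr ?\<sigma> ?\<sigma> (rotate_pair g) = ?\<sigma>" if "rotation_matrix g"
    using frame_measure_invariant[OF n] that by (simp add: invariant_prob_on_frames_def rotate_pair_def)
  show "0 < emeasure ?\<sigma> (ball z e \<inter> frames)" if "z \<in> frames" "e > 0"
  proof -
    have "(\<lambda>z. z) \<in> measurable ?\<sigma> borel"
      unfolding measurable_cong_sets[OF s refl] by (intro measurable_restrict_space1) simp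
    then have "emeasure ?\<sigma> (ball z e \<inter> frames) = emeasure (distr ?\<sigma> borel (\<lambda>z. z)) (ball z e)"
      by (subst emeasure_distr) (auto simp: sp)
    also have "\<dots> > 0"
      using invariant_prob_facts(6)[OF n frame_measure_invariant[OF n] that] .
    finally show ?thesis .
  qed
qed

section \<open>Invariant spaces of functions on frames\<close>

lemma Q_val_frames_poly:
  "\<exists>p\<in>biforms 2 2. f = abs_Q p \<and> (\<forall>z\<in>frames. Q_val f z = poly_val p z)"
  using Q_cases[of f] Q_val_abs frames_subset_variety by (metis subset_iff)

lemma continuous_on_Q_val: "continuous_on frames (Q_val f)"
  using Q_val_frames_poly[of f] continuous_on_poly_val[of frames] by (metis (no_types, lifting) continuous_on_cong)

text \<open>
  In dimension at least three rotations act transitively on frames, so the invariant measure is unique.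
\<close>

context
  fixes ty :: "'n::finite itself"
  assumes n: "CARD('n) \<ge> 3"
begin

abbreviation (input) "\<sigma> \<equiv> frame_measure :: ((real^'n) \<times> (real^'n)) measure"

lemma measurable_frame_measureI: "continuous_on frames f \<Longrightarrow> f \<in> borel_measurable \<sigma>"
  for f :: "_ \<Rightarrow> 'b::topological_space"
  unfolding measurable_cong_sets[OF sets_frame_measure[OF n] refl]
  by (rule borel_measurable_continuous_on_restrict)

lemma integrable_frame_measureI:
  fixes f :: "_ \<Rightarrow> real"
  assumes "continuous_on frames f"
  shows "integrable \<sigma> f"
proof -
  interpret prob_space \<sigma> by (rule prob_space_frame_measure[OF n])
  have "bounded (f ` frames)"
    using compact_continuous_image[OF assms compact_frames] by (rule compact_imp_bounded)
  then obtain B where "\<And>z. z \<in> frames \<Longrightarrow> norm (f z) \<le> B"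
    by (force simp: bounded_iff)
  then show ?thesis
    using measurable_frame_measureI[OF assms] by (intro integrable_const_bound[of _ B]) (auto simp: space_frame_measure[OF n])
qed

lemma continuous_on_rotate_pair: "continuous_on S (rotate_pair g)"
  unfolding rotate_pair_def case_prod_beta
  by (intro continuous_intros linear_continuous_on
      bounded_linear_compose[OF matrix_vector_mul_bounded_linear] bounded_linear_fst bounded_linear_snd)

lemma integral_rotate_pair:
  fixes f :: "(real^'n) \<times> (real^'n) \<Rightarrow> real"
  assumes "continuous_on frames f" and g: "rotation_matrix g"
  shows "integral\<^sup>L \<sigma> (\<lambda>z. f (rotate_pair g z)) = integral\<^sup>L \<sigma> f"
proof -
  have "rotate_pair g \<in> measurable \<sigma> \<sigma>"
    unfolding measurable_cong_sets[OF sets_frame_measure[OF n] sets_frame_measure[OF n]]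
    using rotate_pair_frames[OF g]
    by (intro measurable_restrict_space2 measurable_restrict_space1 rotate_pair_measurable) (auto simp: space_restrict_space)
  from integral_distr[OF this measurable_frame_measureI[OF assms(1)]] show ?thesis
    by (simp add: distr_frame_measure[OF n g])
qed

text \<open>
  The invariant measure has full support, so the semi-inner product of \<open>L\<^sup>2\<close> is definite on continuous functions.
\<close>

lemma integral_square_eq_0:
  fixes f :: "(real^'n) \<times> (real^'n) \<Rightarrow> real"
  assumes f: "continuous_on frames f" and 0: "integral\<^sup>L \<sigma> (\<lambda>z. f z * f z) = 0" and z: "z \<in> frames"
  shows "f z = 0"
proof (rule ccontr)
  assume nz: "f z \<noteq> 0"
  have "continuous_on frames (\<lambda>z. f z * f z)" using f by (intro continuous_intros)
  then have AE: "AE w in \<sigma>. f w * f w = 0"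
    using integral_nonneg_eq_0_iff_AE[of \<sigma> "\<lambda>z. f z * f z"] 0 integrable_frame_measureI by auto
  obtain e where e: "e > 0" "\<And>w. w \<in> frames \<Longrightarrow> dist w z < e \<Longrightarrow> dist (f w) (f z) < \<bar>f z\<bar>"
    using f z nz unfolding continuous_on_iff by (metis zero_less_abs_iff)
  have sub: "ball z e \<inter> frames \<subseteq> {w \<in> space \<sigma>. \<not> f w * f w = 0}"
  proof
    fix w assume w: "w \<in> ball z e \<inter> frames"
    then have "dist (f w) (f z) < \<bar>f z\<bar>" using e(2) by (auto simp: dist_commute)
    then show "w \<in> {w \<in> space \<sigma>. \<not> f w * f w = 0}"
      using w by (auto simp: space_frame_measure[OF n] dist_real_def)
  qed
  have meas: "ball z e \<inter> frames \<in> sets \<sigma>"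
    by (auto simp: sets_frame_measure[OF n] sets_restrict_space_iff frames_borel)
  have "AE w in \<sigma>. w \<notin> ball z e \<inter> frames"
    using AE AE_space by eventually_elim (use sub in auto)
  moreover have "{w \<in> space \<sigma>. \<not> w \<notin> ball z e \<inter> frames} = ball z e \<inter> frames"
    using sets.sets_into_space[OF meas] by blast
  ultimately have "emeasure \<sigma> (ball z e \<inter> frames) = 0"
    using AE_iff_measurable[OF meas, of "\<lambda>w. w \<notin> ball z e \<inter> frames"] by simp
  with emeasure_frame_ball[OF n z e(1)] show False by simp
qed

lemma integral_comb:
  fixes \<psi> :: "'i \<Rightarrow> (real^'n) \<times> (real^'n) \<Rightarrow> real"
  assumes cont: "\<And>i. i \<in> I \<Longrightarrow> continuous_on frames (\<psi> i)" and f: "continuous_on frames f"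
  shows "integral\<^sup>L \<sigma> (\<lambda>z. (\<Sum>i\<in>I. a i * \<psi> i z) * f z) = (\<Sum>i\<in>I. a i * integral\<^sup>L \<sigma> (\<lambda>z. \<psi> i z * f z))"
proof -
  have "integral\<^sup>L \<sigma> (\<lambda>z. \<Sum>i\<in>I. a i * (\<psi> i z * f z)) = (\<Sum>i\<in>I. integral\<^sup>L \<sigma> (\<lambda>z. a i * (\<psi> i z * f z)))"
    by (intro Bochner_Integration.integral_sum integrable_frame_measureI continuous_intros cont f)
  then show ?thesis by (simp add: sum_distrib_right mult.assoc)
qed

definition orthonormal :: "'i set \<Rightarrow> ('i \<Rightarrow> (real^'n) \<times> (real^'n) \<Rightarrow> real) \<Rightarrow> bool"
  where "orthonormal I \<psi> \<longleftrightarrow> finite I \<and> (\<forall>i\<in>I. continuous_on frames (\<psi> i)) \<and>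
    (\<forall>i\<in>I. \<forall>j\<in>I. integral\<^sup>L \<sigma> (\<lambda>z. \<psi> i z * \<psi> j z) = (if i = j then 1 else 0))"

lemma orthonormal_coefficient:
  assumes on: "orthonormal I \<psi>" and j: "j \<in> I"
  shows "integral\<^sup>L \<sigma> (\<lambda>z. (\<Sum>i\<in>I. a i * \<psi> i z) * \<psi> j z) = a j"
proof -
  have "integral\<^sup>L \<sigma> (\<lambda>z. (\<Sum>i\<in>I. a i * \<psi> i z) * \<psi> j z) = (\<Sum>i\<in>I. a i * integral\<^sup>L \<sigma> (\<lambda>z. \<psi> i z * \<psi> j z))"
    using on j by (intro integral_comb) (auto simp: orthonormal_def)
  also have "\<dots> = (\<Sum>i\<in>I. if i = j then a j else 0)"
    using on j by (intro sum.cong) (auto simp: orthonormal_def)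
  finally show ?thesis using on j by (simp add: orthonormal_def)
qed

lemma orthonormal_cont: "orthonormal I \<psi> \<Longrightarrow> continuous_on frames (\<lambda>z. \<Sum>i\<in>I. a i * \<psi> i z)"
  by (intro continuous_intros) (auto simp: orthonormal_def)

lemma orthonormal_norm:
  assumes on: "orthonormal I \<psi>"
  shows "integral\<^sup>L \<sigma> (\<lambda>z. (\<Sum>i\<in>I. a i * \<psi> i z) * (\<Sum>i\<in>I. a i * \<psi> i z)) = (\<Sum>i\<in>I. (a i)\<^sup>2)"
proof -
  have "integral\<^sup>L \<sigma> (\<lambda>z. (\<Sum>i\<in>I. a i * \<psi> i z) * (\<Sum>i\<in>I. a i * \<psi> i z))
     = (\<Sum>i\<in>I. a i * integral\<^sup>L \<sigma> (\<lambda>z. \<psi> i z * (\<Sum>i\<in>I. a i * \<psi> i z)))"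
    using on orthonormal_cont[OF on] by (intro integral_comb) (auto simp: orthonormal_def)
  also have "\<dots> = (\<Sum>i\<in>I. a i * a i)"
    using orthonormal_coefficient[OF on, of _ a] by (intro sum.cong) (simp_all add: mult.commute)
  finally show ?thesis by (simp add: power2_eq_square)
qed

text \<open>
  Orthonormalisation of a finite family inside a space of continuous functions. Vectors depending linearly on
  the earlier ones are dropped, so the size of the family bounds the size of the system. The functions
  count as equal when they agree on frames.
\<close>

lemma gram_schmidt:
  fixes \<phi> :: "'i \<Rightarrow> (real^'n) \<times> (real^'n) \<Rightarrow> real"
  assumes A: "finite A"
    and cont: "\<And>f. f \<in> V \<Longrightarrow> continuous_on frames f"
    and lin: "\<And>f g a b. f \<in> V \<Longrightarrow> g \<in> V \<Longrightarrow> (\<lambda>z. a * f z + b * g z) \<in> V"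
    and \<phi>: "\<And>i. i \<in> A \<Longrightarrow> \<phi> i \<in> V"
  shows "\<exists>E. E \<subseteq> V \<and> card E \<le> card A \<and> orthonormal E (\<lambda>e. e) \<and>
    (\<forall>i\<in>A. \<exists>c. \<forall>z\<in>frames. \<phi> i z = (\<Sum>e\<in>E. c e * e z))"
  using A \<phi>
proof (induction A rule: finite_induct)
  case empty
  then show ?case by (intro exI[of _ "{}"]) (auto simp: orthonormal_def)
next
  case (insert k A)
  then obtain E where E: "E \<subseteq> V" "card E \<le> card A" "orthonormal E (\<lambda>e. e)"
    "\<And>i. i \<in> A \<Longrightarrow> \<exists>c. \<forall>z\<in>frames. \<phi> i z = (\<Sum>e\<in>E. c e * e z)"
    by auto
  have finE: "finite E" using E(3) by (simp add: orthonormal_def)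
  have k: "\<phi> k \<in> V" using insert by simp
  define a where "a e = integral\<^sup>L \<sigma> (\<lambda>z. \<phi> k z * e z)" for e
  have zero: "(\<lambda>z. 0) \<in> V" using lin[OF k k, of 0 0] by simp
  have comb: "(\<lambda>z. \<Sum>e\<in>F. a e * e z) \<in> V" if "F \<subseteq> V" "finite F" for F
    using that(2,1)
  proof (induction F rule: finite_induct)
    case (insert e F)
    then show ?case using lin[of e "\<lambda>z. \<Sum>e\<in>F. a e * e z" "a e" 1] by simp
  qed (simp add: zero)
  define r where "r z = \<phi> k z - (\<Sum>e\<in>E. a e * e z)" for z
  have rV: "r \<in> V"
    using lin[OF k comb[OF E(1) finE], of 1 "-1"] by (simp add: r_def[abs_def])
  have r_orth: "integral\<^sup>L \<sigma> (\<lambda>z. r z * e z) = 0" if "e \<in> E" for e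
  proof -
    have "integral\<^sup>L \<sigma> (\<lambda>z. r z * e z)
        = integral\<^sup>L \<sigma> (\<lambda>z. \<phi> k z * e z - (\<Sum>e\<in>E. a e * e z) * e z)"
      by (simp add: r_def left_diff_distrib)
    also have "\<dots> = integral\<^sup>L \<sigma> (\<lambda>z. \<phi> k z * e z) - integral\<^sup>L \<sigma> (\<lambda>z. (\<Sum>e\<in>E. a e * e z) * e z)"
      using that E k cont comb[OF E(1) finE]
      by (intro Bochner_Integration.integral_diff integrable_frame_measureI continuous_intros) auto
    also have "\<dots> = 0" using orthonormal_coefficient[OF E(3) that] by (simp add: a_def)
    finally show ?thesis .
  qed
  define t where "t = integral\<^sup>L \<sigma> (\<lambda>z. r z * r z)"
  show ?case
  proof (cases "t = 0")
    case True
    have "r z = 0" if "z \<in> frames" for z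
      using integral_square_eq_0[OF cont[OF rV] True[unfolded t_def] that] .
    then have "\<forall>z\<in>frames. \<phi> k z = (\<Sum>e\<in>E. a e * e z)" by (simp add: r_def)
    then show ?thesis
      using E insert by (intro exI[of _ E]) auto
  next
    case False
    moreover have "t \<ge> 0" unfolding t_def by (rule integral_nonneg_AE) simp
    ultimately have t: "t > 0" by simp
    define s where "s z = (1 / sqrt t) * r z + 0 * r z" for z
    have s: "s z = r z / sqrt t" for z by (simp add: s_def)
    have sV: "s \<in> V" using lin[OF rV rV, of "1 / sqrt t" 0] by (simp add: s_def[abs_def])
    have ss: "integral\<^sup>L \<sigma> (\<lambda>z. s z * s z) = 1"
      using t by (simp add: s flip: t_def)
    have se: "integral\<^sup>L \<sigma> (\<lambda>z. s z * e z) = 0" "integral\<^sup>L \<sigma> (\<lambda>z. e z * s z) = 0" if "e \<in> E" for e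
      using r_orth[OF that] by (simp_all add: s mult.commute)
    have sE: "s \<notin> E" using ss se by auto
    have "orthonormal (insert s E) (\<lambda>e. e)"
      unfolding orthonormal_def
    proof (intro conjI ballI)
      show "integral\<^sup>L \<sigma> (\<lambda>z. i z * j z) = (if i = j then 1 else 0)"
        if "i \<in> insert s E" "j \<in> insert s E" for i j
        using that ss se sE E(3) by (auto simp: orthonormal_def)
    qed (use finE E cont sV in auto)
    moreover have "\<exists>c. \<forall>z\<in>frames. \<phi> i z = (\<Sum>e\<in>insert s E. c e * e z)" if "i \<in> insert k A" for i
    proof (cases "i = k")
      case True
      have "\<phi> k z = (\<Sum>e\<in>insert s E. (a(s := sqrt t)) e * e z)" for z
      proof -
        have "(\<Sum>e\<in>E. (a(s := sqrt t)) e * e z) = (\<Sum>e\<in>E. a e * e z)"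
          using sE by (intro sum.cong) auto
        then show ?thesis
          using t finE sE by (simp add: s r_def)
      qed
      then show ?thesis using True by blast
    next
      case False
      then obtain c where c: "\<forall>z\<in>frames. \<phi> i z = (\<Sum>e\<in>E. c e * e z)" using E(4) \<open>i \<in> insert k A\<close> by auto
      have "(\<Sum>e\<in>E. (c(s := 0)) e * e z) = (\<Sum>e\<in>E. c e * e z)" for z
        using sE by (intro sum.cong) auto
      then have "\<forall>z\<in>frames. \<phi> i z = (\<Sum>e\<in>insert s E. (c(s := 0)) e * e z)"
        using c finE sE by simp
      then show ?thesis by blast
    qed
    ultimately show ?thesis
      using E sV sE finE insert by (intro exI[of _ "insert s E"]) auto
  qed
qed

text \<open>
  The square root of the sum is the largest value at \<open>z\<close> of a function of norm one in the span. Rotating the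
  extremal function for the rotated point produces a competitor at \<open>z\<close>, so the sum does not increase when
  \<open>z\<close> is rotated; by transitivity it is constant, and its integral is the size of the system.
\<close>

lemma orthonormal_invariant_sum_squares:
  fixes \<psi> :: "'i \<Rightarrow> (real^'n) \<times> (real^'n) \<Rightarrow> real"
  assumes on: "orthonormal I \<psi>"
    and inv: "\<And>g i. rotation_matrix g \<Longrightarrow> i \<in> I \<Longrightarrow> \<exists>c. \<forall>z\<in>frames. \<psi> i (rotate_pair g z) = (\<Sum>j\<in>I. c j * \<psi> j z)"
    and z: "z \<in> frames"
  shows "(\<Sum>i\<in>I. (\<psi> i z)\<^sup>2) = card I"
proof -
  interpret prob_space \<sigma> by (rule prob_space_frame_measure[OF n])
  define S where "S z = (\<Sum>i\<in>I. (\<psi> i z)\<^sup>2)" for z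
  have Snn: "S z \<ge> 0" for z unfolding S_def by (intro sum_nonneg) auto
  have le: "S (rotate_pair g z) \<le> S z" if g: "rotation_matrix g" and z: "z \<in> frames" for g z
  proof -
    obtain c where c: "\<And>i z. i \<in> I \<Longrightarrow> z \<in> frames \<Longrightarrow> \<psi> i (rotate_pair g z) = (\<Sum>j\<in>I. c i j * \<psi> j z)"
    proof -
      have "\<forall>i\<in>I. \<exists>c. \<forall>z\<in>frames. \<psi> i (rotate_pair g z) = (\<Sum>j\<in>I. c j * \<psi> j z)" using inv[OF g] by blast
      from bchoice[OF this] show ?thesis using that by blast
    qed
    \<comment> \<open>Up to normalisation, \<open>h\<close> is the function of norm one with the largest value at the rotated point.\<close>
    define a where "a i = \<psi> i (rotate_pair g z)" for i
    define h where "h w = (\<Sum>i\<in>I. a i * \<psi> i w)" for w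
    define b where "b j = (\<Sum>i\<in>I. a i * c i j)" for j
    have hg: "h (rotate_pair g w) = (\<Sum>j\<in>I. b j * \<psi> j w)" if "w \<in> frames" for w
    proof -
      have "h (rotate_pair g w) = (\<Sum>i\<in>I. \<Sum>j\<in>I. a i * c i j * \<psi> j w)"
        unfolding h_def using c that by (intro sum.cong) (auto simp: sum_distrib_left mult.assoc)
      also have "\<dots> = (\<Sum>j\<in>I. \<Sum>i\<in>I. a i * c i j * \<psi> j w)" by (rule sum.swap)
      finally show ?thesis by (simp add: b_def sum_distrib_right)
    qed
    have hc: "continuous_on frames h" unfolding h_def using on by (rule orthonormal_cont)
    have "S (rotate_pair g z) = integral\<^sup>L \<sigma> (\<lambda>w. h w * h w)"
      unfolding h_def orthonormal_norm[OF on] by (simp add: S_def a_def)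
    also have "\<dots> = integral\<^sup>L \<sigma> (\<lambda>w. h (rotate_pair g w) * h (rotate_pair g w))"
      using integral_rotate_pair[of "\<lambda>w. h w * h w", OF _ g] hc by (simp add: continuous_on_mult)
    also have "\<dots> = integral\<^sup>L \<sigma> (\<lambda>w. (\<Sum>j\<in>I. b j * \<psi> j w) * (\<Sum>j\<in>I. b j * \<psi> j w))"
      by (intro Bochner_Integration.integral_cong) (auto simp: space_frame_measure[OF n] hg)
    also have "\<dots> = (\<Sum>j\<in>I. (b j)\<^sup>2)" by (rule orthonormal_norm[OF on])
    finally have Sb: "S (rotate_pair g z) = (\<Sum>j\<in>I. (b j)\<^sup>2)" .
    have "S (rotate_pair g z) = h (rotate_pair g z)" by (simp add: S_def h_def a_def power2_eq_square)
    then have "S (rotate_pair g z) = (\<Sum>j\<in>I. b j * \<psi> j z)" by (simp add: hg[OF z])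
    then have "(S (rotate_pair g z))\<^sup>2 \<le> (\<Sum>j\<in>I. (b j)\<^sup>2) * S z"
      unfolding S_def[of z] using Cauchy_Schwarz_ineq_sum[of b "\<lambda>j. \<psi> j z" I] by simp
    then have "S (rotate_pair g z) * S (rotate_pair g z) \<le> S (rotate_pair g z) * S z"
      unfolding Sb[symmetric] power2_eq_square[of "S (rotate_pair g z)"] .
    then show ?thesis using Snn[of "rotate_pair g z"] Snn[of z] by (cases "S (rotate_pair g z) = 0") auto
  qed
  have le': "S w \<le> S v" if vw: "v \<in> frames" "w \<in> frames" for v w
  proof -
    obtain g where g: "rotation_matrix g" "g *v fst v = fst w" "g *v snd v = snd w"
      using frames_transitive[OF n vw] .
    then have "rotate_pair g v = w" by (simp add: rotate_pair_def case_prod_beta)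
    then show ?thesis using le[OF g(1) vw(1)] by simp
  qed
  have const: "S w = S z" if "w \<in> frames" for w
    using le'[OF that z] le'[OF z that] by simp
  have "real (card I) = (\<Sum>i\<in>I. integral\<^sup>L \<sigma> (\<lambda>w. \<psi> i w * \<psi> i w))"
    using on by (simp add: orthonormal_def)
  also have "\<dots> = integral\<^sup>L \<sigma> (\<lambda>w. \<Sum>i\<in>I. \<psi> i w * \<psi> i w)"
    using on by (intro Bochner_Integration.integral_sum[symmetric] integrable_frame_measureI continuous_intros)
      (auto simp: orthonormal_def)
  also have "\<dots> = integral\<^sup>L \<sigma> (\<lambda>w. S z)"
    using const by (intro Bochner_Integration.integral_cong) (auto simp: space_frame_measure[OF n] S_def power2_eq_square)
  also have "\<dots> = S z" by (simp add: prob_space)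
  finally show ?thesis by (simp add: S_def)
qed

text \<open>
  An orthonormal system spanning the biforms on the set of frames has at most as many elements as there are
  monomials, and rotations preserve the bidegree.
\<close>

lemma biform_square_le:
  assumes p: "p \<in> biforms k l" and z: "z \<in> frames"
  shows "(poly_val p z)\<^sup>2 \<le> card (bimonoms k l :: 'n xymonom set) * integral\<^sup>L \<sigma> (\<lambda>z. (poly_val p z)\<^sup>2)"
proof -
  define V where "V = {poly_val p | p :: 'n xypoly. p \<in> biforms k l}"
  have "\<exists>E. E \<subseteq> V \<and> card E \<le> card (bimonoms k l :: 'n xymonom set) \<and> orthonormal E (\<lambda>e. e) \<and>
    (\<forall>m\<in>bimonoms k l. \<exists>c. \<forall>z\<in>frames. monom_val m z = (\<Sum>e\<in>E. c e * e z))"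
  proof (rule gram_schmidt[OF finite_bimonoms])
    show "continuous_on frames f" if "f \<in> V" for f
      using that continuous_on_poly_val by (auto simp: V_def)
    show "(\<lambda>z. a * f z + b * g z) \<in> V" if fg: "f \<in> V" "g \<in> V" for f g a b
    proof -
      obtain p q where "p \<in> biforms k l" "q \<in> biforms k l" "f = poly_val p" "g = poly_val q"
        using fg by (auto simp: V_def)
      then show ?thesis
        unfolding V_def by (intro CollectI exI[of _ "const a * p + const b * q"])
          (auto simp: poly_val_add poly_val_const_mult biforms_add biforms_const_mult)
    qed
    show "monom_val m \<in> V" if "m \<in> bimonoms k l" for m
      using that unfolding V_def by (intro CollectI exI[of _ "Poly_Mapping.single m 1"])
        (auto simp: poly_val_single biforms_single bimonoms_def)
  qed
  then obtain E where E: "E \<subseteq> V" "card E \<le> card (bimonoms k l :: 'n xymonom set)" "orthonormal E (\<lambda>e. e)"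
    "\<forall>m\<in>bimonoms k l. \<exists>c. \<forall>z\<in>frames. monom_val m z = (\<Sum>e\<in>E. c e * e z)" by blast
  from bchoice[OF E(4)] obtain C
    where C: "\<And>m z. m \<in> bimonoms k l \<Longrightarrow> z \<in> frames \<Longrightarrow> monom_val m z = (\<Sum>e\<in>E. C m e * e z)"
    by blast
  have expand: "\<exists>a. \<forall>z\<in>frames. poly_val q z = (\<Sum>e\<in>E. a e * e z)" if "q \<in> biforms k l" for q
  proof (intro exI ballI)
    fix z :: "(real^'n) \<times> (real^'n)" assume z: "z \<in> frames"
    have "poly_val q z = (\<Sum>m\<in>bimonoms k l. \<Sum>e\<in>E. Poly_Mapping.lookup q m * C m e * e z)"
      unfolding biforms_eq_sum_bimonoms[OF that] using C z
      by (intro sum.cong) (auto simp: sum_distrib_left mult.assoc)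
    also have "\<dots> = (\<Sum>e\<in>E. (\<Sum>m\<in>bimonoms k l. Poly_Mapping.lookup q m * C m e) * e z)"
      by (subst sum.swap) (simp add: sum_distrib_right)
    finally show "poly_val q z = (\<Sum>e\<in>E. (\<Sum>m\<in>bimonoms k l. Poly_Mapping.lookup q m * C m e) * e z)" .
  qed
  have "(\<Sum>e\<in>E. (e z)\<^sup>2) = card E"
  proof (rule orthonormal_invariant_sum_squares[OF E(3) _ z])
    fix g :: "real^'n^'n" and e assume g: "rotation_matrix g" and "e \<in> E"
    then obtain q where q: "q \<in> biforms k l" "e = poly_val q" using E(1) by (auto simp: V_def)
    obtain q' where q': "q' \<in> biforms k l" "\<forall>x y. poly_val q' (x, y) = poly_val q (g *v x, g *v y)"
      using biforms_rotate[OF q(1)] by blast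
    have "e (rotate_pair g z) = poly_val q' z" for z
      using q'(2) by (cases z) (simp add: q(2) rotate_pair_def)
    then show "\<exists>c. \<forall>z\<in>frames. e (rotate_pair g z) = (\<Sum>j\<in>E. c j * j z)"
      using expand[OF q'(1)] by simp
  qed
  moreover obtain a where a: "\<And>z. z \<in> frames \<Longrightarrow> poly_val p z = (\<Sum>e\<in>E. a e * e z)"
    using expand[OF p] by blast
  moreover have "integral\<^sup>L \<sigma> (\<lambda>z. (poly_val p z)\<^sup>2) = (\<Sum>e\<in>E. (a e)\<^sup>2)"
    unfolding orthonormal_norm[OF E(3), symmetric]
    by (intro Bochner_Integration.integral_cong) (auto simp: space_frame_measure[OF n] a power2_eq_square)
  moreover have "(\<Sum>e\<in>E. a e * e z)\<^sup>2 \<le> (\<Sum>e\<in>E. (a e)\<^sup>2) * (\<Sum>e\<in>E. (e z)\<^sup>2)"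
    by (rule Cauchy_Schwarz_ineq_sum)
  ultimately have "(poly_val p z)\<^sup>2 \<le> integral\<^sup>L \<sigma> (\<lambda>z. (poly_val p z)\<^sup>2) * card E"
    using z by simp
  also have "\<dots> \<le> integral\<^sup>L \<sigma> (\<lambda>z. (poly_val p z)\<^sup>2) * card (bimonoms k l :: 'n xymonom set)"
    using E(2) by (intro mult_left_mono) auto
  finally show ?thesis by (simp add: mult.commute)
qed

lemma Q_val_power_le:
  fixes f :: "'n Q"
  assumes z: "z \<in> frames"
  shows "Q_val f z ^ (2 * j) \<le> card (bimonoms (2 * j) (2 * j) :: 'n xymonom set) * integral\<^sup>L \<sigma> (\<lambda>z. Q_val f z ^ (2 * j))"
proof -
  obtain p where p: "p \<in> biforms 2 2" "f = abs_Q p" "\<And>z. z \<in> frames \<Longrightarrow> Q_val f z = poly_val p z"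
    using Q_val_frames_poly[of f] by blast
  have pj: "p ^ j \<in> biforms (2 * j) (2 * j)"
    using biforms_power[OF p(1), of j] by (simp add: mult.commute)
  have "integral\<^sup>L \<sigma> (\<lambda>z. Q_val f z ^ (2 * j)) = integral\<^sup>L \<sigma> (\<lambda>z. (poly_val (p ^ j) z)\<^sup>2)"
    by (intro Bochner_Integration.integral_cong)
       (auto simp: space_frame_measure[OF n] p(3) poly_val_power power_mult mult.commute[of 2] simp flip: power_mult)
  moreover have "Q_val f z ^ (2 * j) = (poly_val (p ^ j) z)\<^sup>2"
    using z by (simp add: p(3) poly_val_power mult.commute[of 2] power_mult)
  ultimately show ?thesis using biform_square_le[OF pj z] by simp
qed

subsection \<open>Isometries onto the forms of mean zero\<close>

lemma frames_in_variety: "z \<in> frames \<Longrightarrow> z \<in> variety"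
  using frames_subset_variety by blast

lemma Q_val_norms_frames: "z \<in> frames \<Longrightarrow> Q_val Q_norms z = 1"
  using frames_in_variety[of z] by (cases z) (simp add: Q_val_norms frames_def dot_square_norm)

lemma inner_M_add: "inner_M (f + g) h = inner_M f h + inner_M g (h :: 'n Q)"
proof -
  have "inner_M (f + g) h = integral\<^sup>L \<sigma> (\<lambda>z. Q_val f z * Q_val h z + Q_val g z * Q_val h z)"
    unfolding inner_M_def
    by (intro Bochner_Integration.integral_cong)
       (auto simp: space_frame_measure[OF n] frames_in_variety Q_val_add distrib_right)
  also have "\<dots> = inner_M f h + inner_M g h"
    unfolding inner_M_def
    by (intro Bochner_Integration.integral_add integrable_frame_measureI continuous_intros continuous_on_Q_val)
  finally show ?thesis .
qed

lemma inner_M_scaleR: "inner_M (c *\<^sub>R f) h = c * inner_M f (h :: 'n Q)"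
proof -
  have "inner_M (c *\<^sub>R f) h = integral\<^sup>L \<sigma> (\<lambda>z. c * (Q_val f z * Q_val h z))"
    unfolding inner_M_def
    by (intro Bochner_Integration.integral_cong)
       (auto simp: space_frame_measure[OF n] frames_in_variety Q_val_scaleR)
  then show ?thesis by (simp add: inner_M_def)
qed

lemma inner_M_commute: "inner_M f g = inner_M g f"
  by (simp add: inner_M_def mult.commute)

lemma inner_M_sum: "inner_M (\<Sum>i\<in>I. c i *\<^sub>R f i) h = (\<Sum>i\<in>I. c i * inner_M (f i) (h :: 'n Q))"
proof -
  have "inner_M 0 h = 0" using inner_M_scaleR[of 0 0 h] by simp
  then show ?thesis
    by (induction I rule: infinite_finite_induct) (auto simp: inner_M_add inner_M_scaleR)
qed

lemma inner_M_norms: "inner_M f Q_norms = integral\<^sup>L \<sigma> (Q_val f)"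
  unfolding inner_M_def
  by (intro Bochner_Integration.integral_cong) (auto simp: space_frame_measure[OF n] Q_val_norms_frames)

lemma inner_M_norms_norms: "inner_M Q_norms (Q_norms :: 'n Q) = 1"
proof -
  interpret prob_space \<sigma> by (rule prob_space_frame_measure[OF n])
  have "integral\<^sup>L \<sigma> (Q_val Q_norms) = integral\<^sup>L \<sigma> (\<lambda>z. 1)"
    by (intro Bochner_Integration.integral_cong) (auto simp: space_frame_measure[OF n] Q_val_norms_frames)
  then show ?thesis by (simp add: inner_M_norms prob_space)
qed

lemma M_Q_iff: "f \<in> M_Q \<longleftrightarrow> inner_M f (Q_norms :: 'n Q) = 0"
  by (simp add: M_Q_def inner_M_norms)

text \<open>
  An orthonormal system spanning \<open>M_Q\<close>, extended by the constant function \<open>Q_norms\<close>, is a basis of \<open>Q\<close>; hence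
  it has one element less than the dimension of \<open>Q\<close>, which is the dimension demanded of \<open>M_Q\<close>.
\<close>

lemma isometry_exists: "\<exists>\<phi> :: real ^ 'n M_index \<Rightarrow> 'n Q. isometry_M \<phi>"
proof -
  obtain B :: "'n Q set" where B: "finite B" "span B = UNIV" using dim_Q(2)[where 'n = 'n] n by auto
  define V where "V = {h. continuous_on frames h \<and> (\<exists>f :: 'n Q. f \<in> M_Q \<and> (\<forall>z\<in>frames. h z = Q_val f z))}"
  \<comment> \<open>The orthogonal projection to the forms of mean zero.\<close>
  define pr where "pr f = f - inner_M f Q_norms *\<^sub>R Q_norms" for f :: "'n Q"
  have prM: "pr f \<in> M_Q" for f
  proof -
    have "inner_M (pr f + inner_M f Q_norms *\<^sub>R Q_norms) Q_norms = inner_M f Q_norms"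
      by (simp add: pr_def)
    then show ?thesis
      by (simp add: M_Q_iff inner_M_add inner_M_scaleR inner_M_norms_norms)
  qed
  have "\<exists>E. E \<subseteq> V \<and> card E \<le> card B \<and> orthonormal E (\<lambda>e. e) \<and>
    (\<forall>b\<in>B. \<exists>c. \<forall>z\<in>frames. Q_val (pr b) z = (\<Sum>e\<in>E. c e * e z))"
  proof (rule gram_schmidt[OF B(1)])
    show "continuous_on frames f" if "f \<in> V" for f using that by (simp add: V_def)
    show "(\<lambda>z. a * f z + b * g z) \<in> V" if fg: "f \<in> V" "g \<in> V" for f g a b
    proof -
      obtain F G where FG: "F \<in> M_Q" "G \<in> M_Q" "\<forall>z\<in>frames. f z = Q_val F z" "\<forall>z\<in>frames. g z = Q_val G z"
        using fg by (auto simp: V_def)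
      have "a *\<^sub>R F + b *\<^sub>R G \<in> M_Q"
        using FG by (simp add: M_Q_iff inner_M_add inner_M_scaleR)
      moreover have "\<forall>z\<in>frames. a * f z + b * g z = Q_val (a *\<^sub>R F + b *\<^sub>R G) z"
        using FG by (simp add: Q_val_add Q_val_scaleR frames_in_variety)
      moreover have "continuous_on frames (\<lambda>z. a * f z + b * g z)"
        using fg by (intro continuous_intros) (auto simp: V_def)
      ultimately show ?thesis unfolding V_def by blast
    qed
    show "Q_val (pr b) \<in> V" for b
      using prM continuous_on_Q_val unfolding V_def by blast
  qed
  then obtain E where E: "E \<subseteq> V" "orthonormal E (\<lambda>e. e)"
    "\<forall>b\<in>B. \<exists>c. \<forall>z\<in>frames. Q_val (pr b) z = (\<Sum>e\<in>E. c e * e z)" by blast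
  have finE: "finite E" using E(2) by (simp add: orthonormal_def)
  have "\<forall>e\<in>E. \<exists>f. f \<in> M_Q \<and> (\<forall>z\<in>frames. e z = Q_val f z)" using E(1) by (auto simp: V_def)
  from bchoice[OF this] obtain F where F: "\<And>e. e \<in> E \<Longrightarrow> F e \<in> M_Q"
    "\<And>e z. e \<in> E \<Longrightarrow> z \<in> frames \<Longrightarrow> e z = Q_val (F e) z" by blast
  have onF: "inner_M (F e) (F e') = (if e = e' then 1 else 0)" if "e \<in> E" "e' \<in> E" for e e'
  proof -
    have "inner_M (F e) (F e') = integral\<^sup>L \<sigma> (\<lambda>z. e z * e' z)"
      unfolding inner_M_def
      by (intro Bochner_Integration.integral_cong) (use that F in \<open>auto simp: space_frame_measure[OF n]\<close>)
    then show ?thesis using E(2) that by (simp add: orthonormal_def)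
  qed
  have injF: "inj_on F E" by (rule inj_onI) (metis onF zero_neq_one)
  define W where "W = insert Q_norms (F ` E)"
  have norms_F: "inner_M (F e) Q_norms = 0" "inner_M Q_norms (F e) = 0" if "e \<in> E" for e
    using F(1)[OF that] by (auto simp: M_Q_iff inner_M_commute)
  have notin: "Q_norms \<notin> F ` E" using norms_F inner_M_norms_norms by (metis imageE zero_neq_one)
  have ip: "inner_M v w = (if v = w then 1 else 0)" if "v \<in> W" "w \<in> W" for v w
    using that notin onF norms_F inner_M_norms_norms injF unfolding W_def by (auto simp: inj_on_eq_iff)
  have indep: "independent W"
  proof (rule independent_if_scalars_zero)
    show "finite W" using finE by (simp add: W_def)
    fix f w assume 0: "(\<Sum>x\<in>W. f x *\<^sub>R x) = 0" and w: "w \<in> W"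
    have "0 = inner_M (\<Sum>x\<in>W. f x *\<^sub>R x) w" using inner_M_scaleR[of 0 0 w] by (simp add: 0)
    also have "\<dots> = (\<Sum>x\<in>W. f x * inner_M x w)" by (rule inner_M_sum)
    also have "\<dots> = (\<Sum>x\<in>W. if x = w then f w else 0)" using ip w by (intro sum.cong) auto
    also have "\<dots> = f w" using finE w by (simp add: W_def)
    finally show "f w = 0" by simp
  qed
  have spanW: "span W = UNIV"
  proof -
    have "B \<subseteq> span W"
    proof
      fix b assume "b \<in> B"
      then obtain c where c: "\<forall>z\<in>frames. Q_val (pr b) z = (\<Sum>e\<in>E. c e * e z)" using E(3) by blast
      have "pr b - (\<Sum>e\<in>E. c e *\<^sub>R F e) = 0"
      proof (rule Q_eq_0I)
        show "2 \<le> CARD('n)" using n by simp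
        show "Q_val (pr b - (\<Sum>e\<in>E. c e *\<^sub>R F e)) z = 0" if "z \<in> frames" for z
          using that c F(2) frames_in_variety[OF that]
          by (simp add: Q_val_diff Q_val_sum Q_val_scaleR)
      qed
      then have "b = (\<Sum>e\<in>E. c e *\<^sub>R F e) + inner_M b Q_norms *\<^sub>R Q_norms"
        by (simp add: pr_def diff_eq_eq)
      also have "\<dots> \<in> span W"
        unfolding W_def by (intro span_add span_sum span_scale span_base) auto
      finally show "b \<in> span W" .
    qed
    then have "span B \<subseteq> span W" by (simp add: span_minimal)
    then show ?thesis using B by auto
  qed
  have "dim (UNIV :: 'n Q set) = card W"
    by (rule dim_eq_card) (use spanW indep in auto)
  also have "card W = card E + 1"
    using notin finE by (simp add: W_def card_image[OF injF])
  finally have "card E = dim_M CARD('n)"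
    using dim_Q(1)[where 'n = 'n] n by (simp add: dim_M_def)
  then have "card E = card (UNIV :: 'n M_index set)"
    using card_M_index[where 'n = 'n] n by simp
  then obtain \<beta> where \<beta>: "bij_betw \<beta> (UNIV :: 'n M_index set) E"
    using finE finite_same_card_bij[of "UNIV :: 'n M_index set" E] by auto
  have \<beta>E: "\<beta> i \<in> E" for i using \<beta> by (auto simp: bij_betw_def)
  define \<phi> where "\<phi> u = (\<Sum>i\<in>UNIV. (u $ i) *\<^sub>R F (\<beta> i))" for u :: "real ^ 'n M_index"
  have lin: "linear \<phi>"
    by (rule linearI) (auto simp: \<phi>_def scaleR_left_distrib sum.distrib scaleR_sum_right)
  have \<phi>F: "inner_M (F (\<beta> i)) (F (\<beta> j)) = (if i = j then 1 else 0)" for i j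
    using \<beta> \<beta>E onF by (auto simp: bij_betw_def inj_on_eq_iff)
  have "inner_M (\<phi> u) (\<phi> v) = u \<bullet> v" for u v
  proof -
    have "inner_M (F (\<beta> i)) (\<phi> v) = v $ i" for i
      unfolding inner_M_commute[of _ "\<phi> v"]
      by (simp add: \<phi>_def[of v] inner_M_sum \<phi>F if_distrib cong: if_cong)
    then show ?thesis
      by (simp add: \<phi>_def[of u] inner_M_sum inner_vec_def)
  qed
  moreover have "range \<phi> = M_Q"
  proof
    show "range \<phi> \<subseteq> M_Q"
      using F(1)[OF \<beta>E] by (auto simp: M_Q_iff \<phi>_def inner_M_sum)
    show "M_Q \<subseteq> range \<phi>"
    proof
      fix f :: "'n Q" assume f: "f \<in> M_Q"
      have "f \<in> span (insert Q_norms (F ` E))" using spanW by (simp add: W_def)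
      then obtain k where k: "f - k *\<^sub>R Q_norms \<in> span (F ` E)" by (auto simp: span_insert)
      have "F ` E \<subseteq> range \<phi>"
      proof
        fix x assume "x \<in> F ` E"
        then obtain i where "x = F (\<beta> i)" using \<beta> by (auto simp: bij_betw_def)
        then have "x = \<phi> (axis i 1)"
          by (simp add: \<phi>_def axis_def if_distrib[of "\<lambda>c. c *\<^sub>R _"] cong: if_cong)
        then show "x \<in> range \<phi>" by blast
      qed
      moreover have "subspace (range \<phi>)" using lin by (simp add: linear_subspace_image)
      ultimately have "span (F ` E) \<subseteq> range \<phi>" by (rule span_minimal)
      then obtain u where u: "f - k *\<^sub>R Q_norms = \<phi> u" using k by blast
      then have "f = \<phi> u + k *\<^sub>R Q_norms" by (simp add: diff_eq_eq)
      moreover have "inner_M (\<phi> u) Q_norms = 0"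
        using \<open>range \<phi> \<subseteq> M_Q\<close> by (auto simp flip: M_Q_iff)
      ultimately have "k = 0"
        using f by (simp add: M_Q_iff inner_M_add inner_M_scaleR inner_M_norms_norms)
      then show "f \<in> range \<phi>" using u by simp
    qed
  qed
  ultimately show ?thesis using lin unfolding isometry_M_def by blast
qed

lemma isometry_expand:
  fixes \<phi> :: "real ^ 'n M_index \<Rightarrow> 'n Q"
  assumes iso: "isometry_M \<phi>" and z: "z \<in> frames"
  shows "Q_val (\<phi> u) z = (\<Sum>i\<in>UNIV. u $ i * Q_val (\<phi> (axis i 1)) z)"
proof -
  have lin: "linear \<phi>" using iso by (simp add: isometry_M_def)
  have "\<phi> u = \<phi> (\<Sum>i\<in>UNIV. (u $ i) *\<^sub>R axis i 1)" by (simp add: basis_expansion flip: scalar_mult_eq_scaleR)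
  also have "\<dots> = (\<Sum>i\<in>UNIV. (u $ i) *\<^sub>R \<phi> (axis i 1))"
    by (simp add: linear_sum[OF lin] linear_scale[OF lin])
  finally show ?thesis using frames_in_variety[OF z] by (simp add: Q_val_sum Q_val_scaleR)
qed

text \<open>
  The images of the coordinate vectors are an orthonormal basis of the rotation invariant space \<open>M_Q\<close>.
\<close>

lemma isometry_kernel:
  fixes \<phi> :: "real ^ 'n M_index \<Rightarrow> 'n Q"
  assumes iso: "isometry_M \<phi>" and z: "z \<in> frames"
  shows "(\<Sum>i\<in>UNIV. (Q_val (\<phi> (axis i 1)) z)\<^sup>2) = dim_M CARD('n)"
proof -
  have rng: "range \<phi> = M_Q" and ip: "\<And>u v. inner_M (\<phi> u) (\<phi> v) = u \<bullet> v"
    using iso by (auto simp: isometry_M_def)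
  note expand = isometry_expand[OF iso]
  have "(\<Sum>i\<in>(UNIV :: 'n M_index set). (Q_val (\<phi> (axis i 1)) z)\<^sup>2) = card (UNIV :: 'n M_index set)"
  proof (rule orthonormal_invariant_sum_squares[OF _ _ z])
    show "orthonormal (UNIV :: 'n M_index set) (\<lambda>i. Q_val (\<phi> (axis i 1)))"
      using ip[unfolded inner_M_def] continuous_on_Q_val
      by (auto simp: orthonormal_def inner_axis_axis)
    fix g :: "real^'n^'n" and i :: "'n M_index" assume g: "rotation_matrix g"
    define f where "f = \<phi> (axis i 1)"
    have fM: "f \<in> M_Q" using rng by (auto simp: f_def)
    obtain p where p: "p \<in> biforms 2 2" "f = abs_Q p" "\<forall>z\<in>frames. Q_val f z = poly_val p z"
      using Q_val_frames_poly[of f] by blast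
    obtain p' where p': "p' \<in> biforms 2 2" "\<forall>x y. poly_val p' (x, y) = poly_val p (g *v x, g *v y)"
      using biforms_rotate[OF p(1)] by blast
    have eq: "Q_val (abs_Q p') z = Q_val f (rotate_pair g z)" if "z \<in> frames" for z
      using p'(2) Q_val_abs[OF p'(1) frames_in_variety[OF that]] p(3) rotate_pair_frames[OF g that]
      by (cases z) (simp add: rotate_pair_def)
    have "integral\<^sup>L \<sigma> (Q_val (abs_Q p')) = integral\<^sup>L \<sigma> (\<lambda>z. Q_val f (rotate_pair g z))"
      by (intro Bochner_Integration.integral_cong) (auto simp: space_frame_measure[OF n] eq)
    also have "\<dots> = integral\<^sup>L \<sigma> (Q_val f)" by (rule integral_rotate_pair[OF continuous_on_Q_val g])
    finally have "abs_Q p' \<in> M_Q" using fM by (simp add: M_Q_def)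
    then obtain u where u: "abs_Q p' = \<phi> u" using rng by blast
    have "Q_val f (rotate_pair g z) = (\<Sum>i\<in>UNIV. u $ i * Q_val (\<phi> (axis i 1)) z)" if "z \<in> frames" for z
      using eq[OF that] expand[OF that, of u] u by simp
    then show "\<exists>c. \<forall>z\<in>frames. Q_val (\<phi> (axis i 1)) (rotate_pair g z) = (\<Sum>j\<in>UNIV. c j * Q_val (\<phi> (axis j 1)) z)"
      by (auto simp: f_def)
  qed
  then show ?thesis using card_M_index[where 'n = 'n] n by simp
qed

end

section \<open>Moments of linear functionals on the unit ball\<close>

text \<open>
  For \<open>\<tau> \<le> 1\<close>, every \<open>u\<close> in the cap satisfies \<open>norm (u - \<tau> e)\<^sup>2 \<le> 1 - 2 \<tau>\<^sup>2 + \<tau>\<^sup>2\<close>, so the cap lies in a ball of radius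
  \<open>sqrt (1 - \<tau>\<^sup>2) \<le> exp (- \<tau>\<^sup>2 / 2)\<close>. For larger \<open>\<tau>\<close> it is empty.
\<close>

lemma emeasure_cap_le:
  fixes e :: "'e::euclidean_space" and \<tau> :: real
  assumes e: "norm e = 1" and \<tau>: "\<tau> \<ge> 0"
  shows "emeasure lborel {u \<in> cball 0 1. \<tau> \<le> u \<bullet> e} \<le> ennreal (exp (- (DIM('e) * \<tau>\<^sup>2 / 2))) * emeasure lborel (cball (0 :: 'e) 1)"
proof (cases "\<tau> \<le> 1")
  case False
  have "u \<bullet> e \<le> 1" if "norm u \<le> 1" for u
    using norm_cauchy_schwarz[of u e] that e by simp
  then have "{u \<in> cball 0 1. \<tau> \<le> u \<bullet> e} = {}" using False by fastforce
  then show ?thesis by (simp only: emeasure_empty) simp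
next
  case True
  then have t1: "1 - \<tau>\<^sup>2 \<ge> 0" using \<tau> by (simp add: power_le_one)
  have sub: "{u \<in> cball 0 1. \<tau> \<le> u \<bullet> e} \<subseteq> cball (\<tau> *\<^sub>R e) (sqrt (1 - \<tau>\<^sup>2))"
  proof
    fix u assume u: "u \<in> {u \<in> cball 0 1. \<tau> \<le> u \<bullet> e}"
    have "(u - \<tau> *\<^sub>R e) \<bullet> (u - \<tau> *\<^sub>R e) = u \<bullet> u - 2 * \<tau> * (u \<bullet> e) + \<tau>\<^sup>2 * (e \<bullet> e)"
      by (simp add: inner_diff_left inner_diff_right inner_commute power2_eq_square algebra_simps)
    then have "(norm (u - \<tau> *\<^sub>R e))\<^sup>2 = (norm u)\<^sup>2 - 2 * \<tau> * (u \<bullet> e) + \<tau>\<^sup>2"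
      using e by (simp add: dot_square_norm)
    also have "\<dots> \<le> 1 - 2 * \<tau> * \<tau> + \<tau>\<^sup>2"
      using u \<tau> by (intro add_mono diff_mono mult_left_mono) (auto simp: power_le_one)
    finally have "(norm (u - \<tau> *\<^sub>R e))\<^sup>2 \<le> 1 - \<tau>\<^sup>2" by (simp add: power2_eq_square)
    then show "u \<in> cball (\<tau> *\<^sub>R e) (sqrt (1 - \<tau>\<^sup>2))"
      by (simp add: dist_norm norm_minus_commute real_le_rsqrt)
  qed
  have "sqrt (1 - \<tau>\<^sup>2) \<le> exp (- (\<tau>\<^sup>2 / 2))"
  proof (rule real_le_lsqrt)
    show "1 - \<tau>\<^sup>2 \<le> (exp (- (\<tau>\<^sup>2 / 2)))\<^sup>2"
      using exp_ge_add_one_self[of "- \<tau>\<^sup>2"] by (simp flip: exp_double)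
  qed simp
  then have "sqrt (1 - \<tau>\<^sup>2) ^ DIM('e) \<le> exp (- (\<tau>\<^sup>2 / 2)) ^ DIM('e)"
    using t1 by (intro power_mono) auto
  also have "\<dots> = exp (- (DIM('e) * \<tau>\<^sup>2 / 2))" by (simp flip: exp_of_nat_mult)
  finally have pw: "sqrt (1 - \<tau>\<^sup>2) ^ DIM('e) \<le> exp (- (DIM('e) * \<tau>\<^sup>2 / 2))" .
  have "emeasure lborel {u \<in> cball 0 1. \<tau> \<le> u \<bullet> e} \<le> emeasure lborel (cball (\<tau> *\<^sub>R e) (sqrt (1 - \<tau>\<^sup>2)))"
    by (intro emeasure_mono sub) simp
  also have "\<dots> = ennreal (unit_ball_vol DIM('e) * sqrt (1 - \<tau>\<^sup>2) ^ DIM('e))"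
    using t1 by (simp add: emeasure_cball)
  also have "\<dots> \<le> ennreal (exp (- (DIM('e) * \<tau>\<^sup>2 / 2)) * unit_ball_vol DIM('e))"
    using pw by (intro ennreal_leI) (simp add: mult.commute mult_left_mono)
  also have "\<dots> = ennreal (exp (- (DIM('e) * \<tau>\<^sup>2 / 2))) * emeasure lborel (cball (0 :: 'e) 1)"
    by (simp add: emeasure_cball ennreal_mult)
  finally show ?thesis .
qed

lemma emeasure_slab_complement_le:
  fixes q :: "'e::euclidean_space"
  assumes q: "(norm q)\<^sup>2 = DIM('e)" and t: "t \<ge> 0"
  shows "emeasure lborel {u \<in> cball 0 1. t \<le> (u \<bullet> q)\<^sup>2 / 2} \<le> ennreal (2 * exp (- t)) * emeasure lborel (cball (0 :: 'e) 1)"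
proof -
  define d where "d = sqrt (real DIM('e))"
  have d: "d > 0" by (simp add: d_def)
  have nq: "norm q = d" using q by (metis d_def norm_ge_zero real_sqrt_unique)
  define e where "e = q /\<^sub>R d"
  have e: "norm e = 1" using d nq by (simp add: e_def)
  have qe: "q = d *\<^sub>R e" using d by (simp add: e_def)
  define \<tau> where "\<tau> = sqrt (2 * t) / d"
  have \<tau>: "\<tau> \<ge> 0" using t d by (simp add: \<tau>_def)
  have \<tau>2: "DIM('e) * \<tau>\<^sup>2 / 2 = t" using t by (simp add: \<tau>_def d_def power_divide)
  have sub: "{u \<in> cball 0 1. t \<le> (u \<bullet> q)\<^sup>2 / 2} \<subseteq> {u \<in> cball 0 1. \<tau> \<le> u \<bullet> e} \<union> {u \<in> cball 0 1. \<tau> \<le> u \<bullet> (- e)}"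
  proof
    fix u assume u: "u \<in> {u \<in> cball 0 1. t \<le> (u \<bullet> q)\<^sup>2 / 2}"
    then have "2 * t \<le> (d * (u \<bullet> e))\<^sup>2" by (simp add: qe)
    then have "sqrt (2 * t) \<le> \<bar>d * (u \<bullet> e)\<bar>" using real_sqrt_le_mono by fastforce
    then have "\<tau> \<le> \<bar>u \<bullet> e\<bar>" using d by (simp add: \<tau>_def abs_mult divide_le_eq mult.commute)
    then show "u \<in> {u \<in> cball 0 1. \<tau> \<le> u \<bullet> e} \<union> {u \<in> cball 0 1. \<tau> \<le> u \<bullet> (- e)}" using u by auto
  qed
  have m: "{u \<in> cball 0 1. \<tau> \<le> u \<bullet> w} \<in> sets lborel" for w :: 'e
  proof -
    have "{u \<in> cball 0 1. \<tau> \<le> u \<bullet> w} = cball 0 1 \<inter> {u. \<tau> \<le> u \<bullet> w}" by auto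
    moreover have "closed \<dots>" by (intro closed_Int closed_cball closed_Collect_le continuous_intros)
    ultimately show ?thesis by simp
  qed
  have "emeasure lborel {u \<in> cball 0 1. t \<le> (u \<bullet> q)\<^sup>2 / 2}
      \<le> emeasure lborel ({u \<in> cball 0 1. \<tau> \<le> u \<bullet> e} \<union> {u \<in> cball 0 1. \<tau> \<le> u \<bullet> (- e)})"
    using m by (intro emeasure_mono sub) auto
  also have "\<dots> \<le> emeasure lborel {u \<in> cball 0 1. \<tau> \<le> u \<bullet> e} + emeasure lborel {u \<in> cball 0 1. \<tau> \<le> u \<bullet> (- e)}"
    using m by (intro emeasure_subadditive)
  also have "\<dots> \<le> ennreal (exp (- t)) * emeasure lborel (cball (0 :: 'e) 1) + ennreal (exp (- t)) * emeasure lborel (cball (0 :: 'e) 1)"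
    using emeasure_cap_le[OF e \<tau>] emeasure_cap_le[of "- e", OF _ \<tau>] e unfolding \<tau>2 by (intro add_mono) auto
  also have "\<dots> = ennreal (2 * exp (- t)) * emeasure lborel (cball (0 :: 'e) 1)"
    by (simp add: ennreal_plus[symmetric] distrib_right[symmetric] del: ennreal_plus)
  finally show ?thesis .
qed

lemma nn_integral_layer_power:
  assumes "s \<ge> 0" "p > 0"
  shows "(\<integral>\<^sup>+t. ennreal (real p * t ^ (p - 1)) * indicator {0..s} t \<partial>lborel) = ennreal (s ^ p)"
proof -
  have "(\<integral>\<^sup>+t. ennreal (real p * t ^ (p - 1)) * indicator {0..s} t \<partial>lborel) = ennreal (s ^ p - 0 ^ p)"
    using assms by (intro nn_integral_FTC_Icc) (auto intro!: derivative_eq_intros)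
  then show ?thesis using assms by simp
qed

text \<open>
  With \<open>s u = (u \<bullet> q)\<^sup>2 / 2\<close>, the power \<open>s u ^ p\<close> is the integral of \<open>p t\<^sup>p\<^sup>-\<^sup>1\<close> over \<open>0 \<le> t \<le> s u\<close>. After
  exchanging the integrals, the exponential bound on the level sets of \<open>s\<close> leaves the Gamma integral \<open>\<integral>p t\<^sup>p\<^sup>-\<^sup>1 exp (- t) dt = p!\<close>.
\<close>

lemma nn_integral_ball_moment_le:
  fixes q :: "'e::euclidean_space"
  assumes q: "(norm q)\<^sup>2 = DIM('e)" and p: "p > 0"
  shows "(\<integral>\<^sup>+u. ennreal ((u \<bullet> q) ^ (2 * p)) * indicator (cball 0 1) u \<partial>lborel)
    \<le> ennreal (2 * fact p * 2 ^ p) * emeasure lborel (cball (0 :: 'e) 1)"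
proof -
  let ?B = "cball (0 :: 'e) 1"
  have pair: "pair_sigma_finite (lborel :: real measure) (lborel :: 'e measure)" ..
  define s where "s u = (u \<bullet> q)\<^sup>2 / 2" for u
  have s: "s u \<ge> 0" for u by (simp add: s_def)
  have [measurable]: "s \<in> borel_measurable borel" unfolding s_def[abs_def] by measurable
  have [measurable]: "?B \<in> sets borel" by simp
  define k where "k t u = ennreal (real p * t ^ (p - 1)) * indicator {0..} t * (indicator ?B u * indicator {t..} (s u))" for t u
  have k_meas: "(\<lambda>(t, u). k t u) \<in> borel_measurable (lborel \<Otimes>\<^sub>M lborel)"
  proof -
    have "(\<lambda>(t, u). k t u) = (\<lambda>(t, u). ennreal (real p * t ^ (p - 1)) * indicator {0..} t * (indicator ?B u * (if t \<le> s u then 1 else 0)))"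
      by (auto simp: k_def indicator_def fun_eq_iff)
    also have "\<dots> \<in> borel_measurable (lborel \<Otimes>\<^sub>M lborel)" by measurable
    finally show ?thesis .
  qed
  have "(\<integral>\<^sup>+u. ennreal (s u ^ p) * indicator ?B u \<partial>lborel) = (\<integral>\<^sup>+u. (\<integral>\<^sup>+t. k t u \<partial>lborel) \<partial>lborel)"
  proof (intro nn_integral_cong)
    fix u
    have "(\<integral>\<^sup>+t. k t u \<partial>lborel) = (\<integral>\<^sup>+t. (ennreal (real p * t ^ (p - 1)) * indicator {0..s u} t) * indicator ?B u \<partial>lborel)"
      by (intro nn_integral_cong) (auto simp: k_def indicator_def)
    also have "\<dots> = ennreal (s u ^ p) * indicator ?B u"
      using nn_integral_layer_power[OF s p, of u] by (subst nn_integral_multc) auto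
    finally show "ennreal (s u ^ p) * indicator ?B u = (\<integral>\<^sup>+t. k t u \<partial>lborel)" by simp
  qed
  also have "\<dots> = (\<integral>\<^sup>+t. (\<integral>\<^sup>+u. k t u \<partial>lborel) \<partial>lborel)"
    by (rule pair_sigma_finite.Fubini'[OF pair k_meas])
  also have "\<dots> \<le> (\<integral>\<^sup>+t. ennreal (2 * p) * emeasure lborel ?B * (ennreal (t ^ (p - 1) * exp (- t)) * indicator {0..} t) \<partial>lborel)"
  proof (intro nn_integral_mono)
    fix t :: real
    show "(\<integral>\<^sup>+u. k t u \<partial>lborel) \<le> ennreal (2 * p) * emeasure lborel ?B * (ennreal (t ^ (p - 1) * exp (- t)) * indicator {0..} t)"
    proof (cases "t \<ge> 0")
      case True
      have eq: "{u \<in> ?B. t \<le> s u} = ?B \<inter> {u. t \<le> s u}" by auto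
      have meas: "{u \<in> ?B. t \<le> s u} \<in> sets lborel" unfolding eq by measurable
      have "(\<integral>\<^sup>+u. k t u \<partial>lborel) = (\<integral>\<^sup>+u. ennreal (real p * t ^ (p - 1)) * indicator {u \<in> ?B. t \<le> s u} u \<partial>lborel)"
        using True by (intro nn_integral_cong) (auto simp: k_def indicator_def)
      also have "\<dots> = ennreal (real p * t ^ (p - 1)) * emeasure lborel {u \<in> ?B. t \<le> s u}"
        using meas by (rule nn_integral_cmult_indicator)
      also have "\<dots> \<le> ennreal (real p * t ^ (p - 1)) * (ennreal (2 * exp (- t)) * emeasure lborel ?B)"
        using emeasure_slab_complement_le[OF q True] unfolding s_def by (intro mult_left_mono) auto
      also have "\<dots> = ennreal (2 * p) * emeasure lborel ?B * ennreal (t ^ (p - 1) * exp (- t))"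
      proof -
        have "ennreal (real p * t ^ (p - 1)) * ennreal (2 * exp (- t)) = ennreal (2 * p) * ennreal (t ^ (p - 1) * exp (- t))"
          using True by (simp add: ac_simps flip: ennreal_mult)
        then show ?thesis by (metis mult.assoc mult.commute)
      qed
      finally show ?thesis using True by simp
    qed (simp add: k_def)
  qed
  also have "\<dots> = ennreal (2 * p) * emeasure lborel ?B * ennreal (fact (p - 1))"
    by (subst nn_integral_cmult) (auto simp: nn_intergal_power_times_exp_Ici)
  also have "\<dots> = ennreal (2 * fact p) * emeasure lborel ?B"
  proof -
    have "ennreal (2 * p) * ennreal (fact (p - 1)) = ennreal (2 * fact p)"
      using p by (simp add: fact_reduce[of p] mult.assoc flip: ennreal_mult)
    then show ?thesis by (metis mult.assoc mult.commute)
  qed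
  finally have main: "(\<integral>\<^sup>+u. ennreal (s u ^ p) * indicator ?B u \<partial>lborel) \<le> ennreal (2 * fact p) * emeasure lborel ?B" .
  have "(\<integral>\<^sup>+u. ennreal ((u \<bullet> q) ^ (2 * p)) * indicator ?B u \<partial>lborel)
      = (\<integral>\<^sup>+u. ennreal (2 ^ p) * (ennreal (s u ^ p) * indicator ?B u) \<partial>lborel)"
  proof (intro nn_integral_cong)
    fix u
    have "(u \<bullet> q) ^ (2 * p) = 2 ^ p * s u ^ p" by (simp add: s_def power_mult flip: power_mult_distrib)
    then show "ennreal ((u \<bullet> q) ^ (2 * p)) * indicator ?B u = ennreal (2 ^ p) * (ennreal (s u ^ p) * indicator ?B u)"
      using s[of u] by (simp add: ennreal_mult mult.assoc)
  qed
  also have "\<dots> = ennreal (2 ^ p) * (\<integral>\<^sup>+u. ennreal (s u ^ p) * indicator ?B u \<partial>lborel)"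
    by (rule nn_integral_cmult) measurable
  also have "\<dots> \<le> ennreal (2 ^ p) * (ennreal (2 * fact p) * emeasure lborel ?B)"
    using main by (rule mult_left_mono) simp
  also have "\<dots> = ennreal (2 * fact p * 2 ^ p) * emeasure lborel ?B"
    by (simp add: mult.assoc[symmetric] ennreal_mult[symmetric]) (simp add: mult_ac)
  finally show ?thesis .
qed

text \<open>
  Where \<open>\<bar>u \<bullet> q z\<bar>\<close> exceeds \<open>s\<close> for some \<open>z\<close>, the assumed comparison of maximum and mean forces the mean of
  \<open>(u \<bullet> q w) ^ (2 p)\<close> to be at least \<open>s ^ (2 p) / N\<close> (when \<open>N > 0\<close>). By Markov's inequality and the moment bound for each \<open>q w\<close>
  this happens on at most half of the ball.
\<close>

lemma half_ball_le_sublevel: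
  fixes q :: "'z \<Rightarrow> 'e::euclidean_space"
  assumes M: "prob_space M"
    and q_meas [measurable]: "q \<in> borel_measurable M"
    and q: "\<And>z. z \<in> space M \<Longrightarrow> (norm (q z))\<^sup>2 = DIM('e)"
    and p: "p > 0" and s: "s > 0" and N: "N \<ge> 0"
    and H: "\<And>u z. z \<in> space M \<Longrightarrow> (u \<bullet> q z) ^ (2 * p) \<le> N * integral\<^sup>L M (\<lambda>w. (u \<bullet> q w) ^ (2 * p))"
    and big: "4 * N * fact p * 2 ^ p \<le> s ^ (2 * p)"
  shows "measure lborel (cball (0 :: 'e) 1) / 2 \<le> measure lborel (cball 0 1 \<inter> (\<Inter>z\<in>space M. {u. \<bar>u \<bullet> q z\<bar> \<le> s}))"
proof -
  interpret M: prob_space M by fact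
  interpret pair_sigma_finite M "lborel :: 'e measure" ..
  let ?B = "cball (0 :: 'e) 1"
  let ?G = "?B \<inter> (\<Inter>z\<in>space M. {u. \<bar>u \<bullet> q z\<bar> \<le> s})"
  have "closed ?G"
    by (intro closed_Int closed_INT closed_cball ballI closed_Collect_le continuous_intros)
  then have G [measurable]: "?G \<in> sets borel" by simp
  have Bm [measurable]: "?B \<in> sets borel" by simp
  have fin: "emeasure lborel ?B < \<infinity>" by (simp add: emeasure_cball)
  have int: "integrable M (\<lambda>w. (u \<bullet> q w) ^ (2 * p))" for u
  proof (rule M.integrable_const_bound[where B = "(norm u * sqrt DIM('e)) ^ (2 * p)"])
    show "AE z in M. norm ((u \<bullet> q z) ^ (2 * p)) \<le> (norm u * sqrt (real DIM('e))) ^ (2 * p)"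
    proof (rule AE_I2)
      fix z assume "z \<in> space M"
      then have "norm (q z) = sqrt DIM('e)" using q by (metis norm_ge_zero real_sqrt_unique)
      then have "\<bar>u \<bullet> q z\<bar> \<le> norm u * sqrt DIM('e)" using Cauchy_Schwarz_ineq2[of u "q z"] by simp
      then show "norm ((u \<bullet> q z) ^ (2 * p)) \<le> (norm u * sqrt (real DIM('e))) ^ (2 * p)"
        by (simp add: power_abs power_mono)
    qed
  qed measurable
  have ev: "(u \<bullet> q w) ^ (2 * p) \<ge> 0" for u w by (simp add: power_mult)
  define k where "k w u = ennreal ((u \<bullet> q w) ^ (2 * p)) * indicator ?B u" for w u
  have k_meas: "(\<lambda>(w, u). k w u) \<in> borel_measurable (M \<Otimes>\<^sub>M lborel)"
    and k_meas': "(\<lambda>(u, w). k w u) \<in> borel_measurable (lborel \<Otimes>\<^sub>M M)"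
    unfolding k_def by measurable
  have bad: "ennreal (s ^ (2 * p)) * indicator (?B - ?G) u \<le> ennreal N * (\<integral>\<^sup>+w. k w u \<partial>M)" for u
  proof (cases "u \<in> ?B - ?G")
    case True
    then obtain z where z: "z \<in> space M" "s < \<bar>u \<bullet> q z\<bar>" by (auto simp: not_le)
    have "s ^ (2 * p) \<le> \<bar>u \<bullet> q z\<bar> ^ (2 * p)" using z s by (intro power_mono) auto
    also have "\<dots> = (u \<bullet> q z) ^ (2 * p)" by (simp add: power_even_abs)
    also have "\<dots> \<le> N * integral\<^sup>L M (\<lambda>w. (u \<bullet> q w) ^ (2 * p))" by (rule H[OF z(1)])
    finally have "ennreal (s ^ (2 * p)) \<le> ennreal N * ennreal (integral\<^sup>L M (\<lambda>w. (u \<bullet> q w) ^ (2 * p)))"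
      using N by (subst ennreal_mult[symmetric]) (auto intro!: ennreal_leI integral_nonneg_AE simp: ev)
    also have "ennreal (integral\<^sup>L M (\<lambda>w. (u \<bullet> q w) ^ (2 * p))) = (\<integral>\<^sup>+w. ennreal ((u \<bullet> q w) ^ (2 * p)) \<partial>M)"
      by (rule nn_integral_eq_integral[symmetric]) (auto simp: int ev)
    finally show ?thesis using True by (simp add: k_def)
  qed simp
  have "ennreal (s ^ (2 * p)) * emeasure lborel (?B - ?G)
      = (\<integral>\<^sup>+u. ennreal (s ^ (2 * p)) * indicator (?B - ?G) u \<partial>lborel)"
    by (rule nn_integral_cmult_indicator[symmetric]) simp
  also have "\<dots> \<le> (\<integral>\<^sup>+u. ennreal N * (\<integral>\<^sup>+w. k w u \<partial>M) \<partial>lborel)"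
    by (intro nn_integral_mono bad)
  also have "\<dots> = ennreal N * (\<integral>\<^sup>+u. (\<integral>\<^sup>+w. k w u \<partial>M) \<partial>lborel)"
    by (intro nn_integral_cmult M.borel_measurable_nn_integral k_meas')
  also have "(\<integral>\<^sup>+u. (\<integral>\<^sup>+w. k w u \<partial>M) \<partial>lborel) = (\<integral>\<^sup>+w. (\<integral>\<^sup>+u. k w u \<partial>lborel) \<partial>M)"
    by (rule Fubini'[OF k_meas])
  also have "\<dots> \<le> (\<integral>\<^sup>+w. ennreal (2 * fact p * 2 ^ p) * emeasure lborel ?B \<partial>M)"
    using nn_integral_ball_moment_le[OF q p] unfolding k_def by (intro nn_integral_mono) auto
  also have "\<dots> = ennreal (2 * fact p * 2 ^ p) * emeasure lborel ?B"
    by (simp add: M.emeasure_space_1)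
  finally have "ennreal (s ^ (2 * p)) * emeasure lborel (?B - ?G)
      \<le> ennreal N * (ennreal (2 * fact p * 2 ^ p) * emeasure lborel ?B)"
    by (simp add: mult_left_mono)
  moreover have fm: "?B \<in> fmeasurable lborel" "?G \<in> fmeasurable lborel" "?B - ?G \<in> fmeasurable lborel"
  proof -
    show B: "?B \<in> fmeasurable lborel" using fin by (intro fmeasurableI) auto
    have "?G \<in> sets lborel" "?B - ?G \<in> sets lborel" using G Bm by (simp_all only: sets_lborel sets.Diff)
    then show "?G \<in> fmeasurable lborel" "?B - ?G \<in> fmeasurable lborel"
      using fmeasurableI2[OF B] by blast+
  qed
  ultimately have "s ^ (2 * p) * measure lborel (?B - ?G) \<le> N * (2 * fact p * 2 ^ p) * measure lborel ?B"
    using N s by (simp add: emeasure_eq_measure2 fmeasurableD2 emeasure_eq_ennreal_measure ennreal_mult[symmetric] mult.assoc)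
  also have "\<dots> \<le> s ^ (2 * p) / 2 * measure lborel ?B"
    using big by (intro mult_right_mono) auto
  finally have "measure lborel (?B - ?G) \<le> measure lborel ?B / 2"
    using s by simp
  moreover have "measure lborel (?B - ?G) = measure lborel ?B - measure lborel ?G"
    using fm by (intro measure_Diff) (auto simp: fmeasurableD2)
  ultimately show ?thesis by simp
qed

section \<open>Numerical estimates\<close>

text \<open>
  The ratio of the right-hand sides for \<open>m + 1\<close> and \<open>m\<close> is at least twice \<open>m + 1\<close>, by Bernoulli's inequality.
\<close>

lemma fact_power2_le: "fact m * 2 ^ m \<le> (real m + 1) ^ m"
proof (induction m)
  case (Suc m)
  have bern: "2 * (real m + 1) ^ Suc m \<le> (real m + 2) ^ Suc m"
  proof -
    have "1 + real (Suc m) * (1 / (real m + 1)) \<le> (1 + 1 / (real m + 1)) ^ Suc m"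
      by (rule Bernoulli_inequality) (simp add: order.trans[of _ 0])
    then have "2 \<le> ((real m + 2) / (real m + 1)) ^ Suc m"
      by (simp add: field_simps del: power_Suc)
    then show ?thesis
      by (simp add: power_divide field_simps del: power_Suc)
  qed
  have "fact (Suc m) * 2 ^ Suc m = 2 * (real m + 1) * (fact m * 2 ^ m)"
    by (simp add: algebra_simps)
  also have "\<dots> \<le> 2 * (real m + 1) * (real m + 1) ^ m"
    using Suc by (intro mult_left_mono) auto
  also have "\<dots> = 2 * (real m + 1) ^ Suc m" by simp
  also note bern
  finally show ?case by (simp add: add.commute)
qed simp

text \<open>
  A single term of the binomial expansion of \<open>(4/5 + 1/5) ^ (5 n)\<close> is at most one.
\<close>

lemma binomial_5n_le: "real ((4 * n + n - 1) choose (4 * n)) \<le> (3125 / 256) ^ n"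
proof -
  have le: "real ((4 * n + n - 1) choose (4 * n)) \<le> real ((5 * n) choose (4 * n))"
    by (intro of_nat_mono binomial_right_mono) simp
  have "real ((5 * n) choose (4 * n)) * ((4/5) ^ (4 * n) * (1/5) ^ n) \<le> 1"
  proof -
    have "real ((5 * n) choose (4 * n)) * (4/5) ^ (4 * n) * (1/5) ^ (5 * n - 4 * n)
        \<le> (\<Sum>k\<le>5 * n. real ((5 * n) choose k) * (4/5) ^ k * (1/5) ^ (5 * n - k))"
      by (rule member_le_sum) auto
    also have "\<dots> = (4/5 + 1/5 :: real) ^ (5 * n)" by (rule binomial_ring[symmetric])
    finally show ?thesis by (simp add: mult.assoc)
  qed
  also have "(4/5 :: real) ^ (4 * n) * (1/5) ^ n = (256 / 3125) ^ n"
    unfolding power_mult power_mult_distrib[symmetric] by (simp add: power_divide)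
  finally have "real ((5 * n) choose (4 * n)) \<le> (3125 / 256) ^ n"
    by (simp add: power_divide field_simps)
  with le show ?thesis by simp
qed

text \<open>
  The condition of \<open>half_ball_le_sublevel\<close> for \<open>p = 2 n\<close> and \<open>s = 6 sqrt n\<close>. Up to the factor \<open>4\<close>, the left-hand
  side is at most the power \<open>2 n\<close> of \<open>3125/256 \<cdot> (2 n + 1) \<le> 3125/256 \<cdot> 7/3 \<cdot> n\<close>, and
  \<open>36 = 27648/21875 \<cdot> 3125/256 \<cdot> 7/3\<close>; from \<open>n = 3\<close> on, the power of the remaining quotient absorbs the \<open>4\<close>.
\<close>

lemma radius_bound:
  assumes n: "n \<ge> 3"
  shows "4 * (real ((4 * n + n - 1) choose (4 * n)))\<^sup>2 * fact (2 * n) * 2 ^ (2 * n) \<le> (6 * sqrt (real n)) ^ (2 * (2 * n))"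
proof -
  have "(real ((4 * n + n - 1) choose (4 * n)))\<^sup>2 \<le> ((3125 / 256) ^ n)\<^sup>2"
    by (intro power_mono binomial_5n_le) auto
  moreover have "fact (2 * n) * 2 ^ (2 * n) \<le> (real (2 * n) + 1) ^ (2 * n)" by (rule fact_power2_le)
  moreover have "(real (2 * n) + 1) ^ (2 * n) \<le> (7 / 3 * real n) ^ (2 * n)"
    using n by (intro power_mono) auto
  ultimately have "(real ((4 * n + n - 1) choose (4 * n)))\<^sup>2 * (fact (2 * n) * 2 ^ (2 * n))
      \<le> ((3125 / 256) ^ n)\<^sup>2 * (7 / 3 * real n) ^ (2 * n)"
    by (intro mult_mono) auto
  moreover have "(4 :: real) \<le> (27648 / 21875) ^ (2 * n)"
  proof -
    have "(4 :: real) \<le> (27648 / 21875) ^ 6" by (simp add: power_divide)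
    also have "\<dots> \<le> (27648 / 21875) ^ (2 * n)" using n by (intro power_increasing) auto
    finally show ?thesis .
  qed
  ultimately have "4 * ((real ((4 * n + n - 1) choose (4 * n)))\<^sup>2 * (fact (2 * n) * 2 ^ (2 * n)))
      \<le> (27648 / 21875) ^ (2 * n) * (((3125 / 256) ^ n)\<^sup>2 * (7 / 3 * real n) ^ (2 * n))"
    by - (rule mult_mono, auto)
  also have "\<dots> = (27648 / 21875 * (3125 / 256) * (7 / 3 * real n)) ^ (2 * n)"
    unfolding power_even_eq[symmetric] power_mult_distrib[symmetric] by (simp only: mult.assoc)
  also have "\<dots> = ((6 * sqrt (real n)) ^ 2) ^ (2 * n)"
    by (simp add: power_mult_distrib)
  finally show ?thesis
    by (simp only: mult.assoc power_mult[of "6 * sqrt (real n)" 2 "2 * n"])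
qed

lemma dim_M_ge:
  assumes "n \<ge> 3"
  shows "dim_M n \<ge> 26"
proof -
  define c where "c = (n + 1) choose 2"
  have c2: "2 * c = (n + 1) * n" unfolding c_def by (simp add: choose_two)
  have "2 * (n + 3) \<le> (n + 1) * n"
  proof -
    have "(n + 1) * n \<ge> (n + 1) * 3" using assms by (intro mult_left_mono) auto
    then show ?thesis using assms by simp
  qed
  then have "n + 3 \<le> c" using c2 by simp
  then have "(n + 3)\<^sup>2 \<le> c\<^sup>2" by (rule power_mono) simp
  moreover have "(n + 3)\<^sup>2 = n\<^sup>2 + 6 * n + 9" by (simp add: power2_eq_square algebra_simps)
  ultimately have "c\<^sup>2 \<ge> n\<^sup>2 + 27" using assms by linarith
  then show ?thesis unfolding dim_M_def c_def[symmetric] by linarith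
qed

text \<open>
  It suffices that \<open>162\<close> times the root of \<open>2\<close> of order \<open>26\<close> is at most \<open>10 powr (20 / 9)\<close>. The rational numbers
  \<open>1.029\<close> and \<open>166.8\<close> separate the two sides.
\<close>

lemma constant_bound:
  assumes D: "D \<ge> 26"
  shows "(3 :: real) ^ 3 * 10 powr (- 20 / 9) \<le> (1 / 6) * (1 / 2) powr (1 / real D)"
proof -
  define t :: real where "t = 10 powr (20 / 9)"
  define h :: real where "h = 2 powr (1 / 26)"
  have pos: "t > 0" "h > 0" by (simp_all add: t_def h_def)
  have t: "t ^ 9 = 10 ^ 20"
    by (simp add: t_def powr_power)
  have h: "h ^ 26 = 2"
    by (simp add: h_def powr_power)
  have "h \<le> 1029 / 1000"
  proof (rule power_le_imp_le_base)
    show "h ^ Suc 25 \<le> (1029 / 1000) ^ Suc 25"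
      using h by (simp add: power_divide)
  qed simp
  moreover have "1668 / 10 \<le> t"
  proof (rule power_le_imp_le_base)
    show "(1668 / 10) ^ Suc 8 \<le> t ^ Suc 8"
      using t by (simp add: power_divide)
  qed (use pos in simp)
  ultimately have "162 * h \<le> t" by simp
  then have *: "27 / t \<le> (1 / 6) * (1 / h)" using pos by (simp add: field_simps)
  have h_inv: "1 / h = (1 / 2) powr (1 / 26)" by (simp add: h_def powr_divide)
  have mono: "(1 / 2 :: real) powr (1 / 26) \<le> (1 / 2) powr (1 / real D)"
  proof (rule powr_mono')
    show "1 / real D \<le> 1 / 26" using D by (intro divide_left_mono) auto
  qed auto
  have "(- 20 / 9 :: real) = - (20 / 9)" by simp
  then have "10 powr (- 20 / 9) = 1 / t"
    unfolding t_def by (simp only: powr_minus_divide)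
  then have "3 ^ 3 * 10 powr (- 20 / 9) = 27 / t" by simp
  then show ?thesis using * mono unfolding h_inv by linarith
qed

section \<open>The volume bound\<close>

text \<open>
  A function of mean zero that is bounded below by \<open>-1\<close> satisfies \<open>\<bar>f\<bar> \<le> f + 2\<close>, so its \<open>L\<^sup>1\<close> norm is at most \<open>2\<close>.
  This makes the convex body bounded.
\<close>

lemma abs_average_le:
  fixes \<sigma> :: "'z measure" and f :: "'z \<Rightarrow> real"
  assumes \<sigma>: "prob_space \<sigma>" and int: "integrable \<sigma> f" "integrable \<sigma> (\<lambda>z. f z * f z)"
    and mean: "integral\<^sup>L \<sigma> f = 0"
    and lower: "\<And>z. z \<in> space \<sigma> \<Longrightarrow> - 1 \<le> f z" and C: "\<And>z. z \<in> space \<sigma> \<Longrightarrow> \<bar>f z\<bar> \<le> C"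
  shows "integral\<^sup>L \<sigma> (\<lambda>z. f z * f z) \<le> 2 * C"
proof -
  interpret prob_space \<sigma> by fact
  obtain z0 where z0: "z0 \<in> space \<sigma>" using not_empty by blast
  have C0: "C \<ge> 0" using C[OF z0] by linarith
  have "integral\<^sup>L \<sigma> (\<lambda>z. f z * f z) \<le> integral\<^sup>L \<sigma> (\<lambda>z. C * (f z + 2))"
  proof (rule integral_mono)
    fix z assume z: "z \<in> space \<sigma>"
    have "f z * f z = \<bar>f z\<bar> * \<bar>f z\<bar>" by (simp add: abs_mult_self_eq)
    also have "\<dots> \<le> C * (f z + 2)"
      using C[OF z] lower[OF z] C0 by (intro mult_mono) auto
    finally show "f z * f z \<le> C * (f z + 2)" .
  qed (use int in auto)
  also have "\<dots> = 2 * C" using int mean by (simp add: prob_space)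
  finally show ?thesis .
qed

text \<open>
  The body is compact, so its measure is finite and bounds the measure of the scaled sublevel set that it contains.
\<close>

lemma Pos_tilde_volume_ge:
  assumes n: "CARD('n::finite) \<ge> 3"
  shows "Vol_M (ball_M :: 'n Q set) > 0"
    and "Vol_M (Pos_tilde :: 'n Q set) \<ge>
      (1 / (6 * sqrt (real CARD('n)))) ^ dim_M CARD('n) * (Vol_M (ball_M :: 'n Q set) / 2)"
proof -
  let ?n = "CARD('n)" and ?D = "dim_M CARD('n)"
  let ?\<sigma> = "frame_measure :: ((real^'n) \<times> (real^'n)) measure"
  let ?B = "cball (0 :: real ^ 'n M_index) 1"
  interpret \<sigma>: prob_space ?\<sigma> by (rule prob_space_frame_measure[OF n])
  have sp: "space ?\<sigma> = frames" by (rule space_frame_measure[OF n])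
  have n2: "?n \<ge> 2" using n by simp
  have D: "DIM(real ^ 'n M_index) = ?D" using card_M_index[OF n2] by simp
  have Dpos: "?D > 0" using dim_M_pos[OF n2] .
  define \<phi> :: "real ^ 'n M_index \<Rightarrow> 'n Q" where "\<phi> = (SOME \<phi>. isometry_M \<phi>)"
  have iso: "isometry_M \<phi>" unfolding \<phi>_def using isometry_exists[OF n] by (rule someI_ex)
  have Vol: "Vol_M A = measure lebesgue (\<phi> -` A)" for A by (simp add: Vol_M_def \<phi>_def)
  have rng: "\<phi> u \<in> M_Q" and ip: "inner_M (\<phi> u) (\<phi> v) = u \<bullet> v" for u v
    using iso by (auto simp: isometry_M_def)
  define q :: "(real^'n) \<times> (real^'n) \<Rightarrow> real ^ 'n M_index" where "q z = (\<chi> i. Q_val (\<phi> (axis i 1)) z)" for z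
  have eval: "Q_val (\<phi> u) z = u \<bullet> q z" if "z \<in> frames" for u z
    using isometry_expand[OF n iso that, of u] by (simp add: q_def inner_vec_def)
  have qnorm: "(norm (q z))\<^sup>2 = ?D" if "z \<in> frames" for z
    unfolding power2_norm_eq_inner using isometry_kernel[OF n iso that]
    by (simp add: inner_vec_def q_def power2_eq_square)
  have "q \<in> borel_measurable ?\<sigma>"
  proof (rule measurable_frame_measureI[OF n])
    show "continuous_on frames q"
      unfolding q_def by (intro continuous_intros continuous_on_Q_val)
  qed
  note q_meas = this
  have ball: "\<phi> -` ball_M = ?B"
    using rng ip by (auto simp: ball_M_def norm_eq_sqrt_inner)
  have norms_int: "integral\<^sup>L ?\<sigma> (Q_val Q_norms) = 1"
    using inner_M_norms[OF n, of Q_norms] inner_M_norms_norms[OF n] by simp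
  define K where "K = (\<Inter>z\<in>frames. {u :: real ^ 'n M_index. - 1 \<le> u \<bullet> q z})"
  \<comment> \<open>Adding \<open>Q_norms\<close>, which is \<open>1\<close> on frames, turns \<open>u \<bullet> q z \<ge> -1\<close> into nonnegativity.\<close>
  have Pos: "\<phi> -` Pos_tilde = K"
  proof -
    have "\<phi> u + Q_norms \<in> H_Q" for u
    proof -
      have "inner_M (\<phi> u + Q_norms) Q_norms = 1"
        using rng[of u] by (simp add: inner_M_add[OF n] inner_M_norms_norms[OF n] M_Q_iff[OF n])
      then show ?thesis by (simp add: H_Q_def inner_M_norms[OF n])
    qed
    moreover have "\<phi> u + Q_norms \<in> Pos_Q \<longleftrightarrow> u \<in> K" for u
      unfolding Pos_Q_iff_frames[OF n2] K_def
      using eval[of _ u] by (auto simp: Q_val_add frames_in_variety[OF n] Q_val_norms_frames[OF n])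
    ultimately show ?thesis by (auto simp: Pos_tilde_def)
  qed
  have "closed K" unfolding K_def by (intro closed_INT ballI closed_Collect_le continuous_intros)
  moreover have "K \<subseteq> cball 0 (2 * sqrt ?D)"
  proof
    fix u assume u: "u \<in> K"
    have "integral\<^sup>L ?\<sigma> (\<lambda>z. Q_val (\<phi> u) z * Q_val (\<phi> u) z) \<le> 2 * (norm u * sqrt ?D)"
    proof (rule abs_average_le[OF \<sigma>.prob_space_axioms])
      show "integrable ?\<sigma> (Q_val (\<phi> u))" "integrable ?\<sigma> (\<lambda>z. Q_val (\<phi> u) z * Q_val (\<phi> u) z)"
        by (intro integrable_frame_measureI[OF n] continuous_intros continuous_on_Q_val)+
      show "integral\<^sup>L ?\<sigma> (Q_val (\<phi> u)) = 0" using rng[of u] by (simp add: M_Q_def)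
      show "- 1 \<le> Q_val (\<phi> u) z" if "z \<in> space ?\<sigma>" for z
        using u that by (simp add: K_def sp eval)
      show "\<bar>Q_val (\<phi> u) z\<bar> \<le> norm u * sqrt ?D" if z: "z \<in> space ?\<sigma>" for z
      proof -
        have "norm (q z) = sqrt ?D" using qnorm z by (metis sp norm_ge_zero real_sqrt_unique)
        then show ?thesis using Cauchy_Schwarz_ineq2[of u "q z"] z by (simp add: sp eval)
      qed
    qed
    then have "norm u * norm u \<le> norm u * (2 * sqrt ?D)"
      using ip[of u u] by (simp add: inner_M_def norm_eq_sqrt_inner mult_ac)
    then show "u \<in> cball 0 (2 * sqrt ?D)" by (cases "u = 0") auto
  qed
  ultimately have "compact K"
    by (meson bounded_cball bounded_subset compact_eq_bounded_closed)
  then have K: "K \<in> lmeasurable" by (rule lmeasurable_compact)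
  define s where "s = 6 * sqrt (real ?n)"
  have s: "s > 0" by (simp add: s_def)
  define G where "G = ?B \<inter> (\<Inter>z\<in>frames. {u. \<bar>u \<bullet> q z\<bar> \<le> s})"
  have G: "measure lborel ?B / 2 \<le> measure lborel G"
    unfolding G_def sp[symmetric]
  proof (rule half_ball_le_sublevel[where p = "2 * ?n"
        and N = "(real ((4 * ?n + ?n - 1) choose (4 * ?n)))\<^sup>2"])
    show "(norm (q z))\<^sup>2 = DIM(real ^ 'n M_index)" if "z \<in> space ?\<sigma>" for z
      using that qnorm by (simp add: sp D del: DIM_cart)
    show "(u \<bullet> q z) ^ (2 * (2 * ?n)) \<le> (real ((4 * ?n + ?n - 1) choose (4 * ?n)))\<^sup>2 *
        integral\<^sup>L ?\<sigma> (\<lambda>w. (u \<bullet> q w) ^ (2 * (2 * ?n)))" if z: "z \<in> space ?\<sigma>" for u z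
    proof -
      have "integral\<^sup>L ?\<sigma> (\<lambda>w. (u \<bullet> q w) ^ (2 * (2 * ?n))) = integral\<^sup>L ?\<sigma> (\<lambda>w. Q_val (\<phi> u) w ^ (2 * (2 * ?n)))"
        by (intro Bochner_Integration.integral_cong) (auto simp: sp eval)
      then show ?thesis
        using Q_val_power_le[OF n, of z "\<phi> u" "2 * ?n"] z
        by (simp add: sp eval card_bimonoms power2_eq_square)
    qed
    show "4 * (real ((4 * ?n + ?n - 1) choose (4 * ?n)))\<^sup>2 * fact (2 * ?n) * 2 ^ (2 * ?n) \<le> s ^ (2 * (2 * ?n))"
      unfolding s_def by (rule radius_bound[OF n])
  qed (use s q_meas \<sigma>.prob_space_axioms in auto)
  have "closed G" unfolding G_def
    by (intro closed_Int closed_INT closed_cball ballI closed_Collect_le continuous_intros)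
  then have Gb: "G \<in> sets borel" by simp
  have sub: "(\<lambda>u. (1 / s) *\<^sub>R u + 0) ` G \<subseteq> K"
  proof
    fix v assume "v \<in> (\<lambda>u. (1 / s) *\<^sub>R u + 0) ` G"
    then obtain u where u: "u \<in> G" "v = (1 / s) *\<^sub>R u" by auto
    have "- 1 \<le> v \<bullet> q z" if z: "z \<in> frames" for z
    proof -
      have "\<bar>u \<bullet> q z\<bar> \<le> s" using u(1) z by (auto simp: G_def)
      then have "\<bar>v \<bullet> q z\<bar> \<le> 1" using s by (simp add: u(2))
      then show ?thesis by linarith
    qed
    then show "v \<in> K" by (auto simp: K_def)
  qed
  have Bb: "measure lebesgue ?B = measure lborel ?B" and GG: "measure lebesgue G = measure lborel G"
    using Gb by (auto intro!: measure_completion)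
  show "Vol_M (ball_M :: 'n Q set) > 0"
    unfolding Vol ball Bb by (simp add: content_cball unit_ball_vol_pos)
  have "(1 / s) ^ ?D * (measure lebesgue ?B / 2) \<le> (1 / s) ^ ?D * measure lebesgue G"
    using G s unfolding Bb GG by (intro mult_left_mono) auto
  also have "\<dots> = measure lebesgue ((\<lambda>u. (1 / s) *\<^sub>R u + 0) ` G)"
    using measure_lebesgue_affine[of "1 / s" 0 G] s D by simp
  also have "\<dots> \<le> measure lebesgue K"
  proof (rule measure_mono_fmeasurable[OF sub _ K])
    show "(\<lambda>u. (1 / s) *\<^sub>R u + 0) ` G \<in> sets lebesgue"
    proof -
      have "closed ((*\<^sub>R) (1 / s) ` G)" using \<open>closed G\<close> by (rule closed_scaling)
      then show ?thesis by (simp add: borel_closed)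
    qed
  qed
  finally show "Vol_M (Pos_tilde :: 'n Q set) \<ge>
      (1 / (6 * sqrt (real ?n))) ^ ?D * (Vol_M (ball_M :: 'n Q set) / 2)"
    by (simp only: Vol Pos ball s_def)
qed

theorem theorem4p5:
  assumes "CARD('n::finite) \<ge> 3"
  shows "3 ^ 3 * 10 powr (- 20 / 9) / sqrt (real CARD('n))
    \<le> (Vol_M (Pos_tilde :: 'n Q set) / Vol_M (ball_M :: 'n Q set)) powr (1 / real (dim_M CARD('n)))"
proof -
  let ?D = "dim_M CARD('n)"
  define r where "r = 1 / (6 * sqrt (real CARD('n)))"
  define V where "V = Vol_M (ball_M :: 'n Q set)"
  have r: "r > 0" by (simp add: r_def)
  have D: "?D \<ge> 26" using dim_M_ge[OF assms] .
  have V: "V > 0" "r ^ ?D * (V / 2) \<le> Vol_M (Pos_tilde :: 'n Q set)"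
    using Pos_tilde_volume_ge[OF assms] by (simp_all add: V_def r_def)
  have "3 ^ 3 * 10 powr (- 20 / 9) / sqrt (real CARD('n)) \<le> (1 / 6) * (1 / 2) powr (1 / real ?D) / sqrt (real CARD('n))"
    by (intro divide_right_mono constant_bound D) simp
  also have "\<dots> = r * (1 / 2) powr (1 / real ?D)" by (simp add: r_def)
  also have "r = (r ^ ?D) powr (1 / real ?D)"
    using r D by (simp add: powr_powr flip: powr_realpow)
  also have "(r ^ ?D) powr (1 / real ?D) * (1 / 2) powr (1 / real ?D) = (r ^ ?D * (1 / 2)) powr (1 / real ?D)"
    by (rule powr_mult[symmetric])
  also have "\<dots> \<le> (Vol_M (Pos_tilde :: 'n Q set) / V) powr (1 / real ?D)"
    using V r by (intro powr_mono2) (auto simp: field_simps)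
  finally show ?thesis by (simp add: V_def)
qed

end
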